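(* Let $(M^n,g)$ be an $n$-dimensional closed Riemannian manifold with non-negative Ricci curvature, let $c>0$ be a constant, and let $f:M\times[0,\infty)\to\mathbb{R}$ be a positive solution of $f_t=\Delta f+cf(1-f)$, where $f$ is $C^2$ in $x$ and $C^1$ in $t$. Let $u=\log f$. Let $\alpha,\beta$ be real constants such that (i) $0<\alpha<1$, (ii) $\beta\le \dfrac{-cn(1+\alpha)}{4\alpha^2-4\alpha+2n}<0$. (a) If in addition (iii) $\dfrac{8\beta(1-\alpha)}{n}+c<0$, then for all $x\in M$ and all $t>0$ $$\Delta u+\alpha|\nabla u|^2+\beta e^u+\phi_0(t)\ge 0,\qquad \phi_0(t)=\frac{\left(\frac{\beta cn}{cn+8\beta(1-\alpha)}\right)e^{-ct}-\beta}{1-e^{-ct}}.$$ (b) If instead of (iii) one has (iv) $\dfrac{8\beta(1-\alpha)}{n}+c\ge 0$, then for all $x\in M$ and all $t>0$ $$\Delta u+\alpha|\nabla u|^2+\beta e^u+\phi_0(t)\ge 0,$$ where, with $T_2:=\dfrac{n}{2(1-\alpha)(-\beta c)}\left(\dfrac{4\beta(1-\alpha)}{n}+c\right)$, $$\phi_0(t)=\begin{cases}\dfrac{n}{2(1-\alpha)t}, & t\le T_2,\\[2mm] \dfrac{-\beta c\,(e^{c(t-T_2)}+1)}{c+\frac{8\beta(1-\alpha)}{n}+c\,e^{c(t-T_2)}}, & t>T_2.\end{cases}$$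
   Context: Closed means compact without boundary. $\Delta$, $\nabla$ and $|\cdot|$ are the Laplace–Beltrami operator ($\Delta=\operatorname{div}\nabla$), gradient and norm of $g$, acting in the space variable $x$. *)

theory Defs
  imports "HOL-Analysis.Analysis"
begin

subsection \<open>Calculus on open subsets of Euclidean space\<close>

definition partial :: "'n::finite \<Rightarrow> (real^'n \<Rightarrow> 'b::real_normed_vector) \<Rightarrow> real^'n \<Rightarrow> 'b"
  where "partial i F y = frechet_derivative F (at y) (axis i 1)"

text \<open>\<open>Ck_on\<close> is the usual class $C^k$ only for open \<open>S\<close>, the only case in which it is used.\<close>

primrec Ck_on :: "nat \<Rightarrow> (real^'n::finite) set \<Rightarrow> (real^'n \<Rightarrow> 'b::real_normed_vector) \<Rightarrow> bool"
  where
    "Ck_on 0 S F \<longleftrightarrow> continuous_on S F"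
  | "Ck_on (Suc k) S F \<longleftrightarrow> F differentiable_on S \<and> (\<forall>i. Ck_on k S (partial i F))"

definition smooth_on :: "(real^'n::finite) set \<Rightarrow> (real^'n \<Rightarrow> 'b::real_normed_vector) \<Rightarrow> bool"
  where "smooth_on S F \<longleftrightarrow> (\<forall>k. Ck_on k S F)"


subsection \<open>Smooth manifolds\<close>

text \<open>
  A manifold is a set \<open>M\<close> in a Hausdorff space, with the subspace topology, together with a
  (not necessarily maximal) smooth atlas. Charts take values in open subsets of \<open>real^'n\<close>,
  so there is no boundary and the dimension is \<open>CARD('n)\<close>.
\<close>

type_synonym ('a, 'n) chart = "'a set \<times> ('a \<Rightarrow> real^'n)"

definition cdom :: "('a, 'n::finite) chart \<Rightarrow> 'a set"
  where "cdom \<kappa> = fst \<kappa>"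

definition cmap :: "('a, 'n::finite) chart \<Rightarrow> 'a \<Rightarrow> real^'n"
  where "cmap \<kappa> = snd \<kappa>"

definition cran :: "('a, 'n::finite) chart \<Rightarrow> (real^'n) set"
  where "cran \<kappa> = cmap \<kappa> ` cdom \<kappa>"

definition cinv :: "('a, 'n::finite) chart \<Rightarrow> real^'n \<Rightarrow> 'a"
  where "cinv \<kappa> = inv_into (cdom \<kappa>) (cmap \<kappa>)"

definition smooth_atlas :: "'a::t2_space set \<Rightarrow> ('a, 'n::finite) chart set \<Rightarrow> bool"
  where "smooth_atlas M A \<longleftrightarrow>
    (\<Union>\<kappa>\<in>A. cdom \<kappa>) = M \<and>
    (\<forall>\<kappa>\<in>A. openin (top_of_set M) (cdom \<kappa>) \<and> open (cran \<kappa>) \<and>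
       homeomorphism (cdom \<kappa>) (cran \<kappa>) (cmap \<kappa>) (cinv \<kappa>)) \<and>
    (\<forall>\<kappa>\<in>A. \<forall>\<kappa>'\<in>A. smooth_on (cmap \<kappa> ` (cdom \<kappa> \<inter> cdom \<kappa>')) (cmap \<kappa>' \<circ> cinv \<kappa>))"


subsection \<open>Riemannian metrics\<close>

text \<open>
  A Riemannian metric is given by its component matrices: \<open>g \<kappa> y $ i $ j\<close> is
  $g(\partial_i, \partial_j)$ in the chart \<open>\<kappa>\<close>, at the point with coordinates \<open>y\<close>.
  The last conjunct of the definition says that the components in different charts
  describe the same bilinear form on the tangent space.
\<close>

type_synonym ('a, 'n) metric = "('a, 'n) chart \<Rightarrow> real^'n \<Rightarrow> real^'n^'n"

definition riemannian_metric :: "('a, 'n::finite) chart set \<Rightarrow> ('a, 'n) metric \<Rightarrow> bool"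
  where "riemannian_metric A g \<longleftrightarrow>
    (\<forall>\<kappa>\<in>A. smooth_on (cran \<kappa>) (g \<kappa>) \<and>
       (\<forall>y\<in>cran \<kappa>. transpose (g \<kappa> y) = g \<kappa> y \<and> (\<forall>v. v \<noteq> 0 \<longrightarrow> (g \<kappa> y *v v) \<bullet> v > 0))) \<and>
    (\<forall>\<kappa>\<in>A. \<forall>\<kappa>'\<in>A. \<forall>p\<in>cdom \<kappa> \<inter> cdom \<kappa>'. \<forall>v w.
       let D = frechet_derivative (cmap \<kappa>' \<circ> cinv \<kappa>) (at (cmap \<kappa> p))
       in (g \<kappa> (cmap \<kappa> p) *v v) \<bullet> w = (g \<kappa>' (cmap \<kappa>' p) *v D v) \<bullet> D w)"

definition closed_riemannian_manifold ::
    "'a::t2_space set \<Rightarrow> ('a, 'n::finite) chart set \<Rightarrow> ('a, 'n) metric \<Rightarrow> bool"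
  where "closed_riemannian_manifold M A g \<longleftrightarrow>
    compact M \<and> smooth_atlas M A \<and> riemannian_metric A g"


subsection \<open>Geometry in coordinates\<close>

text \<open>Throughout, \<open>G\<close> is the component matrix of a metric on an open subset of \<open>real^'n\<close>.
  \<open>christoffel G k i j\<close> is $\Gamma^k_{ij}$.\<close>

definition christoffel ::
    "(real^'n::finite \<Rightarrow> real^'n^'n) \<Rightarrow> 'n \<Rightarrow> 'n \<Rightarrow> 'n \<Rightarrow> real^'n \<Rightarrow> real"
  where "christoffel G k i j y =
    (1/2) * (\<Sum>l\<in>UNIV. matrix_inv (G y) $ k $ l *
      (partial i (\<lambda>z. G z $ j $ l) y + partial j (\<lambda>z. G z $ i $ l) y
        - partial l (\<lambda>z. G z $ i $ j) y))"

text \<open>\<open>curvature G l i j k\<close> is the coefficient of $\partial_l$ in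
  $R(\partial_i,\partial_j)\partial_k$, where
  $R(X,Y)Z = \nabla_X\nabla_Y Z - \nabla_Y\nabla_X Z - \nabla_{[X,Y]}Z$. The Ricci tensor is
  $\mathrm{Ric}(Y,Z) = \mathrm{tr}(X \mapsto R(X,Y)Z)$, which is positive on round spheres.\<close>

definition curvature ::
    "(real^'n::finite \<Rightarrow> real^'n^'n) \<Rightarrow> 'n \<Rightarrow> 'n \<Rightarrow> 'n \<Rightarrow> 'n \<Rightarrow> real^'n \<Rightarrow> real"
  where "curvature G l i j k y =
    partial i (christoffel G l j k) y - partial j (christoffel G l i k) y +
    (\<Sum>m\<in>UNIV. christoffel G l i m y * christoffel G m j k y
            - christoffel G l j m y * christoffel G m i k y)"

definition ricci :: "(real^'n::finite \<Rightarrow> real^'n^'n) \<Rightarrow> 'n \<Rightarrow> 'n \<Rightarrow> real^'n \<Rightarrow> real"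
  where "ricci G j k y = (\<Sum>i\<in>UNIV. curvature G i i j k y)"

definition coord_grad ::
    "(real^'n::finite \<Rightarrow> real^'n^'n) \<Rightarrow> (real^'n \<Rightarrow> real) \<Rightarrow> real^'n \<Rightarrow> real^'n"
  where "coord_grad G F y = matrix_inv (G y) *v (\<chi> j. partial j F y)"

text \<open>The divergence is the trace of the covariant derivative, $\nabla_i X^i$.\<close>

definition coord_div ::
    "(real^'n::finite \<Rightarrow> real^'n^'n) \<Rightarrow> (real^'n \<Rightarrow> real^'n) \<Rightarrow> real^'n \<Rightarrow> real"
  where "coord_div G X y =
    (\<Sum>i\<in>UNIV. partial i (\<lambda>z. X z $ i) y + (\<Sum>j\<in>UNIV. christoffel G i i j y * X y $ j))"


subsection \<open>Geometry on a Riemannian manifold\<close>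

definition nonneg_ricci :: "('a, 'n::finite) chart set \<Rightarrow> ('a, 'n) metric \<Rightarrow> bool"
  where "nonneg_ricci A g \<longleftrightarrow>
    (\<forall>\<kappa>\<in>A. \<forall>y\<in>cran \<kappa>. \<forall>v::real^'n.
       (\<Sum>j\<in>UNIV. \<Sum>k\<in>UNIV. ricci (g \<kappa>) j k y * v $ j * v $ k) \<ge> 0)"

text \<open>The norm of the gradient and the Laplacian are independent of the chart in which they
  are computed; \<open>chart_at\<close> only selects one.\<close>

definition chart_at :: "('a, 'n::finite) chart set \<Rightarrow> 'a \<Rightarrow> ('a, 'n) chart"
  where "chart_at A p = (SOME \<kappa>. \<kappa> \<in> A \<and> p \<in> cdom \<kappa>)"

definition grad_norm ::
    "('a, 'n::finite) chart set \<Rightarrow> ('a, 'n) metric \<Rightarrow> ('a \<Rightarrow> real) \<Rightarrow> 'a \<Rightarrow> real"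
  where "grad_norm A g h p =
    (let \<kappa> = chart_at A p; y = cmap \<kappa> p; X = coord_grad (g \<kappa>) (h \<circ> cinv \<kappa>) y
     in sqrt ((g \<kappa> y *v X) \<bullet> X))"

definition laplacian ::
    "('a, 'n::finite) chart set \<Rightarrow> ('a, 'n) metric \<Rightarrow> ('a \<Rightarrow> real) \<Rightarrow> 'a \<Rightarrow> real"
  where "laplacian A g h p =
    (let \<kappa> = chart_at A p
     in coord_div (g \<kappa>) (coord_grad (g \<kappa>) (h \<circ> cinv \<kappa>)) (cmap \<kappa> p))"


subsection \<open>Time-dependent functions\<close>

text \<open>Time runs through \<open>{0..}\<close>, so at \<open>t = 0\<close> this is the right derivative.\<close>

definition time_deriv :: "('a \<Rightarrow> real \<Rightarrow> real) \<Rightarrow> 'a \<Rightarrow> real \<Rightarrow> real"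
  where "time_deriv f p t = vector_derivative (f p) (at t within {0..})"

text \<open>$C^2$ in space and $C^1$ in time, in the usual parabolic sense: the derivatives
  involved exist and are jointly continuous on $M \times [0,\infty)$.\<close>

definition C21 :: "('a, 'n::finite) chart set \<Rightarrow> ('a \<Rightarrow> real \<Rightarrow> real) \<Rightarrow> bool"
  where "C21 A f \<longleftrightarrow>
    (\<forall>\<kappa>\<in>A. let F = (\<lambda>t y. f (cinv \<kappa> y) t); Q = cran \<kappa> \<times> {0..} in
       (\<forall>t\<ge>0. Ck_on 2 (cran \<kappa>) (F t)) \<and>
       (\<forall>p\<in>cdom \<kappa>. f p differentiable_on {0..}) \<and>
       continuous_on Q (\<lambda>(y, t). F t y) \<and>
       (\<forall>i. continuous_on Q (\<lambda>(y, t). partial i (F t) y)) \<and>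
       (\<forall>i j. continuous_on Q (\<lambda>(y, t). partial i (partial j (F t)) y)) \<and>
       continuous_on Q (\<lambda>(y, t). time_deriv f (cinv \<kappa> y) t))"

end

theory Submission
  imports Defs
begin

text \<open>
  Put $h = \Delta u + \alpha |\nabla u|^2 + \beta e^u + \phi_0$. By the Bochner formula,
  $h_t - \Delta h - 2 \langle \nabla u, \nabla h \rangle$ is positive at a negative minimum of \<open>h\<close>: with
  $k = 2 (1 - \alpha) / n$ it is bounded below by a polynomial in $|\nabla u|^2$ and $e^u$ whose mixed term is
  controlled by (ii) and whose part in $e^u$ is nonnegative because of the choice of $\phi_0$. Since
  $h \to \infty$ as $t \to 0$, the maximum principle gives $h \ge 0$.

  As \<open>f\<close> is only $C^2$ in space and $C^1$ in time, \<open>h\<close> cannot be differentiated. By the equation,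
  $f (h - \phi_0) = f_t - (1 - \alpha) |\nabla f|^2 / f + (\beta + c) f^2 - c f$. At a minimum, the gradient term is
  replaced by its linearisation in a fixed vector field, which leaves an expression of first order, linear in
  the derivatives of \<open>f\<close>. There $f_t$ and $\nabla f$ are approximated by difference quotients, to which the
  parabolic operator can be applied; their commutator with the Laplacian is of second order, so the
  inequality at the minimum survives in the limit.
\<close>

subsection \<open>Positive semidefinite matrices\<close>

text \<open>At a minimum of value m < 0 put X = |grad u|^2, E = e^u, p = \<phi>_0 - m, so \<Delta>u
  = -(\<alpha> X + \<beta> E + p). What must be positive is k (\<alpha> X + \<beta> E + p)^2 + c E
  (p + (1 - \<alpha>) X + \<beta>) - 2 (\<beta> + c) E X + \<phi>_0'. The coefficient of X E,
  multiplied by n, is -\<beta> (4 \<alpha>^2 - 4 \<alpha> + 2 n) - c n (1 + \<alpha>); hence the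
  quotient in (ii). The part free of X is k \<beta>^2 E^2 + B(p) E + k p^2 + \<phi>_0' with B(p) =
  (2 k \<beta> + c) p + \<beta> c. At p = \<phi>_0 its discriminant in E vanishes if \<phi>_0' = c
  (\<phi>_0 + \<beta>) (w \<phi>_0 + \<beta> c) / (4 k \<beta>^2), where w = 4 k \<beta> + c is the
  number in (iii) and (iv). If w < 0, this equation has a solution that comes down from infinity at
  t = 0: \<phi>_0 in (a). If w \<ge> 0 it has none; but then B(\<phi>_0) \<ge> 0 as long as \<phi>_0
  is large, so \<phi>_0' = -k \<phi>_0^2 suffices, solved by 1/(k t), up to the time T_2 where
  B(\<phi>_0) = 0.\<close>

lemma quadform_shift:
  fixes a :: "'n::finite \<Rightarrow> 'n \<Rightarrow> real"
  assumes sym: "\<And>i j. a i j = a j i"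
  shows "(\<Sum>i\<in>UNIV. \<Sum>j\<in>UNIV. a i j * (v i + (if i = o' then x else 0)) * (v j + (if j = o' then x else 0)))
    = (\<Sum>i\<in>UNIV. \<Sum>j\<in>UNIV. a i j * v i * v j) + 2 * x * (\<Sum>j\<in>UNIV. a o' j * v j) + x\<^sup>2 * a o' o'"
proof -
  have "(\<Sum>i\<in>UNIV. \<Sum>j\<in>UNIV. a i j * (v i + (if i = o' then x else 0)) * (v j + (if j = o' then x else 0)))
    = (\<Sum>i\<in>UNIV. \<Sum>j\<in>UNIV. a i j * v i * v j)
      + (\<Sum>i\<in>UNIV. \<Sum>j\<in>UNIV. a i j * v i * (if j = o' then x else 0))
      + (\<Sum>i\<in>UNIV. if i = o' then (\<Sum>j\<in>UNIV. a i j * x * v j) else 0)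
      + (\<Sum>i\<in>UNIV. if i = o' then (\<Sum>j\<in>UNIV. a i j * x * (if j = o' then x else 0)) else 0)"
    unfolding sum.distrib[symmetric]
    by (intro sum.cong refl) (auto simp: algebra_simps sum.distrib)
  also have "\<dots> = (\<Sum>i\<in>UNIV. \<Sum>j\<in>UNIV. a i j * v i * v j) + (\<Sum>i\<in>UNIV. a i o' * v i * x)
      + (\<Sum>j\<in>UNIV. a o' j * x * v j) + a o' o' * x * x"
    by (simp add: if_distrib[of "\<lambda>z. _ * z"] sum.delta cong: if_cong)
  also have "(\<Sum>i\<in>UNIV. a i o' * v i * x) = x * (\<Sum>j\<in>UNIV. a o' j * v j)"
    by (simp add: sum_distrib_left sym[of _ o'] mult_ac)
  also have "(\<Sum>i\<in>UNIV. a o' i * x * v i) = x * (\<Sum>j\<in>UNIV. a o' j * v j)"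
    by (simp add: sum_distrib_left mult_ac)
  finally show ?thesis by (simp add: power2_eq_square)
qed

text \<open>Gaussian elimination: subtracting the rank one matrix of a pivot column keeps
  the matrix positive semidefinite and clears the row and column of the pivot.\<close>

lemma psd_factor_on:
  fixes a :: "'n::finite \<Rightarrow> 'n \<Rightarrow> real"
  assumes "finite I" "\<And>i j. a i j = a j i" "\<And>v. (\<Sum>i\<in>UNIV. \<Sum>j\<in>UNIV. a i j * v i * v j) \<ge> 0"
    and "\<And>i j. i \<notin> I \<Longrightarrow> a i j = 0"
  shows "\<exists>q. \<forall>i j. a i j = (\<Sum>k\<in>I. q k i * q k j)"
  using assms
proof (induction I arbitrary: a rule: finite_induct)
  case empty
  then show ?case by auto
next
  case (insert p I)
  note sym = insert.prems(1) and psd = insert.prems(2) and supp = insert.prems(3)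
  have shift: "0 \<le> (\<Sum>i\<in>UNIV. \<Sum>j\<in>UNIV. a i j * v i * v j) + 2 * x * (\<Sum>j\<in>UNIV. a p j * v j) + x\<^sup>2 * a p p" for v x
    using psd[of "\<lambda>i. v i + (if i = p then x else 0)"] quadform_shift[of a v p x] sym by simp
  show ?case
  proof (cases "a p p = 0")
    case True
    \<comment> \<open>With a zero pivot the form at e_j + x e_p is affine in x, so its slope has to
      vanish; the x chosen below gives the value -1.\<close>
    have row: "a p j = 0" for j
    proof (rule ccontr)
      assume nz: "a p j \<noteq> 0"
      have "0 \<le> a j j + 2 * x * a p j" for x
        using shift[of "\<lambda>i. if i = j then 1 else 0" x] True
        by (simp add: if_distrib[of "\<lambda>z. _ * z"] sum.delta cong: if_cong)
      from this[of "- (a j j + 1) / (2 * a p j)"] nz show False by (simp add: field_simps)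
    qed
    have "\<exists>q. \<forall>i j. a i j = (\<Sum>k\<in>I. q k i * q k j)"
      by (rule insert.IH[OF sym psd]) (use supp row in \<open>metis insert_iff\<close>)
    then obtain q where q: "\<And>i j. a i j = (\<Sum>k\<in>I. q k i * q k j)" by auto
    have "a i j = (\<Sum>k\<in>insert p I. (q(p := (\<lambda>_. 0))) k i * (q(p := (\<lambda>_. 0))) k j)" for i j
      unfolding q using insert.hyps by (simp add: sum.insert) (intro sum.cong, auto)
    then show ?thesis by blast
  next
    case False
    have "a p p \<ge> 0"
      using psd[of "\<lambda>i. if i = p then 1 else 0"]
      by (simp add: if_distrib[of "\<lambda>z. _ * z"] sum.delta cong: if_cong)
    with False have pos: "a p p > 0" by simp
    define b where "b i j = a i j - a p i * a p j / a p p" for i j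
    have "\<exists>q. \<forall>i j. b i j = (\<Sum>k\<in>I. q k i * q k j)"
    proof (rule insert.IH)
      show "b i j = b j i" for i j by (simp add: b_def sym[of i j])
      show "b i j = 0" if "i \<notin> I" for i j
      proof (cases "i = p")
        case True then show ?thesis using pos by (simp add: b_def)
      next
        case False then show ?thesis using supp[of i] sym[of p i] that by (simp add: b_def)
      qed
      show "0 \<le> (\<Sum>i\<in>UNIV. \<Sum>j\<in>UNIV. b i j * v i * v j)" for v
      proof -
        define r where "r = (\<Sum>j\<in>UNIV. a p j * v j)"
        have "(\<Sum>i\<in>UNIV. \<Sum>j\<in>UNIV. b i j * v i * v j)
           = (\<Sum>i\<in>UNIV. \<Sum>j\<in>UNIV. a i j * v i * v j) - (\<Sum>i\<in>UNIV. \<Sum>j\<in>UNIV. (a p i * v i) * (a p j * v j)) / a p p"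
          by (simp add: b_def sum_subtractf[symmetric] sum_divide_distrib algebra_simps)
        also have "(\<Sum>i\<in>UNIV. \<Sum>j\<in>UNIV. (a p i * v i) * (a p j * v j)) = r * r"
          by (simp add: r_def sum_product)
        finally have *: "(\<Sum>i\<in>UNIV. \<Sum>j\<in>UNIV. b i j * v i * v j) = (\<Sum>i\<in>UNIV. \<Sum>j\<in>UNIV. a i j * v i * v j) - r * r / a p p" .
        \<comment> \<open>\<open>- r / a p p\<close> minimises the shifted form over x, and the
          minimum is the form of the Schur complement \<open>b\<close>.\<close>
        show ?thesis unfolding *
          using shift[of v "- r / a p p", folded r_def] pos by (simp add: power2_eq_square)
      qed
    qed
    then obtain q where q: "\<And>i j. b i j = (\<Sum>k\<in>I. q k i * q k j)" by auto
    define q' where "q' = q(p := (\<lambda>i. a p i / sqrt (a p p)))"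
    have "a i j = (\<Sum>k\<in>insert p I. q' k i * q' k j)" for i j
    proof -
      have "(\<Sum>k\<in>I. q' k i * q' k j) = b i j"
        unfolding q using insert.hyps by (intro sum.cong) (auto simp: q'_def)
      then show ?thesis using insert.hyps pos by (simp add: q'_def b_def)
    qed
    then show ?thesis by blast
  qed
qed

text \<open>The factorisation replaces diagonalisation: for the inverse metric, the rows of
  \<open>q\<close> play the part of an orthonormal frame.\<close>

lemma psd_factor:
  fixes a :: "'n::finite \<Rightarrow> 'n \<Rightarrow> real"
  assumes "\<And>i j. a i j = a j i" "\<And>v. (\<Sum>i\<in>UNIV. \<Sum>j\<in>UNIV. a i j * v i * v j) \<ge> 0"
  obtains q :: "'n \<Rightarrow> 'n \<Rightarrow> real" where "\<And>i j. a i j = (\<Sum>k\<in>UNIV. q k i * q k j)"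
  proof -
  have "\<exists>q. \<forall>i j. a i j = (\<Sum>k\<in>(UNIV::'n set). q k i * q k j)"
    by (rule psd_factor_on) (use assms in auto)
  then show thesis using that by blast
qed

text \<open>Writing \<open>a\<close> as a sum of squares makes the contraction a sum of values of
  the form \<open>b\<close> on the rows of \<open>q\<close>. At a minimum \<open>a\<close> is the
  inverse metric and \<open>b\<close> the matrix of second derivatives.\<close>

lemma psd_trace_nonneg:
  fixes a b :: "'n::finite \<Rightarrow> 'n \<Rightarrow> real"
  assumes "\<And>i j. a i j = a j i" "\<And>v. (\<Sum>i\<in>UNIV. \<Sum>j\<in>UNIV. a i j * v i * v j) \<ge> 0"
    and b: "\<And>v. (\<Sum>i\<in>UNIV. \<Sum>j\<in>UNIV. b i j * v i * v j) \<ge> 0"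
  shows "(\<Sum>i\<in>UNIV. \<Sum>j\<in>UNIV. a i j * b i j) \<ge> 0"
proof -
  obtain q :: "'n \<Rightarrow> 'n \<Rightarrow> real" where q: "\<And>i j. a i j = (\<Sum>k\<in>UNIV. q k i * q k j)"
    using psd_factor[of a] assms by metis
  have "(\<Sum>i\<in>UNIV. \<Sum>j\<in>UNIV. a i j * b i j) = (\<Sum>i\<in>UNIV. \<Sum>j\<in>UNIV. \<Sum>k\<in>UNIV. b i j * q k i * q k j)"
    by (simp add: q sum_distrib_right sum_distrib_left mult_ac)
  also have "\<dots> = (\<Sum>i\<in>UNIV. \<Sum>k\<in>UNIV. \<Sum>j\<in>UNIV. b i j * q k i * q k j)"
    by (intro sum.cong refl sum.swap)
  also have "\<dots> = (\<Sum>k\<in>UNIV. \<Sum>i\<in>UNIV. \<Sum>j\<in>UNIV. b i j * q k i * q k j)"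
    by (rule sum.swap)
  also have "\<dots> \<ge> 0" by (intro sum_nonneg b)
  finally show ?thesis .
qed

text \<open>\<open>H\<close> has one index raised and need not be a symmetric matrix. With a = q^T q
  the matrix s = q S q^T is symmetric and has the same trace as \<open>H\<close>, also after
  squaring. So the claim is Cauchy-Schwarz for the diagonal of \<open>s\<close>, compared with the
  sum of all squared entries.\<close>

lemma psd_trace_square:
  fixes a S H :: "'n::finite \<Rightarrow> 'n \<Rightarrow> real"
  assumes "\<And>i j. a i j = a j i" "\<And>v. (\<Sum>i\<in>UNIV. \<Sum>j\<in>UNIV. a i j * v i * v j) \<ge> 0"
    and S: "\<And>i j. S i j = S j i"
    and H: "\<And>i j. H i j = (\<Sum>m\<in>UNIV. a i m * S m j)"
  shows "(\<Sum>i\<in>UNIV. H i i)\<^sup>2 \<le> CARD('n) * (\<Sum>i\<in>UNIV. \<Sum>j\<in>UNIV. H i j * H j i)"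
proof -
  obtain q :: "'n \<Rightarrow> 'n \<Rightarrow> real" where q: "\<And>i j. a i j = (\<Sum>k\<in>UNIV. q k i * q k j)"
    using psd_factor[of a] assms by metis
  define s where "s k l = (\<Sum>m\<in>UNIV. \<Sum>j\<in>UNIV. q k m * S m j * q l j)" for k l
  define w where "w k j = (\<Sum>m\<in>UNIV. q k m * S m j)" for k j
  have Hw: "H i j = (\<Sum>k\<in>UNIV. q k i * w k j)" for i j
    unfolding H q w_def sum_distrib_left sum_distrib_right by (subst sum.swap) (simp add: mult_ac)
  have sw: "s k l = (\<Sum>j\<in>UNIV. w k j * q l j)" for k l
    unfolding s_def w_def sum_distrib_right by (rule sum.swap)
  have ssym: "s k l = s l k" for k l
    unfolding s_def by (subst sum.swap) (simp add: S mult_ac)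
  have tr: "(\<Sum>i\<in>UNIV. H i i) = (\<Sum>k\<in>UNIV. s k k)"
    unfolding Hw sw by (subst sum.swap) (simp add: mult_ac)
  have "(\<Sum>i\<in>UNIV. \<Sum>j\<in>UNIV. H i j * H j i)
      = (\<Sum>i\<in>UNIV. \<Sum>j\<in>UNIV. \<Sum>k\<in>UNIV. \<Sum>l\<in>UNIV. (w k j * q l j) * (w l i * q k i))"
    unfolding Hw sum_product by (simp add: mult_ac)
  also have "\<dots> = (\<Sum>i\<in>UNIV. \<Sum>k\<in>UNIV. \<Sum>j\<in>UNIV. \<Sum>l\<in>UNIV. (w k j * q l j) * (w l i * q k i))"
    by (intro sum.cong refl sum.swap)
  also have "\<dots> = (\<Sum>i\<in>UNIV. \<Sum>k\<in>UNIV. \<Sum>l\<in>UNIV. \<Sum>j\<in>UNIV. (w k j * q l j) * (w l i * q k i))"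
    by (intro sum.cong refl sum.swap)
  also have "\<dots> = (\<Sum>i\<in>UNIV. \<Sum>k\<in>UNIV. \<Sum>l\<in>UNIV. s k l * (w l i * q k i))"
    by (simp add: sw sum_distrib_right)
  also have "\<dots> = (\<Sum>k\<in>UNIV. \<Sum>i\<in>UNIV. \<Sum>l\<in>UNIV. s k l * (w l i * q k i))"
    by (rule sum.swap)
  also have "\<dots> = (\<Sum>k\<in>UNIV. \<Sum>l\<in>UNIV. \<Sum>i\<in>UNIV. s k l * (w l i * q k i))"
    by (intro sum.cong refl sum.swap)
  also have "\<dots> = (\<Sum>k\<in>UNIV. \<Sum>l\<in>UNIV. s k l * s l k)"
    by (simp add: sw sum_distrib_left)
  also have "\<dots> = (\<Sum>k\<in>UNIV. \<Sum>l\<in>UNIV. (s k l)\<^sup>2)"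
    by (simp add: ssym power2_eq_square)
  finally have HH: "(\<Sum>i\<in>UNIV. \<Sum>j\<in>UNIV. H i j * H j i) = (\<Sum>k\<in>UNIV. \<Sum>l\<in>UNIV. (s k l)\<^sup>2)" .
  have "(\<Sum>k\<in>UNIV. s k k)\<^sup>2 \<le> (\<Sum>k\<in>(UNIV::'n set). 1\<^sup>2) * (\<Sum>k\<in>UNIV. (s k k)\<^sup>2)"
    using Cauchy_Schwarz_ineq_sum[of "\<lambda>_. 1" "\<lambda>k. s k k" "UNIV :: 'n set"] by simp
  also have "\<dots> = CARD('n) * (\<Sum>k\<in>UNIV. (s k k)\<^sup>2)" by simp
  also have "\<dots> \<le> CARD('n) * (\<Sum>k\<in>UNIV. \<Sum>l\<in>UNIV. (s k l)\<^sup>2)"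
    by (intro mult_left_mono sum_mono member_le_sum[of _ UNIV "\<lambda>l. (s _ l)\<^sup>2"]) auto
  finally show ?thesis unfolding tr HH .
qed

subsection \<open>Partial derivatives\<close>

lemma partialI: "(F has_derivative F') (at y) \<Longrightarrow> partial i F y = F' (axis i 1)"
  unfolding partial_def using frechet_derivative_at by metis

text \<open>Both functions have the same derivatives at \<open>y\<close>, and
  \<open>frechet_derivative\<close> selects from these alone; this covers points where neither is
  differentiable.\<close>

lemma partial_cong:
  assumes "open S" "y \<in> S" "\<And>z. z \<in> S \<Longrightarrow> F z = H z"
  shows "partial i F y = partial i H y"
proof -
  have "(F has_derivative F') (at y) = (H has_derivative F') (at y)" for F'
    using assms has_derivative_transform_within_open[of F F' y UNIV S H]
      has_derivative_transform_within_open[of H F' y UNIV S F] by auto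
  then show ?thesis by (simp add: partial_def frechet_derivative_def)
qed

lemma differentiable_cong:
  assumes "open S" "y \<in> S" "\<And>z. z \<in> S \<Longrightarrow> F z = H z" "F differentiable at y"
  shows "H differentiable at y"
  using assms has_derivative_transform_within_open[of F _ y UNIV S H]
  unfolding differentiable_def by blast

lemma frechet_eq_partial:
  assumes "F differentiable at y"
  shows "frechet_derivative F (at y) v = (\<Sum>i\<in>UNIV. v $ i *\<^sub>R partial i F y)"
proof -
  have lin: "linear (frechet_derivative F (at y))"
    using assms by (rule linear_frechet_derivative)
  have "frechet_derivative F (at y) v = frechet_derivative F (at y) (\<Sum>i\<in>UNIV. v $ i *\<^sub>R axis i 1)"
    using basis_expansion[of v] by (simp add: scalar_mult_eq_scaleR)
  also have "\<dots> = (\<Sum>i\<in>UNIV. v $ i *\<^sub>R partial i F y)"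
    by (simp add: partial_def linear_sum[OF lin] linear_scale[OF lin])
  finally show ?thesis .
qed

lemma has_derivative_partial:
  assumes "F differentiable at y"
  shows "(F has_derivative (\<lambda>v. \<Sum>i\<in>UNIV. v $ i *\<^sub>R partial i F y)) (at y)"
proof -
  have "frechet_derivative F (at y) = (\<lambda>v. \<Sum>i\<in>UNIV. v $ i *\<^sub>R partial i F y)"
    using frechet_eq_partial[OF assms] by blast
  then show ?thesis using assms frechet_derivative_works by metis
qed

lemma directional_derivative:
  fixes F :: "real^'n::finite \<Rightarrow> real"
  assumes "F differentiable at (y + s *\<^sub>R v)"
  shows "((\<lambda>s. F (y + s *\<^sub>R v)) has_real_derivative (\<Sum>i\<in>UNIV. v $ i * partial i F (y + s *\<^sub>R v))) (at s)"
proof -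
  have "((\<lambda>s. F (y + s *\<^sub>R v)) has_derivative
      (\<lambda>h. \<Sum>i\<in>UNIV. (h *\<^sub>R v) $ i *\<^sub>R partial i F (y + s *\<^sub>R v))) (at s)"
    by (rule has_derivative_compose[where f = "\<lambda>s. y + s *\<^sub>R v" and g = F, OF _ has_derivative_partial[OF assms]])
      (auto intro!: derivative_eq_intros)
  then show ?thesis
    unfolding has_field_derivative_def
    by (rule has_derivative_eq_rhs) (rule ext, simp add: sum_distrib_left mult_ac)
qed

lemma partial_const [simp]: "partial i (\<lambda>_. c) = (\<lambda>_. 0)"
  by (rule ext, subst partialI[OF has_derivative_const]) simp

lemma partial_add:
  "F differentiable at y \<Longrightarrow> H differentiable at y \<Longrightarrow>
    partial i (\<lambda>z. F z + H z) y = partial i F y + partial i H y"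
  by (subst partialI[OF has_derivative_add[OF has_derivative_partial has_derivative_partial]])
    (simp_all add: axis_def if_distrib[of "\<lambda>z. z *\<^sub>R _"] cong: if_cong)

lemma partial_diff:
  "F differentiable at y \<Longrightarrow> H differentiable at y \<Longrightarrow>
    partial i (\<lambda>z. F z - H z) y = partial i F y - partial i H y"
  by (subst partialI[OF has_derivative_diff[OF has_derivative_partial has_derivative_partial]])
    (simp_all add: axis_def if_distrib[of "\<lambda>z. z *\<^sub>R _"] cong: if_cong)

lemma partial_mult:
  fixes F H :: "real^'n::finite \<Rightarrow> real"
  shows "F differentiable at y \<Longrightarrow> H differentiable at y \<Longrightarrow>
    partial i (\<lambda>z. F z * H z) y = partial i F y * H y + F y * partial i H y"
  by (subst partialI[OF has_derivative_mult[OF has_derivative_partial has_derivative_partial]])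
    (simp_all add: axis_def if_distrib[of "\<lambda>z. z *\<^sub>R _"] if_distrib[of "\<lambda>z. z * _"] cong: if_cong)

lemma partial_cmult:
  fixes F :: "real^'n::finite \<Rightarrow> real"
  shows "F differentiable at y \<Longrightarrow> partial i (\<lambda>z. c * F z) y = c * partial i F y"
  using partial_mult[of "\<lambda>_. c" y F i] by simp

lemma partial_sum:
  "finite I \<Longrightarrow> (\<And>k. k \<in> I \<Longrightarrow> F k differentiable at y) \<Longrightarrow>
    partial i (\<lambda>z. \<Sum>k\<in>I. F k z) y = (\<Sum>k\<in>I. partial i (F k) y)"
  by (induction I rule: finite_induct) (auto simp: partial_add differentiable_sum)

lemma partial_vec_nth:
  assumes "F differentiable at y"
  shows "(\<lambda>z. F z $ k) differentiable at y" "partial i (\<lambda>z. F z $ k) y = partial i F y $ k"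
proof -
  have *: "((\<lambda>z. F z $ k) has_derivative (\<lambda>v. (\<Sum>i\<in>UNIV. v $ i *\<^sub>R partial i F y) $ k)) (at y)"
    by (rule bounded_linear.has_derivative[OF bounded_linear_vec_nth has_derivative_partial[OF assms]])
  then show "(\<lambda>z. F z $ k) differentiable at y" unfolding differentiable_def by blast
  show "partial i (\<lambda>z. F z $ k) y = partial i F y $ k"
    by (subst partialI[OF *]) (simp add: axis_def if_distrib[of "\<lambda>z. z *\<^sub>R _"] cong: if_cong)
qed

lemma partial_real_comp:
  fixes F :: "real^'n::finite \<Rightarrow> real"
  assumes "F differentiable at y" "(p has_real_derivative d) (at (F y))"
  shows "(\<lambda>z. p (F z)) differentiable at y" "partial i (\<lambda>z. p (F z)) y = d * partial i F y"
proof -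
  have *: "((\<lambda>z. p (F z)) has_derivative (\<lambda>v. d * (\<Sum>i\<in>UNIV. v $ i *\<^sub>R partial i F y))) (at y)"
    by (rule has_derivative_compose[OF has_derivative_partial[OF assms(1)]])
      (use assms(2) in \<open>simp add: has_field_derivative_def\<close>)
  then show "(\<lambda>z. p (F z)) differentiable at y" unfolding differentiable_def by blast
  show "partial i (\<lambda>z. p (F z)) y = d * partial i F y"
    by (subst partialI[OF *]) (simp add: axis_def if_distrib[of "\<lambda>z. z * _"] cong: if_cong)
qed

lemma partial_translate:
  fixes F :: "real^'n::finite \<Rightarrow> 'b::real_normed_vector"
  assumes "F differentiable at (y + e)"
  shows "(\<lambda>z. F (z + e)) differentiable at y" "partial i (\<lambda>z. F (z + e)) y = partial i F (y + e)"
proof -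
  have *: "((\<lambda>z. F (z + e)) has_derivative (\<lambda>v. (\<Sum>i\<in>UNIV. v $ i *\<^sub>R partial i F (y + e)))) (at y)"
    by (rule has_derivative_compose[where f = "\<lambda>z. z + e" and g = F, OF _ has_derivative_partial[OF assms]])
      (auto intro!: derivative_eq_intros)
  then show "(\<lambda>z. F (z + e)) differentiable at y" unfolding differentiable_def by blast
  show "partial i (\<lambda>z. F (z + e)) y = partial i F (y + e)"
    by (subst partialI[OF *]) (simp add: axis_def if_distrib[of "\<lambda>z. z *\<^sub>R _"] cong: if_cong)
qed

lemma partial_nth: "partial i (\<lambda>z::real^'n::finite. z $ k) = (\<lambda>_. if i = k then 1 else 0)"
proof
  fix y :: "real^'n"
  have "((\<lambda>z. z $ k) has_derivative (\<lambda>z. z $ k)) (at y)"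
    by (rule bounded_linear_imp_has_derivative[OF bounded_linear_vec_nth])
  then have "partial i (\<lambda>z. z $ k) y = axis i 1 $ k" by (rule partialI)
  then show "partial i (\<lambda>z. z $ k) y = (if i = k then 1 else 0)"
    unfolding axis_def by auto
qed

subsection \<open>Functions of class $C^k$\<close>

lemma Ck_on_differentiable:
  "Ck_on (Suc k) S F \<Longrightarrow> open S \<Longrightarrow> y \<in> S \<Longrightarrow> F differentiable at y"
  unfolding Ck_on.simps differentiable_on_def using at_within_open[of y S] by metis

lemma Ck_on_cong:
  assumes "open S" "\<And>z. z \<in> S \<Longrightarrow> F z = H z"
  shows "Ck_on k S F \<longleftrightarrow> Ck_on k S H"
  using assms(2)
proof (induction k arbitrary: F H)
  case 0
  then show ?case by (simp cong: continuous_on_cong)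
next
  case (Suc k)
  have "F differentiable_on S \<longleftrightarrow> H differentiable_on S"
    using Suc.prems differentiable_cong[OF assms(1), of _ F H] differentiable_cong[OF assms(1), of _ H F]
    using at_within_open[OF _ assms(1)] unfolding differentiable_on_def by metis
  moreover have "Ck_on k S (partial i F) \<longleftrightarrow> Ck_on k S (partial i H)" for i
    by (rule Suc.IH) (rule partial_cong[OF assms(1)], auto simp: Suc.prems)
  ultimately show ?case by simp
qed

lemma Ck_on_Suc_imp: "Ck_on (Suc k) S F \<Longrightarrow> Ck_on k S F"
  by (induction k arbitrary: F) (simp_all add: differentiable_imp_continuous_on)

lemma Ck_on_const: "Ck_on k S (\<lambda>_. c)"
  by (induction k arbitrary: c) auto

lemma Ck_on_add:
  assumes "open S" "Ck_on k S F" "Ck_on k S H"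
  shows "Ck_on k S (\<lambda>z. F z + H z)"
  using assms(2,3)
proof (induction k arbitrary: F H)
  case (Suc k)
  have "Ck_on k S (partial i (\<lambda>z. F z + H z))" for i
    by (subst Ck_on_cong[OF assms(1), of _ "\<lambda>z. partial i F z + partial i H z"])
      (use Suc assms(1) in \<open>auto intro!: partial_add Ck_on_differentiable\<close>)
  then show ?case using Suc.prems by (auto intro: differentiable_on_add)
qed (auto intro: continuous_intros)

lemma Ck_on_mult:
  fixes F H :: "real^'n::finite \<Rightarrow> real"
  assumes "open S" "Ck_on k S F" "Ck_on k S H"
  shows "Ck_on k S (\<lambda>z. F z * H z)"
  using assms(2,3)
proof (induction k arbitrary: F H)
  case (Suc k)
  have "Ck_on k S (partial i (\<lambda>z. F z * H z))" for i
    by (subst Ck_on_cong[OF assms(1), of _ "\<lambda>z. partial i F z * H z + F z * partial i H z"])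
      (use Suc assms(1) Ck_on_Suc_imp[OF Suc.prems(1)] Ck_on_Suc_imp[OF Suc.prems(2)] in
        \<open>auto intro!: partial_mult Ck_on_differentiable Ck_on_add\<close>)
  then show ?case using Suc.prems by (auto intro: differentiable_on_mult)
qed (auto intro: continuous_intros)

lemma Ck_on_sum:
  assumes "open S" "finite I" "\<And>i. i \<in> I \<Longrightarrow> Ck_on k S (F i)"
  shows "Ck_on k S (\<lambda>z. \<Sum>i\<in>I. F i z)"
  using assms(2,3) by (induction I rule: finite_induct) (auto intro: Ck_on_const Ck_on_add[OF assms(1)])

text \<open>For the Leibniz expansion of a determinant, see \<open>smooth_det\<close>.\<close>

lemma Ck_on_prod:
  fixes F :: "'i \<Rightarrow> real^'n::finite \<Rightarrow> real"
  assumes "open S" "finite I" "\<And>i. i \<in> I \<Longrightarrow> Ck_on k S (F i)"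
  shows "Ck_on k S (\<lambda>z. \<Prod>i\<in>I. F i z)"
  using assms(2,3) by (induction I rule: finite_induct) (auto intro: Ck_on_const Ck_on_mult[OF assms(1)])

lemma Ck_on_diff:
  fixes F H :: "real^'n::finite \<Rightarrow> real"
  assumes "open S" "Ck_on k S F" "Ck_on k S H"
  shows "Ck_on k S (\<lambda>z. F z - H z)"
  using Ck_on_add[OF assms(1,2) Ck_on_mult[OF assms(1) Ck_on_const[of k S "-1"] assms(3)]] by simp

lemma Ck_on_exp:
  fixes F :: "real^'n::finite \<Rightarrow> real"
  assumes "open S" "Ck_on k S F"
  shows "Ck_on k S (\<lambda>z. exp (F z))"
  using assms(2)
proof (induction k arbitrary: F)
  case (Suc k)
  have d: "(\<lambda>z. exp (F z)) differentiable at y" "partial i (\<lambda>z. exp (F z)) y = exp (F y) * partial i F y"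
    if "y \<in> S" for i y
    using partial_real_comp[OF Ck_on_differentiable[OF Suc.prems assms(1) that] DERIV_exp] by auto
  have "Ck_on k S (partial i (\<lambda>z. exp (F z)))" for i
    by (rule iffD2[OF Ck_on_cong[OF assms(1) d(2)]], assumption)
      (use Suc assms(1) Ck_on_Suc_imp[OF Suc.prems] in \<open>auto intro!: Ck_on_mult\<close>)
  then show ?case using d(1) by (auto simp: differentiable_on_def intro: differentiable_at_withinI)
qed (auto intro: continuous_intros)

lemma Ck_on_inverse:
  fixes F :: "real^'n::finite \<Rightarrow> real"
  assumes "open S" "Ck_on k S F" "\<And>y. y \<in> S \<Longrightarrow> F y \<noteq> 0"
  shows "Ck_on k S (\<lambda>z. inverse (F z))"
  using assms(2,3)
proof (induction k arbitrary: F)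
  case (Suc k)
  have d: "(\<lambda>z. inverse (F z)) differentiable at y"
    "partial i (\<lambda>z. inverse (F z)) y = - 1 * (inverse (F y) * inverse (F y)) * partial i F y"
    if "y \<in> S" for i y
    using partial_real_comp[OF Ck_on_differentiable[OF Suc.prems(1) assms(1) that] DERIV_inverse[OF Suc.prems(2)[OF that]]]
    by (auto simp: power2_eq_square)
  have "Ck_on k S (partial i (\<lambda>z. inverse (F z)))" for i
    by (rule iffD2[OF Ck_on_cong[OF assms(1) d(2)]], assumption)
      (intro Ck_on_mult Ck_on_const Suc.IH assms(1) Ck_on_Suc_imp[OF Suc.prems(1)] Suc.prems(2),
        use Suc.prems(1) in simp_all)
  then show ?case using d(1) by (auto simp: differentiable_on_def intro: differentiable_at_withinI)
qed (auto intro!: continuous_on_inverse)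

lemma partial_ln:
  fixes F :: "real^'n::finite \<Rightarrow> real"
  assumes "F differentiable at y" "F y > 0"
  shows "(\<lambda>z. ln (F z)) differentiable at y" "partial i (\<lambda>z. ln (F z)) y = inverse (F y) * partial i F y"
  using partial_real_comp[OF assms(1) DERIV_ln[OF assms(2)]] by auto

lemma Ck_on_ln:
  fixes F :: "real^'n::finite \<Rightarrow> real"
  assumes "open S" "Ck_on k S F" "\<And>y. y \<in> S \<Longrightarrow> F y > 0"
  shows "Ck_on k S (\<lambda>z. ln (F z))"
  using assms(2,3)
proof (induction k arbitrary: F)
  case (Suc k)
  note d = partial_ln[OF Ck_on_differentiable[OF Suc.prems(1) assms(1)] Suc.prems(2)]
  have "Ck_on k S (partial i (\<lambda>z. ln (F z)))" for i
    by (rule iffD2[OF Ck_on_cong[OF assms(1) d(2)]], assumption, assumption,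
        intro Ck_on_mult Ck_on_inverse assms(1) Ck_on_Suc_imp[OF Suc.prems(1)])
      (use Suc.prems in \<open>auto dest!: Suc.prems(2)\<close>)
  then show ?case using d(1) by (auto simp: differentiable_on_def intro: differentiable_at_withinI)
next
  case 0
  then show ?case by (auto intro!: continuous_on_ln) (metis less_irrefl)
qed

lemma Ck_on_vec_nth:
  assumes "open S" "Ck_on k S F"
  shows "Ck_on k S (\<lambda>z. F z $ j)"
  using assms(2)
proof (induction k arbitrary: F)
  case (Suc k)
  note d = partial_vec_nth[OF Ck_on_differentiable[OF Suc.prems(1) assms(1)]]
  have "Ck_on k S (partial i (\<lambda>z. F z $ j))" for i
    by (rule iffD2[OF Ck_on_cong[OF assms(1) d(2)]], assumption) (use Suc in auto)
  then show ?case using d(1) by (auto simp: differentiable_on_def intro: differentiable_at_withinI)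
qed (auto intro!: continuous_intros)

lemma Ck_on_nth: "Ck_on k S (\<lambda>z. z $ j)"
proof (cases k)
  case (Suc m)
  have "(\<lambda>z. z $ j) differentiable_on S"
    unfolding differentiable_on_def
    using bounded_linear_imp_differentiable[OF bounded_linear_vec_nth] by blast
  then show ?thesis by (simp add: Suc partial_nth Ck_on_const)
qed (simp add: continuous_intros)

lemma Ck_on_subset: "Ck_on k S F \<Longrightarrow> T \<subseteq> S \<Longrightarrow> Ck_on k T F"
  by (induction k arbitrary: F) (auto intro: continuous_on_subset differentiable_on_subset)

named_theorems smooth_intros

lemma smooth_on_const [smooth_intros]: "smooth_on S (\<lambda>_. c)"
  by (simp add: smooth_on_def Ck_on_const)

lemma smooth_on_nth [smooth_intros]: "smooth_on S (\<lambda>z. z $ j)"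
  by (simp add: smooth_on_def Ck_on_nth)

lemma smooth_on_partial [smooth_intros]: "smooth_on S F \<Longrightarrow> smooth_on S (partial i F)"
  unfolding smooth_on_def by (meson Ck_on.simps(2))

lemma smooth_on_differentiable: "smooth_on S F \<Longrightarrow> open S \<Longrightarrow> y \<in> S \<Longrightarrow> F differentiable at y"
  unfolding smooth_on_def using Ck_on_differentiable by blast

lemma smooth_on_continuous: "smooth_on S F \<Longrightarrow> continuous_on S F"
  unfolding smooth_on_def by (metis Ck_on.simps(1))

lemma smooth_on_cong: "open S \<Longrightarrow> (\<And>z. z \<in> S \<Longrightarrow> F z = H z) \<Longrightarrow> smooth_on S F \<longleftrightarrow> smooth_on S H"
  unfolding smooth_on_def using Ck_on_cong by blast

context
  fixes S :: "(real^'n::finite) set"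
  assumes S: "open S"
begin

lemma smooth_on_add [smooth_intros]: "smooth_on S F \<Longrightarrow> smooth_on S H \<Longrightarrow> smooth_on S (\<lambda>z. F z + H z)"
  by (simp add: smooth_on_def Ck_on_add[OF S])

lemma smooth_on_diff [smooth_intros]:
  "smooth_on S F \<Longrightarrow> smooth_on S H \<Longrightarrow> smooth_on S (\<lambda>z. F z - H z :: real)"
  by (simp add: smooth_on_def Ck_on_diff[OF S])

lemma smooth_on_mult [smooth_intros]:
  "smooth_on S F \<Longrightarrow> smooth_on S H \<Longrightarrow> smooth_on S (\<lambda>z. F z * H z :: real)"
  by (simp add: smooth_on_def Ck_on_mult[OF S])

lemma smooth_on_sum [smooth_intros]:
  "(\<And>i. i \<in> I \<Longrightarrow> smooth_on S (F i)) \<Longrightarrow> finite I \<Longrightarrow> smooth_on S (\<lambda>z. \<Sum>i\<in>I. F i z)"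
  by (simp add: smooth_on_def Ck_on_sum[OF S])

lemma smooth_on_prod [smooth_intros]:
  "(\<And>i. i \<in> I \<Longrightarrow> smooth_on S (F i)) \<Longrightarrow> finite I \<Longrightarrow> smooth_on S (\<lambda>z. \<Prod>i\<in>I. F i z :: real)"
  by (simp add: smooth_on_def Ck_on_prod[OF S])

lemma smooth_on_exp [smooth_intros]: "smooth_on S F \<Longrightarrow> smooth_on S (\<lambda>z. exp (F z :: real))"
  by (simp add: smooth_on_def Ck_on_exp[OF S])

lemma smooth_on_inverse:
  "smooth_on S F \<Longrightarrow> (\<And>y. y \<in> S \<Longrightarrow> F y \<noteq> 0) \<Longrightarrow> smooth_on S (\<lambda>z. inverse (F z :: real))"
  by (simp add: smooth_on_def Ck_on_inverse[OF S])

lemma smooth_on_vec_nth: "smooth_on S F \<Longrightarrow> smooth_on S (\<lambda>z. F z $ j)"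
  by (simp add: smooth_on_def Ck_on_vec_nth[OF S])

end

subsection \<open>Difference quotients\<close>

text \<open>The base points \<open>P j\<close> move together with the step sizes, so a derivative at
  \<open>P0\<close> alone would not do: the mean value theorem gives \<open>d\<close> at an
  intermediate point, and continuity of \<open>d\<close> finishes. The domain is any normed space,
  so that \<open>w\<close> can be a space or a time direction of pairs (y, t).\<close>

lemma difference_quotient_tendsto:
  fixes v d :: "'e::real_normed_vector \<Rightarrow> real"
  assumes W: "open W" "P0 \<in> W"
    and d: "\<And>Q. Q \<in> W \<Longrightarrow> ((\<lambda>\<theta>. v (Q + \<theta> *\<^sub>R w)) has_real_derivative d Q) (at 0)"
    and cont: "continuous_on W d"
    and P: "P \<longlonglongrightarrow> P0" and s: "s \<longlonglongrightarrow> 0" "\<And>j::nat. s j > 0"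
  shows "(\<lambda>j. (v (P j + s j *\<^sub>R w) - v (P j)) / s j) \<longlonglongrightarrow> d P0"
proof (rule LIMSEQ_I)
  fix e :: real assume e: "e > 0"
  have "isCont d P0" using cont W by (simp add: continuous_on_eq_continuous_at)
  then obtain \<delta>1 where \<delta>1: "\<delta>1 > 0" "\<And>Q. dist Q P0 < \<delta>1 \<Longrightarrow> dist (d Q) (d P0) < e"
    unfolding continuous_at_eps_delta using e by blast
  obtain \<delta>2 where \<delta>2: "\<delta>2 > 0" "ball P0 \<delta>2 \<subseteq> W" using W open_contains_ball by blast
  define \<delta> where "\<delta> = min \<delta>1 \<delta>2"
  have \<delta>: "\<delta> > 0" using \<delta>1 \<delta>2 by (simp add: \<delta>_def)
  have "eventually (\<lambda>j. dist (P j) P0 < \<delta> / 2) sequentially"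
    by (rule tendstoD[OF P]) (use \<delta> in simp)
  moreover have "(\<lambda>j. s j * norm w) \<longlonglongrightarrow> 0 * norm w" by (intro tendsto_intros s)
  then have "eventually (\<lambda>j. s j * norm w < \<delta> / 2) sequentially"
    by (intro order_tendstoD) (use \<delta> in auto)
  ultimately have "eventually (\<lambda>j. norm ((v (P j + s j *\<^sub>R w) - v (P j)) / s j - d P0) < e) sequentially"
  proof eventually_elim
    case (elim j)
    have near: "dist (P j + \<theta> *\<^sub>R w) P0 < \<delta>" if "0 \<le> \<theta>" "\<theta> \<le> s j" for \<theta>
    proof -
      have "dist (P j + \<theta> *\<^sub>R w) P0 \<le> dist (P j) P0 + norm (\<theta> *\<^sub>R w)"
        by (metis add_diff_cancel_left' dist_commute dist_norm dist_triangle add.commute)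
      also have "norm (\<theta> *\<^sub>R w) \<le> s j * norm w"
        using that by (simp add: mult_right_mono)
      finally show ?thesis using elim by simp
    qed
    have der: "((\<lambda>\<theta>. v (P j + \<theta> *\<^sub>R w)) has_real_derivative d (P j + \<theta> *\<^sub>R w)) (at \<theta>)"
      if "0 \<le> \<theta>" "\<theta> \<le> s j" for \<theta>
    proof -
      have "P j + \<theta> *\<^sub>R w \<in> W"
        using near[OF that] \<delta>2(2) by (auto simp: \<delta>_def dist_commute)
      from d[OF this] have "((\<lambda>\<theta>'. v (P j + (\<theta>' + \<theta>) *\<^sub>R w)) has_real_derivative d (P j + \<theta> *\<^sub>R w)) (at 0)"
        by (simp add: algebra_simps)
      then show ?thesis using DERIV_shift[of "\<lambda>\<theta>. v (P j + \<theta> *\<^sub>R w)" _ 0 \<theta>] by simp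
    qed
    obtain z where z: "0 < z" "z < s j"
      "v (P j + s j *\<^sub>R w) - v (P j + 0 *\<^sub>R w) = (s j - 0) * d (P j + z *\<^sub>R w)"
      using MVT2[OF s(2)[of j], of "\<lambda>\<theta>. v (P j + \<theta> *\<^sub>R w)" "\<lambda>\<theta>. d (P j + \<theta> *\<^sub>R w)"] der by auto
    have "(v (P j + s j *\<^sub>R w) - v (P j)) / s j = d (P j + z *\<^sub>R w)"
      using z(3) s(2)[of j] by (simp add: field_simps)
    then show ?case using \<delta>1(2)[of "P j + z *\<^sub>R w"] near[of z] z by (simp add: \<delta>_def dist_norm)
  qed
  then show "\<exists>no. \<forall>n\<ge>no. norm ((v (P n + s n *\<^sub>R w) - v (P n)) / s n - d P0) < e"
    by (simp add: eventually_sequentially)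
qed

lemma axis_directional:
  fixes F :: "real^'n::finite \<Rightarrow> real"
  assumes "F differentiable at (y + s *\<^sub>R axis i 1)"
  shows "((\<lambda>s. F (y + s *\<^sub>R axis i 1)) has_real_derivative partial i F (y + s *\<^sub>R axis i 1)) (at s)"
  using directional_derivative[OF assms]
  by (simp add: axis_def if_distrib[of "\<lambda>z. z * _"] cong: if_cong)

text \<open>The mean value theorem in direction \<open>i\<close> turns the second difference into a
  difference quotient of \<open>partial i F\<close> in direction \<open>j\<close> at a moving base
  point. Steps of at most r/2 keep both shifts together inside the ball.\<close>

lemma mixed_difference_tendsto:
  fixes F :: "real^'n::finite \<Rightarrow> real"
  assumes S: "open S" "Ck_on 2 S F" "cball y r \<subseteq> S" "r > 0"
  defines "s \<equiv> \<lambda>m::nat. r / 2 / real (Suc m)"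
  shows "(\<lambda>m. (F (y + s m *\<^sub>R axis i 1 + s m *\<^sub>R axis j 1) - F (y + s m *\<^sub>R axis i 1)
     - F (y + s m *\<^sub>R axis j 1) + F y) / (s m * s m)) \<longlonglongrightarrow> partial j (partial i F) y"
proof -
  have C: "Ck_on (Suc (Suc 0)) S F" using S by (simp add: numeral_2_eq_2)
  then have C1: "Ck_on (Suc 0) S (partial i F)" by simp
  have s0: "s \<longlonglongrightarrow> 0"
  proof -
    have "(\<lambda>m. r / 2 * (1 / real (Suc m))) \<longlonglongrightarrow> r / 2 * 0"
      by (intro tendsto_intros LIMSEQ_inverse_real_of_nat[unfolded inverse_eq_divide])
    then show ?thesis by (simp add: s_def)
  qed
  have spos: "s m > 0" for m using S by (simp add: s_def)
  have sle: "s m \<le> r / 2" for m using S by (simp add: s_def field_simps)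
  have inS: "y + x *\<^sub>R axis i 1 + x' *\<^sub>R axis j 1 \<in> S" if "0 \<le> x" "x \<le> s m" "0 \<le> x'" "x' \<le> s m" for x x' m
  proof -
    have "norm (x *\<^sub>R axis i 1 + x' *\<^sub>R axis j (1::real)) \<le> norm (x *\<^sub>R axis i (1::real)) + norm (x' *\<^sub>R axis j (1::real))"
      by (rule norm_triangle_ineq)
    also have "\<dots> \<le> r" using that sle[of m] by (simp add: norm_axis_1)
    finally have "y + x *\<^sub>R axis i 1 + x' *\<^sub>R axis j 1 \<in> cball y r"
      by (simp add: dist_norm add.assoc norm_minus_commute) (metis add.commute)
    then show ?thesis using S by blast
  qed
  have "\<exists>z. 0 < z \<and> z < s m \<and>
      F (y + s m *\<^sub>R axis i 1 + s m *\<^sub>R axis j 1) - F (y + s m *\<^sub>R axis i 1)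
     - F (y + s m *\<^sub>R axis j 1) + F y
     = s m * (partial i F (y + z *\<^sub>R axis i 1 + s m *\<^sub>R axis j 1) - partial i F (y + z *\<^sub>R axis i 1))" for m
  proof -
    let ?g = "\<lambda>x. F ((y + s m *\<^sub>R axis j 1) + x *\<^sub>R axis i 1) - F (y + x *\<^sub>R axis i 1)"
    have "(?g has_real_derivative (partial i F ((y + s m *\<^sub>R axis j 1) + x *\<^sub>R axis i 1) - partial i F (y + x *\<^sub>R axis i 1))) (at x)"
      if "0 \<le> x" "x \<le> s m" for x
      using inS[of x m "s m"] inS[of x m 0] that spos[of m] 
      by (intro DERIV_diff axis_directional Ck_on_differentiable[OF C S(1)])
        (auto simp: add_ac)
    from MVT2[OF spos[of m] this]
    obtain z where "0 < z" "z < s m" "?g (s m) - ?g 0 = (s m - 0) * (partial i F ((y + s m *\<^sub>R axis j 1) + z *\<^sub>R axis i 1) - partial i F (y + z *\<^sub>R axis i 1))"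
      by auto
    then show ?thesis by (intro exI[of _ z]) (simp add: algebra_simps)
  qed
  then obtain z where z: "\<And>m. 0 < z m" "\<And>m. z m < s m" and zeq: "\<And>m.
      F (y + s m *\<^sub>R axis i 1 + s m *\<^sub>R axis j 1) - F (y + s m *\<^sub>R axis i 1)
     - F (y + s m *\<^sub>R axis j 1) + F y
     = s m * (partial i F (y + z m *\<^sub>R axis i 1 + s m *\<^sub>R axis j 1) - partial i F (y + z m *\<^sub>R axis i 1))"
    by metis
  have "z \<longlonglongrightarrow> 0"
    by (rule tendsto_sandwich[OF _ _ tendsto_const s0]) (use z in \<open>auto intro!: always_eventually simp: less_imp_le\<close>)
  then have "(\<lambda>m. y + z m *\<^sub>R axis i 1) \<longlonglongrightarrow> y + 0 *\<^sub>R axis i 1" by (intro tendsto_intros)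
  then have zt: "(\<lambda>m. y + z m *\<^sub>R axis i 1) \<longlonglongrightarrow> y" by simp
  have "(\<lambda>m. (partial i F ((y + z m *\<^sub>R axis i 1) + s m *\<^sub>R axis j 1) - partial i F (y + z m *\<^sub>R axis i 1)) / s m)
      \<longlonglongrightarrow> partial j (partial i F) y"
  proof (rule difference_quotient_tendsto[OF S(1) _ _ _ zt s0 spos])
    show "y \<in> S" using S by auto
    show "continuous_on S (partial j (partial i F))" using C1 by simp
    show "((\<lambda>\<theta>. partial i F (Q + \<theta> *\<^sub>R axis j 1)) has_real_derivative partial j (partial i F) Q) (at 0)" if "Q \<in> S" for Q
      using axis_directional[of "partial i F" Q 0 j] Ck_on_differentiable[OF C1 S(1) that] by simp
  qed
  then show ?thesis unfolding zeq using spos by (simp add: less_imp_neq[symmetric])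
qed

text \<open>The second difference is unchanged when \<open>i\<close> and \<open>j\<close> are
  exchanged, so its two limits coincide.\<close>

lemma partial_commute:
  fixes F :: "real^'n::finite \<Rightarrow> real"
  assumes "open S" "Ck_on 2 S F" "y \<in> S"
  shows "partial i (partial j F) y = partial j (partial i F) y"
proof -
  obtain r where r: "r > 0" "cball y r \<subseteq> S" using assms open_contains_cball by blast
  have eq: "(\<lambda>m. (F (y + s m *\<^sub>R axis i 1 + s m *\<^sub>R axis j 1) - F (y + s m *\<^sub>R axis i 1)
     - F (y + s m *\<^sub>R axis j 1) + F y) / (s m * s m)) = 
     (\<lambda>m. (F (y + s m *\<^sub>R axis j 1 + s m *\<^sub>R axis i 1) - F (y + s m *\<^sub>R axis j 1)
     - F (y + s m *\<^sub>R axis i 1) + F y) / (s m * s m))" for s :: "nat \<Rightarrow> real"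
    by (rule ext) (simp add: algebra_simps)
  show ?thesis
    using mixed_difference_tendsto[OF assms(1,2) r(2,1), of j i]
      mixed_difference_tendsto[OF assms(1,2) r(2,1), of i j, unfolded eq]
    by (rule LIMSEQ_unique)
qed

text \<open>On the line through \<open>y\<close> in direction \<open>v\<close>, a negative second
  derivative together with a vanishing first one would make the function decrease to the right of
  0.\<close>

lemma second_derivative_test:
  fixes F :: "real^'n::finite \<Rightarrow> real"
  assumes S: "open S" "Ck_on 2 S F" "y \<in> S" and min: "\<And>z. z \<in> S \<Longrightarrow> F y \<le> F z"
  shows "partial i F y = 0" "(\<Sum>i\<in>UNIV. \<Sum>j\<in>UNIV. partial i (partial j F) y * v i * v j) \<ge> 0"
proof -
  have C: "Ck_on (Suc (Suc 0)) S F" using S by (simp add: numeral_2_eq_2)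
  then have C1: "Ck_on (Suc 0) S (partial i F)" for i by simp
  obtain r where r: "r > 0" "ball y r \<subseteq> S" using S open_contains_ball by blast
  have inS: "\<exists>d>0. \<forall>s. \<bar>s\<bar> < d \<longrightarrow> y + s *\<^sub>R w \<in> S" for w
  proof (intro exI conjI allI impI)
    show "r / (norm w + 1) > 0" using r by (simp add: add_nonneg_pos)
    fix s :: real assume "\<bar>s\<bar> < r / (norm w + 1)"
    then have "\<bar>s\<bar> * (norm w + 1) < r" by (simp add: pos_less_divide_eq add_nonneg_pos)
    moreover have "\<bar>s\<bar> * norm w \<le> \<bar>s\<bar> * (norm w + 1)" by (intro mult_left_mono) auto
    ultimately have "y + s *\<^sub>R w \<in> ball y r" by (simp add: dist_norm)
    then show "y + s *\<^sub>R w \<in> S" using r by blast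
  qed
  have zero: "partial i F y = 0" for i
  proof -
    obtain d where d: "d > 0" "\<And>s. \<bar>s\<bar> < d \<Longrightarrow> y + s *\<^sub>R axis i 1 \<in> S" using inS by blast
    have "((\<lambda>s. F (y + s *\<^sub>R axis i 1)) has_real_derivative partial i F y) (at 0)"
      using axis_directional[of F y 0 i] Ck_on_differentiable[OF C S(1,3)] by simp
    then show ?thesis
      by (rule DERIV_local_min[OF _ d(1)]) (use d(2) min in auto)
  qed
  then show "partial i F y = 0" .
  define w :: "real^'n" where "w = (\<chi> i. v i)"
  obtain d where d: "d > 0" "\<And>s. \<bar>s\<bar> < d \<Longrightarrow> y + s *\<^sub>R w \<in> S" using inS by blast
  define g where "g s = F (y + s *\<^sub>R w)" for s
  define g' where "g' s = (\<Sum>i\<in>UNIV. w $ i * partial i F (y + s *\<^sub>R w))" for s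
  define g2 where "g2 = (\<Sum>i\<in>UNIV. \<Sum>j\<in>UNIV. partial i (partial j F) y * v i * v j)"
  have dg: "(g has_real_derivative g' s) (at s)" if "\<bar>s\<bar> < d" for s
    unfolding g_def g'_def by (rule directional_derivative Ck_on_differentiable[OF C S(1) d(2)[OF that]])+
  have "(g' has_real_derivative (\<Sum>j\<in>UNIV. w $ j * (\<Sum>i\<in>UNIV. w $ i * partial i (partial j F) (y + 0 *\<^sub>R w)))) (at 0)"
    unfolding g'_def
    by (intro DERIV_sum DERIV_cmult directional_derivative Ck_on_differentiable[OF C1 S(1)]) (simp add: S)
  also have "(\<Sum>j\<in>UNIV. w $ j * (\<Sum>i\<in>UNIV. w $ i * partial i (partial j F) (y + 0 *\<^sub>R w))) = g2"
    unfolding g2_def by (subst sum.swap) (simp add: w_def sum_distrib_left mult_ac)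
  finally have dg': "(g' has_real_derivative g2) (at 0)" .
  have g0: "g' 0 = 0" by (simp add: g'_def zero)
  show "(\<Sum>i\<in>UNIV. \<Sum>j\<in>UNIV. partial i (partial j F) y * v i * v j) \<ge> 0"
  proof (rule ccontr)
    assume "\<not> ?thesis"
    then have "g2 < 0" by (simp add: g2_def)
    from DERIV_neg_dec_right[OF dg' this] obtain e where e: "e > 0" "\<And>h. h > 0 \<Longrightarrow> h < e \<Longrightarrow> g' h < 0"
      using g0 by auto
    define h where "h = min d e / 2"
    have h: "h > 0" "h < d" "h < e" using d e by (auto simp: h_def)
    obtain z where z: "0 < z" "z < h" "g h - g 0 = (h - 0) * g' z"
      using MVT2[OF h(1), of g g'] dg h by (metis abs_of_nonneg le_less_trans)
    have "h * g' z < 0" using e(2)[of z] z h by (intro mult_pos_neg) auto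
    then have "g h < g 0" using z by simp
    moreover have "g 0 \<le> g h" using min[of "y + h *\<^sub>R w"] d(2)[of h] h by (simp add: g_def)
    ultimately show False by simp
  qed
qed

subsection \<open>A metric in coordinates\<close>

lemma sum_delta_mult:
  fixes h :: "'n::finite \<Rightarrow> real"
  shows "(\<Sum>k\<in>UNIV. h k * (if k = i then 1 else 0)) = h i" "(\<Sum>k\<in>UNIV. (if k = i then 1 else 0) * h k) = h i"
    "(\<Sum>k\<in>UNIV. h k * (if i = k then 1 else 0)) = h i" "(\<Sum>k\<in>UNIV. (if i = k then 1 else 0) * h k) = h i"
  by (simp_all add: if_distrib[of "\<lambda>z. _ * z"] if_distrib[of "\<lambda>z. z * _"] cong: if_cong)

lemma matrix_inv_inverse:
  fixes A :: "real^'n::finite^'n"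
  assumes "\<And>v. v \<noteq> 0 \<Longrightarrow> (A *v v) \<bullet> v > 0"
  shows "matrix_inv A ** A = mat 1" "A ** matrix_inv A = mat 1" "det A \<noteq> 0"
proof -
  have "\<forall>x. A *v x = 0 \<longrightarrow> x = 0"
    using assms by (metis inner_zero_left less_irrefl)
  then have "invertible A"
    using matrix_left_invertible_ker[of A] invertible_left_inverse[of A] by blast
  then show "det A \<noteq> 0" by (simp add: invertible_det_nz)
  have "A ** matrix_inv A = mat 1 \<and> matrix_inv A ** A = mat 1"
    using \<open>invertible A\<close> unfolding matrix_inv_def invertible_def by (rule someI_ex)
  then show "matrix_inv A ** A = mat 1" "A ** matrix_inv A = mat 1" by auto
qed

locale coord_metric =
  fixes G :: "real^'n::finite \<Rightarrow> real^'n^'n" and U :: "(real^'n) set"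
  assumes open_U: "open U"
    and smooth_G: "smooth_on U G"
    and sym_G: "\<And>y. y \<in> U \<Longrightarrow> transpose (G y) = G y"
    and pos_G: "\<And>y v. y \<in> U \<Longrightarrow> v \<noteq> 0 \<Longrightarrow> (G y *v v) \<bullet> v > 0"
begin

definition a :: "'n \<Rightarrow> 'n \<Rightarrow> real^'n \<Rightarrow> real"
  where "a i j y = matrix_inv (G y) $ i $ j"

abbreviation \<Gamma> :: "'n \<Rightarrow> 'n \<Rightarrow> 'n \<Rightarrow> real^'n \<Rightarrow> real"
  where "\<Gamma> \<equiv> christoffel G"

abbreviation dG :: "'n \<Rightarrow> 'n \<Rightarrow> 'n \<Rightarrow> real^'n \<Rightarrow> real"
  where "dG k i j \<equiv> partial k (\<lambda>z. G z $ i $ j)"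

lemma G_sym: "y \<in> U \<Longrightarrow> G y $ i $ j = G y $ j $ i"
  using sym_G[of y] by (metis transpose_def vec_lambda_beta)

lemma aG: "y \<in> U \<Longrightarrow> (\<Sum>k\<in>UNIV. a i k y * G y $ k $ j) = (if i = j then 1 else 0)"
  and Ga: "y \<in> U \<Longrightarrow> (\<Sum>k\<in>UNIV. G y $ i $ k * a k j y) = (if i = j then 1 else 0)"
  using matrix_inv_inverse[of "G y"] pos_G[of y]
  unfolding a_def by (auto simp: matrix_matrix_mult_def mat_def vec_eq_iff)

lemma contract_Ga:
  assumes "y \<in> U"
  shows "(\<Sum>l\<in>UNIV. X l * (\<Sum>j\<in>UNIV. G y $ l $ j * a j p y)) = X p"
  using assms by (simp add: Ga sum_delta_mult)

lemma a_sym: 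
  assumes y: "y \<in> U" shows "a i j y = a j i y"
proof -
  have "a i j y = (\<Sum>k\<in>UNIV. (\<Sum>l\<in>UNIV. a j l y * G y $ l $ k) * a i k y)"
    by (simp add: aG[OF y] sum_delta_mult)
  also have "\<dots> = (\<Sum>k\<in>UNIV. \<Sum>l\<in>UNIV. a j l y * (a i k y * G y $ k $ l))"
    by (simp add: sum_distrib_right sum_distrib_left mult_ac G_sym[OF y])
  also have "\<dots> = (\<Sum>l\<in>UNIV. a j l y * (\<Sum>k\<in>UNIV. a i k y * G y $ k $ l))"
    by (subst sum.swap) (simp add: sum_distrib_left)
  also have "\<dots> = a j i y" by (simp add: aG[OF y] sum_delta_mult)
  finally show ?thesis .
qed

lemma norm_vector_eq:
  fixes v :: "real^'n"
  assumes y: "y \<in> U"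
  defines "w \<equiv> matrix_inv (G y) *v v"
  shows "(G y *v w) \<bullet> w = (\<Sum>i\<in>UNIV. \<Sum>j\<in>UNIV. a i j y * v $ i * v $ j)"
proof -
  have "G y *v w = v"
    using matrix_inv_inverse[of "G y"] pos_G[OF y] by (simp add: w_def matrix_vector_mul_assoc)
  then have "(G y *v w) \<bullet> w = v \<bullet> (matrix_inv (G y) *v v)" by (simp add: w_def)
  then show ?thesis
    by (simp add: inner_vec_def matrix_vector_mult_def a_def sum_distrib_left mult_ac)
qed

lemma a_psd:
  assumes y: "y \<in> U" shows "(\<Sum>i\<in>UNIV. \<Sum>j\<in>UNIV. a i j y * v i * v j) \<ge> 0"
proof -
  define w where "w = matrix_inv (G y) *v (\<chi> i. v i)"
  have "(G y *v w) \<bullet> w \<ge> 0" using pos_G[OF y, of w] by (cases "w = 0") (auto simp: less_imp_le)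
  then show ?thesis unfolding w_def norm_vector_eq[OF y] by simp
qed

lemma smooth_G_nth: "smooth_on U (\<lambda>z. G z $ i $ j)"
  by (intro smooth_on_vec_nth smooth_G open_U)

lemma smooth_det:
  assumes "\<And>i j. smooth_on U (\<lambda>z. A z $ i $ j)"
  shows "smooth_on U (\<lambda>z. det (A z :: real^'n^'n))"
  unfolding det_def by (intro smooth_intros open_U assms finite finite_permutations)

text \<open>\<open>matrix_inv\<close> is defined by a choice and offers no formula to differentiate;
  Cramer's rule expresses its entries by determinants in the entries of the metric.\<close>

lemma smooth_a: "smooth_on U (a i j)"
proof -
  have cr: "a i j y = det (\<chi> p q. if q = i then axis j 1 $ p else G y $ p $ q) * inverse (det (G y))"
    if y: "y \<in> U" for y
  proof -
    note inv = matrix_inv_inverse[OF pos_G[OF y]]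
    have "G y *v (matrix_inv (G y) *v axis j 1) = axis j 1"
      by (simp add: matrix_vector_mul_assoc inv)
    then have "matrix_inv (G y) *v axis j 1 = (\<chi> k. det (\<chi> p q. if q = k then axis j 1 $ p else G y $ p $ q) / det (G y))"
      using cramer[OF inv(3)] by blast
    moreover have "(matrix_inv (G y) *v axis j 1) $ i = a i j y"
      by (simp add: a_def matrix_vector_mult_def axis_def sum_delta_mult)
    ultimately show ?thesis by (simp add: divide_inverse)
  qed
  have sm: "smooth_on U (\<lambda>y. det (\<chi> p q. if q = i then axis j 1 $ p else G y $ p $ q) * inverse (det (G y)))"
  proof (intro smooth_on_mult smooth_on_inverse smooth_det open_U)
    show "smooth_on U (\<lambda>z. (\<chi> p q. if q = i then axis j 1 $ p else G z $ p $ q) $ p $ q)" for p q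
      by (cases "q = i") (auto intro: smooth_on_const smooth_G_nth)
  qed (use smooth_G_nth matrix_inv_inverse(3)[OF pos_G] in auto)
  show ?thesis by (rule iffD2[OF smooth_on_cong[OF open_U cr] sm])
qed

lemma smooth_christoffel: "smooth_on U (\<Gamma> k i j)"
proof -
  have *: "\<Gamma> k i j = (\<lambda>y. (1/2) * (\<Sum>l\<in>UNIV. a k l y *
      (partial i (\<lambda>z. G z $ j $ l) y + partial j (\<lambda>z. G z $ i $ l) y
        - partial l (\<lambda>z. G z $ i $ j) y)))"
    by (rule ext) (simp add: christoffel_def a_def)
  show ?thesis unfolding * by (intro smooth_intros open_U smooth_a smooth_G_nth finite)
qed

lemma dG_sym: "y \<in> U \<Longrightarrow> dG k i j y = dG k j i y"
  using partial_cong[OF open_U, of y "\<lambda>z. G z $ i $ j" "\<lambda>z. G z $ j $ i" k] G_sym by blast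

lemma \<Gamma>_sym: "y \<in> U \<Longrightarrow> \<Gamma> k i j y = \<Gamma> k j i y"
  by (simp add: christoffel_def dG_sym[of y _ i j] add.commute)

text \<open>The right side is the Christoffel symbol of the first kind, in which no inverse metric
  is left.\<close>

lemma \<Gamma>_lower:
  assumes y: "y \<in> U"
  shows "(\<Sum>l\<in>UNIV. \<Gamma> l i j y * G y $ l $ p) = (dG i j p y + dG j i p y - dG p i j y) / 2"
proof -
  define T where "T m = dG i j m y + dG j i m y - dG m i j y" for m
  have "(\<Sum>l\<in>UNIV. \<Gamma> l i j y * G y $ l $ p) = (\<Sum>l\<in>UNIV. \<Sum>m\<in>UNIV. (T m / 2) * (G y $ p $ l * a l m y))"
    by (simp add: christoffel_def a_def[symmetric] T_def[symmetric] sum_distrib_right sum_distrib_left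
        G_sym[OF y, of p] mult_ac)
  also have "\<dots> = (\<Sum>m\<in>UNIV. (T m / 2) * (\<Sum>l\<in>UNIV. G y $ p $ l * a l m y))"
    by (subst sum.swap) (simp add: sum_distrib_left)
  also have "\<dots> = T p / 2"
    unfolding Ga[OF y] by (rule sum_delta_mult)
  finally show ?thesis by (simp add: T_def)
qed

text \<open>The metric is parallel: of the six terms in the two Christoffel symbols of the first
  kind, four cancel.\<close>

lemma metric_compatible:
  assumes y: "y \<in> U"
  shows "dG k i j y = (\<Sum>l\<in>UNIV. \<Gamma> l k i y * G y $ l $ j) + (\<Sum>l\<in>UNIV. \<Gamma> l k j y * G y $ l $ i)"
  unfolding \<Gamma>_lower[OF y] using dG_sym[OF y, of i k j] dG_sym[OF y, of j k i] dG_sym[OF y, of k i j]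
  by (simp add: field_simps)

lemma diff_G: "y \<in> U \<Longrightarrow> (\<lambda>z. G z $ i $ j) differentiable at y"
  and diff_a: "y \<in> U \<Longrightarrow> a i j differentiable at y"
  and diff_\<Gamma>: "y \<in> U \<Longrightarrow> \<Gamma> k i j differentiable at y"
  by (blast intro: smooth_on_differentiable smooth_G_nth smooth_a smooth_christoffel open_U)+

text \<open>The inverse metric is parallel as well: differentiating its product with the metric
  expresses its derivative by \<open>dG\<close>, and \<open>metric_compatible\<close> turns this
  into Christoffel symbols.\<close>

lemma partial_a:
  assumes y: "y \<in> U"
  shows "partial k (a i p) y = - (\<Sum>m\<in>UNIV. a i m y * \<Gamma> p k m y) - (\<Sum>j\<in>UNIV. \<Gamma> i k j y * a j p y)"
proof -
  have prod: "(\<Sum>m\<in>UNIV. partial k (a i m) y * G y $ m $ j) = - (\<Sum>m\<in>UNIV. a i m y * dG k m j y)" for j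
  proof -
    have "partial k (\<lambda>z. \<Sum>m\<in>UNIV. a i m z * G z $ m $ j) y = partial k (\<lambda>_. if i = j then 1 else 0) y"
      by (rule partial_cong[OF open_U y]) (rule aG)
    then have "(\<Sum>m\<in>UNIV. partial k (a i m) y * G y $ m $ j + a i m y * dG k m j y) = 0"
      by (simp add: partial_sum partial_mult diff_a diff_G y differentiable_mult)
    then show ?thesis by (simp add: sum.distrib)
  qed
  have "partial k (a i p) y = (\<Sum>m\<in>UNIV. \<Sum>j\<in>UNIV. partial k (a i m) y * G y $ m $ j * a j p y)"
    using contract_Ga[OF y, of "\<lambda>m. partial k (a i m) y" p] by (simp add: sum_distrib_left mult_ac)
  also have "\<dots> = (\<Sum>j\<in>UNIV. (\<Sum>m\<in>UNIV. partial k (a i m) y * G y $ m $ j) * a j p y)"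
    by (subst sum.swap) (simp add: sum_distrib_right)
  also have "\<dots> = - (\<Sum>j\<in>UNIV. \<Sum>m\<in>UNIV. a i m y * dG k m j y * a j p y)"
    unfolding prod by (simp add: sum_distrib_right sum_negf)
  also have "(\<Sum>j\<in>UNIV. \<Sum>m\<in>UNIV. a i m y * dG k m j y * a j p y)
     = (\<Sum>j\<in>UNIV. \<Sum>m\<in>UNIV. \<Sum>l\<in>UNIV. a i m y * \<Gamma> l k m y * (G y $ l $ j * a j p y))
      + (\<Sum>j\<in>UNIV. \<Sum>m\<in>UNIV. \<Sum>l\<in>UNIV. \<Gamma> l k j y * a j p y * (a i m y * G y $ m $ l))"
    by (simp add: metric_compatible[OF y] sum_distrib_right sum_distrib_left sum.distrib
        distrib_left distrib_right G_sym[OF y] mult_ac)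
  also have "(\<Sum>j\<in>UNIV. \<Sum>m\<in>UNIV. \<Sum>l\<in>UNIV. a i m y * \<Gamma> l k m y * (G y $ l $ j * a j p y))
     = (\<Sum>m\<in>UNIV. \<Sum>l\<in>UNIV. \<Sum>j\<in>UNIV. a i m y * \<Gamma> l k m y * (G y $ l $ j * a j p y))"
    by (subst sum.swap, rule sum.cong[OF refl], rule sum.swap)
  also have "\<dots> = (\<Sum>m\<in>UNIV. a i m y * \<Gamma> p k m y)"
    by (simp add: sum_distrib_left[symmetric] Ga[OF y] sum_delta_mult)
  also have "(\<Sum>j\<in>UNIV. \<Sum>m\<in>UNIV. \<Sum>l\<in>UNIV. \<Gamma> l k j y * a j p y * (a i m y * G y $ m $ l))
     = (\<Sum>j\<in>UNIV. \<Sum>l\<in>UNIV. \<Sum>m\<in>UNIV. \<Gamma> l k j y * a j p y * (a i m y * G y $ m $ l))"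
    by (intro sum.cong refl sum.swap)
  also have "\<dots> = (\<Sum>j\<in>UNIV. \<Gamma> i k j y * a j p y)"
    by (simp add: sum_distrib_left[symmetric] aG[OF y] sum_delta_mult)
  finally show ?thesis by simp
qed

section \<open>The Laplacian and the inner product of gradients\<close>

definition lap :: "(real^'n \<Rightarrow> real) \<Rightarrow> real^'n \<Rightarrow> real"
  where "lap F = coord_div G (coord_grad G F)"

definition gip :: "(real^'n \<Rightarrow> real) \<Rightarrow> (real^'n \<Rightarrow> real) \<Rightarrow> real^'n \<Rightarrow> real"
  where "gip F H y = (\<Sum>i\<in>UNIV. \<Sum>j\<in>UNIV. a i j y * partial i F y * partial j H y)"

text \<open>The first order coefficients of the Laplacian in non-divergence form, see
  \<open>lap_eq\<close>.\<close>

definition b :: "'n \<Rightarrow> real^'n \<Rightarrow> real"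
  where "b k y = (\<Sum>i\<in>UNIV. partial i (a i k) y + (\<Sum>j\<in>UNIV. \<Gamma> i i j y * a j k y))"

lemma smooth_b: "smooth_on U (b k)"
proof -
  have *: "b k = (\<lambda>y. \<Sum>i\<in>UNIV. partial i (a i k) y + (\<Sum>j\<in>UNIV. \<Gamma> i i j y * a j k y))"
    by (rule ext) (rule b_def)
  show ?thesis unfolding * by (intro smooth_intros open_U smooth_a smooth_christoffel finite)
qed

lemma coord_grad_nth: "coord_grad G F y $ i = (\<Sum>j\<in>UNIV. a i j y * partial j F y)"
  by (simp add: coord_grad_def matrix_vector_mult_def a_def)

lemma gip_grad: "gip F H y = (\<Sum>i\<in>UNIV. partial i F y * coord_grad G H y $ i)"
  by (simp add: gip_def coord_grad_nth sum_distrib_left mult_ac)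

lemma gip_commute:
  assumes "y \<in> U" shows "gip F H y = gip H F y"
  unfolding gip_def by (subst sum.swap) (simp add: a_sym[OF assms] mult_ac)

lemma gip_nonneg: "y \<in> U \<Longrightarrow> gip F F y \<ge> 0"
  unfolding gip_def by (rule a_psd)

lemma grad_norm_eq:
  "y \<in> U \<Longrightarrow> (G y *v coord_grad G F y) \<bullet> coord_grad G F y = gip F F y"
  unfolding coord_grad_def by (subst norm_vector_eq) (simp_all add: gip_def)

text \<open>\<open>W\<close> may be smaller than \<open>U\<close>, because a difference quotient of
  a function on \<open>U\<close> is known to be of class $C^2$ only where the shifted argument stays
  in \<open>U\<close>.\<close>

lemma lap_eq:
  assumes W: "open W" "W \<subseteq> U" "y \<in> W" and F: "Ck_on 2 W F"
  shows "lap F y = (\<Sum>i\<in>UNIV. \<Sum>j\<in>UNIV. a i j y * partial i (partial j F) y) + (\<Sum>k\<in>UNIV. b k y * partial k F y)"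
proof -
  have y: "y \<in> U" using W by auto
  have F1: "Ck_on (Suc 0) W (partial i F)" for i using F by (simp add: numeral_2_eq_2)
  have dF: "partial i F differentiable at y" for i
    by (rule Ck_on_differentiable[OF F1 W(1,3)])
  have "lap F y = (\<Sum>i\<in>UNIV. (\<Sum>j\<in>UNIV. partial i (a i j) y * partial j F y + a i j y * partial i (partial j F) y)
      + (\<Sum>j\<in>UNIV. \<Gamma> i i j y * (\<Sum>k\<in>UNIV. a j k y * partial k F y)))"
    unfolding lap_def coord_div_def coord_grad_nth
    by (simp add: partial_sum partial_mult diff_a y dF differentiable_mult)
  also have "\<dots> = (\<Sum>i\<in>UNIV. \<Sum>j\<in>UNIV. a i j y * partial i (partial j F) y)
      + ((\<Sum>i\<in>UNIV. \<Sum>j\<in>UNIV. partial i (a i j) y * partial j F y)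
      + (\<Sum>i\<in>UNIV. \<Sum>j\<in>UNIV. \<Gamma> i i j y * (\<Sum>k\<in>UNIV. a j k y * partial k F y)))"
    by (simp add: sum.distrib)
  also have "(\<Sum>i\<in>UNIV. \<Sum>j\<in>UNIV. partial i (a i j) y * partial j F y)
      + (\<Sum>i\<in>UNIV. \<Sum>j\<in>UNIV. \<Gamma> i i j y * (\<Sum>k\<in>UNIV. a j k y * partial k F y))
      = (\<Sum>k\<in>UNIV. b k y * partial k F y)"
  proof -
    have "(\<Sum>i\<in>UNIV. \<Sum>j\<in>UNIV. \<Gamma> i i j y * (\<Sum>k\<in>UNIV. a j k y * partial k F y))
      = (\<Sum>i\<in>UNIV. \<Sum>j\<in>UNIV. \<Sum>k\<in>UNIV. \<Gamma> i i j y * a j k y * partial k F y)"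
      by (simp add: sum_distrib_left mult_ac)
    also have "\<dots> = (\<Sum>i\<in>UNIV. \<Sum>k\<in>UNIV. \<Sum>j\<in>UNIV. \<Gamma> i i j y * a j k y * partial k F y)"
      by (intro sum.cong refl sum.swap)
    also have "\<dots> = (\<Sum>k\<in>UNIV. \<Sum>i\<in>UNIV. \<Sum>j\<in>UNIV. \<Gamma> i i j y * a j k y * partial k F y)"
      by (rule sum.swap)
    finally have 1: "(\<Sum>i\<in>UNIV. \<Sum>j\<in>UNIV. \<Gamma> i i j y * (\<Sum>k\<in>UNIV. a j k y * partial k F y))
      = (\<Sum>k\<in>UNIV. \<Sum>i\<in>UNIV. \<Sum>j\<in>UNIV. \<Gamma> i i j y * a j k y * partial k F y)" .
    have 2: "(\<Sum>i\<in>UNIV. \<Sum>j\<in>UNIV. partial i (a i j) y * partial j F y)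
      = (\<Sum>k\<in>UNIV. \<Sum>i\<in>UNIV. partial i (a i k) y * partial k F y)"
      by (rule sum.swap)
    show ?thesis unfolding 1 2
      by (simp add: b_def sum_distrib_right distrib_right sum.distrib)
  qed
  finally show ?thesis .
qed

context
  fixes W assumes W: "open W" "W \<subseteq> U"
begin

lemma Ck2_differentiable:
  assumes "Ck_on 2 W F" "y \<in> W"
  shows "F differentiable at y" "partial i F differentiable at y"
proof -
  have "Ck_on (Suc (Suc 0)) W F" using assms by (simp only: numeral_2_eq_2)
  moreover from this have "Ck_on (Suc 0) W (partial i F)" for i by simp
  ultimately show "F differentiable at y" "partial i F differentiable at y"
    using Ck_on_differentiable[OF _ W(1) assms(2)] by blast+
qed

lemma lap_add:
  assumes F: "Ck_on 2 W F" and H: "Ck_on 2 W H" and y: "y \<in> W"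
  shows "lap (\<lambda>z. F z + H z) y = lap F y + lap H y"
proof -
  have 2: "partial i (partial j (\<lambda>z. F z + H z)) y = partial i (partial j F) y + partial i (partial j H) y" for i j
  proof -
    have "partial i (partial j (\<lambda>z. F z + H z)) y = partial i (\<lambda>z. partial j F z + partial j H z) y"
      by (rule partial_cong[OF W(1) y]) (simp add: partial_add Ck2_differentiable F H)
    then show ?thesis by (simp add: partial_add Ck2_differentiable[OF F y] Ck2_differentiable[OF H y])
  qed
  show ?thesis
    unfolding lap_eq[OF W y Ck_on_add[OF W(1) F H]] lap_eq[OF W y F] lap_eq[OF W y H] 2
      partial_add[OF Ck2_differentiable(1)[OF F y] Ck2_differentiable(1)[OF H y]]
    by (simp add: algebra_simps sum.distrib)
qed

lemma partial_partial_mult: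
  fixes F H :: "real^'n \<Rightarrow> real"
  assumes F: "Ck_on 2 W F" and H: "Ck_on 2 W H" and y: "y \<in> W"
  shows "partial i (partial j (\<lambda>z. F z * H z)) y = F y * partial i (partial j H) y + H y * partial i (partial j F) y
    + partial i F y * partial j H y + partial i H y * partial j F y"
proof -
  have "partial i (partial j (\<lambda>z. F z * H z)) y = partial i (\<lambda>z. partial j F z * H z + F z * partial j H z) y"
    by (rule partial_cong[OF W(1) y]) (intro partial_mult Ck2_differentiable(1)[OF F] Ck2_differentiable(1)[OF H])
  then show ?thesis
    by (simp add: partial_add partial_mult differentiable_mult Ck2_differentiable[OF F y]
        Ck2_differentiable[OF H y] algebra_simps)
qed

lemma lap_mult:
  assumes F: "Ck_on 2 W F" and H: "Ck_on 2 W H" and y: "y \<in> W"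
  shows "lap (\<lambda>z. F z * H z) y = F y * lap H y + H y * lap F y + 2 * gip F H y"
proof -
  have yU: "y \<in> U" using y W by auto
  have g: "2 * gip F H y = (\<Sum>i\<in>UNIV. \<Sum>j\<in>UNIV. a i j y * (partial i F y * partial j H y + partial i H y * partial j F y))"
    using gip_commute[OF yU, of F H] by (simp add: gip_def sum.distrib distrib_left mult.assoc)
  show ?thesis
    unfolding lap_eq[OF W y Ck_on_mult[OF W(1) F H]] lap_eq[OF W y F] lap_eq[OF W y H] partial_partial_mult[OF F H y] g
      partial_mult[OF Ck2_differentiable(1)[OF F y] Ck2_differentiable(1)[OF H y]]
    by (simp add: algebra_simps sum.distrib sum_distrib_left)
qed

lemma lap_const: "lap (\<lambda>_. c) y = 0"
  by (simp add: lap_def coord_div_def coord_grad_nth)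

lemma gip_const: "gip (\<lambda>_. c) F y = 0"
  by (simp add: gip_def)

lemma lap_cmult:
  assumes F: "Ck_on 2 W F" and y: "y \<in> W"
  shows "lap (\<lambda>z. c * F z) y = c * lap F y"
  using lap_mult[OF Ck_on_const[of 2 W c] F y] by (simp add: lap_const gip_const)

lemma lap_sum:
  assumes "finite I" "\<And>k. k \<in> I \<Longrightarrow> Ck_on 2 W (F k)" and y: "y \<in> W"
  shows "lap (\<lambda>z. \<Sum>k\<in>I. F k z) y = (\<Sum>k\<in>I. lap (F k) y)"
  using assms(1,2)
proof (induction I rule: finite_induct)
  case (insert p I)
  then show ?case
    by (simp add: lap_add[OF _ Ck_on_sum[OF W(1)] y])
qed (simp add: lap_const)

lemma lap_exp:
  assumes F: "Ck_on 2 W F" and y: "y \<in> W"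
  shows "lap (\<lambda>z. exp (F z)) y = exp (F y) * (lap F y + gip F F y)"
proof -
  have 1: "partial i (\<lambda>z. exp (F z)) z = exp (F z) * partial i F z" if "z \<in> W" for i z
    using partial_real_comp(2)[OF Ck2_differentiable(1)[OF F that] DERIV_exp] .
  have e: "(\<lambda>z. exp (F z)) differentiable at y"
    using partial_real_comp(1)[OF Ck2_differentiable(1)[OF F y] DERIV_exp] .
  have 2: "partial i (partial j (\<lambda>z. exp (F z))) y = exp (F y) * (partial i (partial j F) y + partial i F y * partial j F y)" for i j
  proof -
    have "partial i (partial j (\<lambda>z. exp (F z))) y = partial i (\<lambda>z. exp (F z) * partial j F z) y"
      by (rule partial_cong[OF W(1) y]) (rule 1)
    then show ?thesis
      by (simp add: partial_mult e Ck2_differentiable[OF F y] 1[OF y] algebra_simps)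
  qed
  show ?thesis
    unfolding lap_eq[OF W y Ck_on_exp[OF W(1) F]] lap_eq[OF W y F] 2 1[OF y]
    by (simp add: gip_def algebra_simps sum.distrib sum_distrib_left)
qed

end

lemma smooth_gip:
  assumes "smooth_on U F" "smooth_on U H" shows "smooth_on U (gip F H)"
proof -
  have *: "gip F H = (\<lambda>y. \<Sum>i\<in>UNIV. \<Sum>j\<in>UNIV. a i j y * partial i F y * partial j H y)"
    by (rule ext) (rule gip_def)
  show ?thesis unfolding * by (intro smooth_intros open_U smooth_a assms finite)
qed

lemma Ck2_smooth: "smooth_on U F \<Longrightarrow> W \<subseteq> U \<Longrightarrow> Ck_on 2 W F"
  unfolding smooth_on_def using Ck_on_subset by blast

lemma smooth_lap:
  assumes "smooth_on U F" shows "smooth_on U (lap F)"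
proof -
  have *: "lap F y = (\<Sum>i\<in>UNIV. \<Sum>j\<in>UNIV. a i j y * partial i (partial j F) y) + (\<Sum>k\<in>UNIV. b k y * partial k F y)"
    if "y \<in> U" for y
    using lap_eq[OF open_U subset_refl that Ck2_smooth[OF assms subset_refl]] .
  have sm: "smooth_on U (\<lambda>y. (\<Sum>i\<in>UNIV. \<Sum>j\<in>UNIV. a i j y * partial i (partial j F) y) + (\<Sum>k\<in>UNIV. b k y * partial k F y))"
    by (intro smooth_intros open_U smooth_a smooth_b assms finite)
  show ?thesis by (rule iffD2[OF smooth_on_cong[OF open_U *] sm])
qed

subsection \<open>The Bochner formula\<close>

text \<open>\<open>hess F i j\<close> is $\nabla_j (\operatorname{grad} F)^i$ and \<open>cov2 F m j\<close> is $\nabla_j \nabla_m F$.\<close>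

definition hess :: "(real^'n \<Rightarrow> real) \<Rightarrow> 'n \<Rightarrow> 'n \<Rightarrow> real^'n \<Rightarrow> real"
  where "hess F i j y = partial j (\<lambda>z. coord_grad G F z $ i) y + (\<Sum>k\<in>UNIV. \<Gamma> i j k y * coord_grad G F y $ k)"

definition cov2 :: "(real^'n \<Rightarrow> real) \<Rightarrow> 'n \<Rightarrow> 'n \<Rightarrow> real^'n \<Rightarrow> real"
  where "cov2 F m j y = partial j (partial m F) y - (\<Sum>l\<in>UNIV. \<Gamma> l j m y * partial l F y)"

context
  fixes F :: "real^'n \<Rightarrow> real"
  assumes F: "smooth_on U F"
begin

lemma smooth_grad: "smooth_on U (\<lambda>z. coord_grad G F z $ i)"
  unfolding coord_grad_nth by (intro smooth_intros open_U smooth_a F finite)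

lemma smooth_hess: "smooth_on U (hess F i j)"
proof -
  have *: "hess F i j = (\<lambda>y. partial j (\<lambda>z. coord_grad G F z $ i) y + (\<Sum>k\<in>UNIV. \<Gamma> i j k y * coord_grad G F y $ k))"
    by (rule ext) (rule hess_def)
  show ?thesis unfolding * by (intro smooth_intros open_U smooth_grad smooth_christoffel finite)
qed

lemma lap_hess: "lap F y = (\<Sum>i\<in>UNIV. hess F i i y)"
  by (simp add: lap_def coord_div_def hess_def)

lemma diff_partial: "y \<in> U \<Longrightarrow> partial i F differentiable at y"
  by (intro smooth_on_differentiable[OF _ open_U] smooth_on_partial F)

lemma diff_grad: "y \<in> U \<Longrightarrow> (\<lambda>z. coord_grad G F z $ i) differentiable at y"
  by (rule smooth_on_differentiable[OF smooth_grad open_U])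

lemma diff_hess: "y \<in> U \<Longrightarrow> hess F i j differentiable at y"
  by (rule smooth_on_differentiable[OF smooth_hess open_U])

lemma cov2_sym: "y \<in> U \<Longrightarrow> cov2 F m j y = cov2 F j m y"
  using partial_commute[OF open_U Ck2_smooth[OF F subset_refl], of y j m]
  by (simp add: cov2_def \<Gamma>_sym[of y _ j m])

text \<open>Raising an index commutes with covariant differentiation, by \<open>partial_a\<close>:
  one of its two sums cancels the Christoffel term of \<open>hess\<close>, the other is that of
  \<open>cov2\<close>.\<close>

lemma hess_eq:
  assumes y: "y \<in> U" shows "hess F i j y = (\<Sum>m\<in>UNIV. a i m y * cov2 F m j y)"
proof -
  have "hess F i j y = (\<Sum>l\<in>UNIV. partial j (a i l) y * partial l F y + a i l y * partial j (partial l F) y)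
      + (\<Sum>k\<in>UNIV. \<Sum>l\<in>UNIV. \<Gamma> i j k y * a k l y * partial l F y)"
    unfolding hess_def coord_grad_nth
    by (simp add: partial_sum partial_mult diff_a y diff_partial differentiable_mult sum_distrib_left mult_ac add.commute)
  also have "(\<Sum>k\<in>UNIV. \<Sum>l\<in>UNIV. \<Gamma> i j k y * a k l y * partial l F y) = (\<Sum>l\<in>UNIV. (\<Sum>k\<in>UNIV. \<Gamma> i j k y * a k l y) * partial l F y)"
    by (subst sum.swap) (simp add: sum_distrib_right)
  also have "(\<Sum>l\<in>UNIV. partial j (a i l) y * partial l F y + a i l y * partial j (partial l F) y)
    = (\<Sum>l\<in>UNIV. a i l y * partial j (partial l F) y)
    - (\<Sum>l\<in>UNIV. \<Sum>m\<in>UNIV. a i m y * (\<Gamma> l j m y * partial l F y)) - (\<Sum>l\<in>UNIV. (\<Sum>k\<in>UNIV. \<Gamma> i j k y * a k l y) * partial l F y)"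
    by (simp add: partial_a[OF y] sum.distrib sum_subtractf left_diff_distrib right_diff_distrib
        sum_distrib_right sum_distrib_left sum_negf mult_ac)
  also have "(\<Sum>l\<in>UNIV. \<Sum>m\<in>UNIV. a i m y * (\<Gamma> l j m y * partial l F y)) = (\<Sum>m\<in>UNIV. a i m y * (\<Sum>l\<in>UNIV. \<Gamma> l j m y * partial l F y))"
    by (subst sum.swap) (simp add: sum_distrib_left)
  finally show ?thesis by (simp add: cov2_def right_diff_distrib sum_subtractf)
qed

text \<open>Half of the result comes from differentiating dF, half from differentiating grad F; the
  Christoffel term left over from the second completes the second derivatives in the first to
  \<open>cov2\<close>.\<close>

lemma partial_gip_self:
  assumes y: "y \<in> U"
  shows "partial k (gip F F) y = 2 * (\<Sum>m\<in>UNIV. cov2 F m k y * coord_grad G F y $ m)"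
proof -
  let ?X = "\<lambda>m. coord_grad G F y $ m"
  have gF: "gip F F = (\<lambda>z. \<Sum>i\<in>UNIV. partial i F z * coord_grad G F z $ i)"
    by (rule ext) (rule gip_grad)
  have dX: "partial k (\<lambda>z. coord_grad G F z $ i) y = (\<Sum>m\<in>UNIV. a i m y * cov2 F m k y) - (\<Sum>l\<in>UNIV. \<Gamma> i k l y * ?X l)" for i
    using hess_eq[OF y, of i k] by (simp add: hess_def)
  have "partial k (gip F F) y = (\<Sum>i\<in>UNIV. partial k (partial i F) y * ?X i) + (\<Sum>i\<in>UNIV. partial i F y * partial k (\<lambda>z. coord_grad G F z $ i) y)"
    unfolding gF by (simp add: partial_sum partial_mult diff_partial y diff_grad differentiable_mult sum.distrib)
  also have "(\<Sum>i\<in>UNIV. partial i F y * partial k (\<lambda>z. coord_grad G F z $ i) y)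
     = (\<Sum>i\<in>UNIV. \<Sum>m\<in>UNIV. cov2 F m k y * (a m i y * partial i F y)) - (\<Sum>i\<in>UNIV. \<Sum>l\<in>UNIV. \<Gamma> i k l y * partial i F y * ?X l)"
    unfolding dX by (simp add: right_diff_distrib sum_subtractf sum_distrib_left a_sym[OF y] mult_ac)
  also have "(\<Sum>i\<in>UNIV. \<Sum>m\<in>UNIV. cov2 F m k y * (a m i y * partial i F y)) = (\<Sum>m\<in>UNIV. cov2 F m k y * ?X m)"
    by (subst sum.swap) (simp add: sum_distrib_left[symmetric] coord_grad_nth)
  also have "(\<Sum>i\<in>UNIV. \<Sum>l\<in>UNIV. \<Gamma> i k l y * partial i F y * ?X l) = (\<Sum>l\<in>UNIV. (\<Sum>i\<in>UNIV. \<Gamma> i k l y * partial i F y) * ?X l)"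
    by (subst sum.swap) (simp add: sum_distrib_right)
  finally show ?thesis by (simp add: cov2_def left_diff_distrib sum_subtractf)
qed

lemma grad_gip_self:
  assumes y: "y \<in> U"
  shows "coord_grad G (gip F F) y $ i = 2 * (\<Sum>m\<in>UNIV. hess F i m y * coord_grad G F y $ m)"
proof -
  have "coord_grad G (gip F F) y $ i = 2 * (\<Sum>k\<in>UNIV. \<Sum>m\<in>UNIV. a i k y * cov2 F k m y * coord_grad G F y $ m)"
    by (simp add: coord_grad_nth[of "gip F F"] partial_gip_self[OF y] sum_distrib_left cov2_sym[OF y] mult_ac)
  also have "(\<Sum>k\<in>UNIV. \<Sum>m\<in>UNIV. a i k y * cov2 F k m y * coord_grad G F y $ m) = (\<Sum>m\<in>UNIV. hess F i m y * coord_grad G F y $ m)"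
    by (subst sum.swap) (simp add: hess_eq[OF y] sum_distrib_right)
  finally show ?thesis .
qed

text \<open>The left side is the covariant divergence of \<open>hess\<close> in its upper index. The
  second partial derivatives of grad F commute and match those of \<open>lap F\<close>; the
  Christoffel terms that remain are those of the curvature contracted once.\<close>

lemma contracted_ricci_identity:
  assumes y: "y \<in> U"
  shows "(\<Sum>i\<in>UNIV. partial i (hess F i m) y) + (\<Sum>i\<in>UNIV. \<Sum>j\<in>UNIV. \<Gamma> i i j y * hess F j m y)
      - (\<Sum>i\<in>UNIV. \<Sum>j\<in>UNIV. hess F i j y * \<Gamma> j i m y)
    = partial m (lap F) y + (\<Sum>k\<in>UNIV. ricci G m k y * coord_grad G F y $ k)"
proof -
  define X where "X i z = coord_grad G F z $ i" for i z
  have sX: "smooth_on U (X i)" for i unfolding X_def by (rule smooth_grad)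
  have dX: "X i differentiable at y" "partial j (X i) differentiable at y" for i j
    using smooth_on_differentiable[OF _ open_U y] sX smooth_on_partial by blast+
  have hX: "hess F i j = (\<lambda>z. partial j (X i) z + (\<Sum>k\<in>UNIV. \<Gamma> i j k z * X k z))" for i j
    by (rule ext) (simp add: hess_def X_def[abs_def])
  have lX: "lap F = (\<lambda>z. \<Sum>i\<in>UNIV. partial i (X i) z + (\<Sum>k\<in>UNIV. \<Gamma> i i k z * X k z))"
    by (rule ext) (simp add: lap_hess hX)
  have comm: "partial i (partial m (X i)) y = partial m (partial i (X i)) y" for i
    by (rule partial_commute[OF open_U Ck2_smooth[OF sX subset_refl] y])
  note d = partial_sum partial_mult partial_add diff_\<Gamma> y dX differentiable_mult differentiable_sum differentiable_add
  have 1: "(\<Sum>i\<in>UNIV. partial i (hess F i m) y) = (\<Sum>i\<in>UNIV. partial m (partial i (X i)) y)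
      + (\<Sum>i\<in>UNIV. \<Sum>k\<in>UNIV. partial i (\<Gamma> i m k) y * X k y) + (\<Sum>i\<in>UNIV. \<Sum>k\<in>UNIV. \<Gamma> i m k y * partial i (X k) y)"
    unfolding hX by (simp add: d comm sum.distrib)
  have 2: "partial m (lap F) y = (\<Sum>i\<in>UNIV. partial m (partial i (X i)) y)
      + (\<Sum>i\<in>UNIV. \<Sum>k\<in>UNIV. partial m (\<Gamma> i i k) y * X k y) + (\<Sum>i\<in>UNIV. \<Sum>k\<in>UNIV. \<Gamma> i i k y * partial m (X k) y)"
    unfolding lX by (simp add: d sum.distrib)
  have 3: "(\<Sum>i\<in>UNIV. \<Sum>j\<in>UNIV. \<Gamma> i i j y * hess F j m y) = (\<Sum>i\<in>UNIV. \<Sum>k\<in>UNIV. \<Gamma> i i k y * partial m (X k) y)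
      + (\<Sum>i\<in>UNIV. \<Sum>k\<in>UNIV. (\<Sum>j\<in>UNIV. \<Gamma> i i j y * \<Gamma> j m k y) * X k y)"
  proof -
    have "(\<Sum>i\<in>UNIV. \<Sum>j\<in>UNIV. \<Gamma> i i j y * hess F j m y) = (\<Sum>i\<in>UNIV. \<Sum>k\<in>UNIV. \<Gamma> i i k y * partial m (X k) y)
      + (\<Sum>i\<in>UNIV. \<Sum>j\<in>UNIV. \<Sum>k\<in>UNIV. \<Gamma> i i j y * \<Gamma> j m k y * X k y)"
      unfolding hX by (simp add: distrib_left sum.distrib sum_distrib_left mult.assoc)
    also have "(\<Sum>i\<in>UNIV. \<Sum>j\<in>UNIV. \<Sum>k\<in>UNIV. \<Gamma> i i j y * \<Gamma> j m k y * X k y)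
      = (\<Sum>i\<in>UNIV. \<Sum>k\<in>UNIV. \<Sum>j\<in>UNIV. \<Gamma> i i j y * \<Gamma> j m k y * X k y)"
      by (intro sum.cong refl sum.swap)
    finally show ?thesis by (simp add: sum_distrib_right)
  qed
  have 4: "(\<Sum>i\<in>UNIV. \<Sum>j\<in>UNIV. hess F i j y * \<Gamma> j i m y) = (\<Sum>i\<in>UNIV. \<Sum>k\<in>UNIV. \<Gamma> i m k y * partial i (X k) y)
      + (\<Sum>i\<in>UNIV. \<Sum>k\<in>UNIV. (\<Sum>j\<in>UNIV. \<Gamma> i m j y * \<Gamma> j i k y) * X k y)"
  proof -
    have sym: "\<Gamma> j i m y = \<Gamma> j m i y" for i j by (rule \<Gamma>_sym[OF y])
    have "(\<Sum>i\<in>UNIV. \<Sum>j\<in>UNIV. hess F i j y * \<Gamma> j i m y) = (\<Sum>j\<in>UNIV. \<Sum>i\<in>UNIV. hess F i j y * \<Gamma> j i m y)"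
      by (rule sum.swap)
    also have "\<dots> = (\<Sum>j\<in>UNIV. \<Sum>i\<in>UNIV. \<Gamma> j m i y * partial j (X i) y)
      + (\<Sum>j\<in>UNIV. \<Sum>i\<in>UNIV. \<Sum>k\<in>UNIV. \<Gamma> j m i y * \<Gamma> i j k y * X k y)"
      unfolding hX sym by (simp add: distrib_right distrib_left sum.distrib sum_distrib_left sum_distrib_right mult_ac)
    also have "(\<Sum>j\<in>UNIV. \<Sum>i\<in>UNIV. \<Sum>k\<in>UNIV. \<Gamma> j m i y * \<Gamma> i j k y * X k y)
      = (\<Sum>j\<in>UNIV. \<Sum>k\<in>UNIV. \<Sum>i\<in>UNIV. \<Gamma> j m i y * \<Gamma> i j k y * X k y)"
      by (intro sum.cong refl sum.swap)
    finally show ?thesis by (simp add: sum_distrib_right)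
  qed
  have 5: "(\<Sum>k\<in>UNIV. ricci G m k y * X k y) = (\<Sum>i\<in>UNIV. \<Sum>k\<in>UNIV. partial i (\<Gamma> i m k) y * X k y)
      - (\<Sum>i\<in>UNIV. \<Sum>k\<in>UNIV. partial m (\<Gamma> i i k) y * X k y)
      + (\<Sum>i\<in>UNIV. \<Sum>k\<in>UNIV. (\<Sum>j\<in>UNIV. \<Gamma> i i j y * \<Gamma> j m k y) * X k y)
      - (\<Sum>i\<in>UNIV. \<Sum>k\<in>UNIV. (\<Sum>j\<in>UNIV. \<Gamma> i m j y * \<Gamma> j i k y) * X k y)"
  proof -
    have "(\<Sum>k\<in>UNIV. ricci G m k y * X k y) = (\<Sum>k\<in>UNIV. \<Sum>i\<in>UNIV. curvature G i i m k y * X k y)"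
      by (simp add: ricci_def sum_distrib_right)
    also have "\<dots> = (\<Sum>i\<in>UNIV. \<Sum>k\<in>UNIV. curvature G i i m k y * X k y)"
      by (rule sum.swap)
    finally show ?thesis
      by (simp add: curvature_def left_diff_distrib distrib_right sum.distrib sum_subtractf)
  qed
  show ?thesis unfolding 1 2 3 4 X_def[symmetric] 5 by simp
qed

text \<open>Bochner's formula. By \<open>grad_gip_self\<close> the gradient of |grad F|^2 is twice
  the Hessian applied to grad F. In its divergence, differentiating grad F produces the square of
  the Hessian, and differentiating the Hessian is covered by
  \<open>contracted_ricci_identity\<close>.\<close>

lemma lap_gip_self:
  assumes y: "y \<in> U"
  shows "lap (gip F F) y = 2 * (\<Sum>i\<in>UNIV. \<Sum>j\<in>UNIV. hess F i j y * hess F j i y) + 2 * gip F (lap F) y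
    + 2 * (\<Sum>j\<in>UNIV. \<Sum>k\<in>UNIV. ricci G j k y * coord_grad G F y $ j * coord_grad G F y $ k)"
proof -
  define X where "X i = coord_grad G F y $ i" for i
  have pX: "partial i (\<lambda>z. coord_grad G F z $ m) y = hess F m i y - (\<Sum>k\<in>UNIV. \<Gamma> m i k y * X k)" for i m
    by (simp add: hess_def X_def)
  have "lap (gip F F) y = (\<Sum>i\<in>UNIV. partial i (\<lambda>z. 2 * (\<Sum>m\<in>UNIV. hess F i m z * coord_grad G F z $ m)) y
      + (\<Sum>j\<in>UNIV. \<Gamma> i i j y * (2 * (\<Sum>m\<in>UNIV. hess F j m y * X m))))"
    unfolding lap_def coord_div_def grad_gip_self[OF y] X_def
    by (intro sum.cong refl arg_cong2[of _ _ _ _ "(+)"] partial_cong[OF open_U y] grad_gip_self)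
  also have "\<dots> = 2 * ((\<Sum>i\<in>UNIV. \<Sum>m\<in>UNIV. partial i (hess F i m) y * X m)
      + (\<Sum>i\<in>UNIV. \<Sum>m\<in>UNIV. hess F i m y * partial i (\<lambda>z. coord_grad G F z $ m) y)
      + (\<Sum>i\<in>UNIV. \<Sum>j\<in>UNIV. \<Sum>m\<in>UNIV. \<Gamma> i i j y * hess F j m y * X m))"
    by (simp add: partial_cmult partial_sum partial_mult diff_hess diff_grad y differentiable_mult differentiable_sum
        sum.distrib sum_distrib_left distrib_left X_def mult_ac)
  also have "(\<Sum>i\<in>UNIV. \<Sum>m\<in>UNIV. hess F i m y * partial i (\<lambda>z. coord_grad G F z $ m) y)
     = (\<Sum>i\<in>UNIV. \<Sum>j\<in>UNIV. hess F i j y * hess F j i y) - (\<Sum>i\<in>UNIV. \<Sum>j\<in>UNIV. \<Sum>m\<in>UNIV. hess F i j y * \<Gamma> j i m y * X m)"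
    unfolding pX by (simp add: right_diff_distrib sum_subtractf sum_distrib_left mult.assoc)
  also have "(\<Sum>i\<in>UNIV. \<Sum>j\<in>UNIV. \<Sum>m\<in>UNIV. hess F i j y * \<Gamma> j i m y * X m)
     = (\<Sum>m\<in>UNIV. (\<Sum>i\<in>UNIV. \<Sum>j\<in>UNIV. hess F i j y * \<Gamma> j i m y) * X m)"
    by (subst sum.swap[of _ _ "UNIV :: 'n set"], subst (2) sum.swap, subst sum.swap)
      (simp add: sum_distrib_right, rule sum.swap)
  also have "(\<Sum>i\<in>UNIV. \<Sum>j\<in>UNIV. \<Sum>m\<in>UNIV. \<Gamma> i i j y * hess F j m y * X m)
     = (\<Sum>m\<in>UNIV. (\<Sum>i\<in>UNIV. \<Sum>j\<in>UNIV. \<Gamma> i i j y * hess F j m y) * X m)"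
    by (subst sum.swap[of _ _ "UNIV :: 'n set"], subst (2) sum.swap, subst sum.swap)
      (simp add: sum_distrib_right, rule sum.swap)
  also have "(\<Sum>i\<in>UNIV. \<Sum>m\<in>UNIV. partial i (hess F i m) y * X m) = (\<Sum>m\<in>UNIV. (\<Sum>i\<in>UNIV. partial i (hess F i m) y) * X m)"
    by (subst sum.swap) (simp add: sum_distrib_right)
  finally have "lap (gip F F) y = 2 * (\<Sum>i\<in>UNIV. \<Sum>j\<in>UNIV. hess F i j y * hess F j i y)
      + 2 * (\<Sum>m\<in>UNIV. ((\<Sum>i\<in>UNIV. partial i (hess F i m) y) + (\<Sum>i\<in>UNIV. \<Sum>j\<in>UNIV. \<Gamma> i i j y * hess F j m y)
      - (\<Sum>i\<in>UNIV. \<Sum>j\<in>UNIV. hess F i j y * \<Gamma> j i m y)) * X m)"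
    by (simp add: algebra_simps sum.distrib sum_subtractf)
  also have "(\<Sum>m\<in>UNIV. ((\<Sum>i\<in>UNIV. partial i (hess F i m) y) + (\<Sum>i\<in>UNIV. \<Sum>j\<in>UNIV. \<Gamma> i i j y * hess F j m y)
      - (\<Sum>i\<in>UNIV. \<Sum>j\<in>UNIV. hess F i j y * \<Gamma> j i m y)) * X m)
     = gip F (lap F) y + (\<Sum>j\<in>UNIV. \<Sum>k\<in>UNIV. ricci G j k y * X j * X k)"
    unfolding contracted_ricci_identity[OF y] gip_commute[OF y, of F "lap F"] gip_grad[of "lap F" F] X_def
    by (simp add: distrib_right distrib_left sum.distrib sum_distrib_left sum_distrib_right mult_ac)
  finally show ?thesis by (simp add: X_def)
qed

lemma bochner_ineq:
  assumes y: "y \<in> U" and Ric: "\<And>v. (\<Sum>j\<in>UNIV. \<Sum>k\<in>UNIV. ricci G j k y * v $ j * v $ k) \<ge> 0"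
  shows "lap (gip F F) y \<ge> 2 * (lap F y)\<^sup>2 / CARD('n) + 2 * gip F (lap F) y"
proof -
  have "(lap F y)\<^sup>2 \<le> CARD('n) * (\<Sum>i\<in>UNIV. \<Sum>j\<in>UNIV. hess F i j y * hess F j i y)"
    unfolding lap_hess
    by (rule psd_trace_square[of "\<lambda>i j. a i j y" "\<lambda>i j. cov2 F i j y"])
      (use a_sym a_psd cov2_sym hess_eq y in auto)
  then have "(lap F y)\<^sup>2 / CARD('n) \<le> (\<Sum>i\<in>UNIV. \<Sum>j\<in>UNIV. hess F i j y * hess F j i y)"
    by (simp add: divide_le_eq mult.commute)
  then show ?thesis using lap_gip_self[OF y] Ric[of "coord_grad G F y"] by simp
qed

end
end

subsection \<open>A maximum principle for first order expressions in a solution\<close>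

lemma Ck_on_translate:
  fixes F :: "real^'n::finite \<Rightarrow> 'b::real_normed_vector"
  assumes S: "open S" and T: "open T" "\<And>z. z \<in> T \<Longrightarrow> z + e \<in> S" and F: "Ck_on k S F"
  shows "Ck_on k T (\<lambda>z. F (z + e))"
  using F
proof (induction k arbitrary: F)
  case 0
  then show ?case
    using T(2) by (auto intro!: continuous_on_compose2[of S F T "\<lambda>z. z + e"] continuous_intros)
next
  case (Suc k)
  note d = partial_translate[OF Ck_on_differentiable[OF Suc.prems S T(2)]]
  have "Ck_on k T (partial i (\<lambda>z. F (z + e)))" for i
    by (rule iffD2[OF Ck_on_cong[OF T(1) d(2)]], assumption) (use Suc in auto)
  then show ?case using d(1) by (auto simp: differentiable_on_def intro: differentiable_at_withinI)
qed

text \<open>The hypothesis \<open>lim\<close> is continuous convergence, along all subsequences and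
  all convergent sequences of points; on a compact set it does the work of uniform convergence, and
  difference quotients provide it directly. The penalty makes \<open>P0\<close> the only zero of Z +
  \<Psi>, so minimisers of the approximations can accumulate nowhere else.\<close>

lemma approximate_minimum:
  fixes z :: "nat \<Rightarrow> 'e::metric_space \<Rightarrow> real"
  assumes K: "compact K" "P0 \<in> K" and z: "\<And>j. continuous_on K (z j)"
    and lim: "\<And>(r::nat \<Rightarrow> nat) P P'. strict_mono r \<Longrightarrow> (\<And>j. P j \<in> K) \<Longrightarrow> P' \<in> K \<Longrightarrow> P \<longlonglongrightarrow> P'
      \<Longrightarrow> (\<lambda>j. z (r j) (P j)) \<longlonglongrightarrow> Z P'"
    and Z: "\<And>P. P \<in> K \<Longrightarrow> Z P \<ge> 0" "Z P0 = 0"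
    and \<Psi>: "continuous_on K \<Psi>" "\<And>P. P \<in> K \<Longrightarrow> P \<noteq> P0 \<Longrightarrow> \<Psi> P > 0" "\<Psi> P0 = 0"
  obtains r P where "strict_mono (r::nat \<Rightarrow> nat)" "\<And>j. P j \<in> K" "P \<longlonglongrightarrow> P0"
    "\<And>j Q. Q \<in> K \<Longrightarrow> z (r j) (P j) + \<Psi> (P j) \<le> z (r j) Q + \<Psi> Q"
proof -
  have "\<exists>P\<in>K. \<forall>Q\<in>K. z j P + \<Psi> P \<le> z j Q + \<Psi> Q" for j
    using continuous_attains_inf[OF K(1), of "\<lambda>P. z j P + \<Psi> P"] K(2) z[of j] \<Psi>(1)
    by (auto intro: continuous_on_add)
  then obtain P where P: "\<And>j. P j \<in> K" "\<And>j Q. Q \<in> K \<Longrightarrow> z j (P j) + \<Psi> (P j) \<le> z j Q + \<Psi> Q"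
    by metis
  obtain P' r where r: "P' \<in> K" "strict_mono r" "(P \<circ> r) \<longlonglongrightarrow> P'"
    using K(1) P(1) unfolding compact_def by metis
  have "(\<lambda>j. z (r j) (P (r j)) + \<Psi> (P (r j))) \<longlonglongrightarrow> Z P' + \<Psi> P'"
    using r P(1) by (intro tendsto_add lim continuous_on_tendsto_compose[OF \<Psi>(1)]) (auto simp: o_def)
  moreover have "(\<lambda>j. z (r j) P0) \<longlonglongrightarrow> 0"
    using lim[OF r(2), of "\<lambda>_. P0" P0] K(2) Z(2) by simp
  ultimately have "Z P' + \<Psi> P' \<le> 0"
    by (rule LIMSEQ_le) (use P(2)[OF K(2)] \<Psi>(3) in auto)
  then have "P' = P0" using Z(1)[OF r(1)] \<Psi>(2)[OF r(1)] by (cases "P' = P0") auto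
  then show thesis using that[of r "P \<circ> r"] r P by (auto simp: o_def)
qed

section \<open>Limits at moving points and the commutator with difference quotients\<close>

context coord_metric
begin

lemma lap_nonneg_at_min:
  assumes W: "open W" "W \<subseteq> U" and H: "Ck_on 2 W H" and y: "y \<in> W" and min: "\<And>z. z \<in> W \<Longrightarrow> H y \<le> H z"
  shows "lap H y \<ge> 0"
proof -
  note test = second_derivative_test[OF W(1) H y min]
  have "(\<Sum>i\<in>UNIV. \<Sum>j\<in>UNIV. a i j y * partial i (partial j H) y) \<ge> 0"
    by (rule psd_trace_nonneg) (use test(2) a_sym a_psd y W in auto)
  then show ?thesis by (simp add: lap_eq[OF W y H] test(1))
qed

text \<open>Joint continuity in space and time allows both arguments to move at once; this and the
  next two facts supply the hypothesis \<open>lim\<close> of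
  \<open>approximate_minimum\<close>.\<close>

lemma seq_tendsto:
  assumes h: "continuous_on (U \<times> {0<..}) (\<lambda>(y, t). h t y)"
    and lim: "ys \<longlonglongrightarrow> y0" "ts \<longlonglongrightarrow> t0" and 0: "y0 \<in> U" "t0 > (0::real)"
  shows "(\<lambda>j. h (ts j) (ys j)) \<longlonglongrightarrow> h t0 y0"
proof -
  have "isCont (\<lambda>(y, t). h t y) (y0, t0)"
    using h 0 open_U by (subst (asm) continuous_on_eq_continuous_at) (auto intro: open_Times)
  from isCont_tendsto_compose[OF this tendsto_Pair[OF lim]] show ?thesis by simp
qed

lemma seq_dq_space:
  assumes d: "\<And>t y. t > 0 \<Longrightarrow> y \<in> U \<Longrightarrow> h t differentiable at y"
    and h: "continuous_on (U \<times> {0<..}) (\<lambda>(y, t). partial k (h t) y)"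
    and lim: "ys \<longlonglongrightarrow> y0" "ts \<longlonglongrightarrow> t0" and 0: "y0 \<in> U" "t0 > (0::real)"
    and s: "s \<longlonglongrightarrow> 0" "\<And>j::nat. s j > 0"
  shows "(\<lambda>j. (h (ts j) (ys j + s j *\<^sub>R axis k 1) - h (ts j) (ys j)) / s j) \<longlonglongrightarrow> partial k (h t0) y0"
proof -
  have "(\<lambda>j. ((\<lambda>(y, t). h t y) ((ys j, ts j) + s j *\<^sub>R (axis k 1, 0)) - (\<lambda>(y, t). h t y) (ys j, ts j)) / s j)
      \<longlonglongrightarrow> (\<lambda>(y, t). partial k (h t) y) (y0, t0)"
  proof (rule difference_quotient_tendsto[OF _ _ _ h tendsto_Pair[OF lim] s])
    show "open (U \<times> {0::real<..})" by (intro open_Times open_U) auto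
    show "(y0, t0) \<in> U \<times> {0<..}" using 0 by auto
    show "((\<lambda>\<theta>. (\<lambda>(y, t). h t y) (Q + \<theta> *\<^sub>R (axis k 1, 0))) has_real_derivative (\<lambda>(y, t). partial k (h t) y) Q) (at 0)"
      if "Q \<in> U \<times> {0<..}" for Q
      using axis_directional[of "h (snd Q)" "fst Q" 0 k] d[of "snd Q" "fst Q"] that by (cases Q) auto
  qed
  then show ?thesis by simp
qed

lemma seq_dq_time:
  assumes d: "\<And>t y. t > 0 \<Longrightarrow> y \<in> U \<Longrightarrow> ((\<lambda>t. h t y) has_real_derivative h' t y) (at t)"
    and h: "continuous_on (U \<times> {0<..}) (\<lambda>(y, t). h' t y)"
    and lim: "ys \<longlonglongrightarrow> y0" "ts \<longlonglongrightarrow> t0" and 0: "y0 \<in> U" "t0 > (0::real)"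
    and s: "s \<longlonglongrightarrow> 0" "\<And>j::nat. s j > 0"
  shows "(\<lambda>j. (h (ts j + s j) (ys j) - h (ts j) (ys j)) / s j) \<longlonglongrightarrow> h' t0 y0"
proof -
  have "(\<lambda>j. ((\<lambda>(y, t). h t y) ((ys j, ts j) + s j *\<^sub>R (0, 1)) - (\<lambda>(y, t). h t y) (ys j, ts j)) / s j)
      \<longlonglongrightarrow> (\<lambda>(y, t). h' t y) (y0, t0)"
  proof (rule difference_quotient_tendsto[OF _ _ _ h tendsto_Pair[OF lim] s])
    show "open (U \<times> {0::real<..})" by (intro open_Times open_U) auto
    show "(y0, t0) \<in> U \<times> {0<..}" using 0 by auto
    show "((\<lambda>\<theta>. (\<lambda>(y, t). h t y) (Q + \<theta> *\<^sub>R (0, 1))) has_real_derivative (\<lambda>(y, t). h' t y) Q) (at 0)"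
      if "Q \<in> U \<times> {0<..}" for Q
    proof (cases Q)
      case (Pair y t)
      then have "((\<lambda>t. h t y) has_real_derivative h' t y) (at t)" using d that by auto
      then show ?thesis using DERIV_shift[of "\<lambda>t. h t y" "h' t y" 0 t] Pair by (simp add: add.commute)
    qed
  qed
  then show ?thesis by simp
qed

lemma shift_near:
  assumes "ball y0 (2 * \<rho>) \<subseteq> U" "0 < s" "s < \<rho>" "z \<in> ball y0 \<rho>"
  shows "z + s *\<^sub>R axis k 1 \<in> U" "z \<in> U"
proof -
  have "dist (z + s *\<^sub>R axis k 1) y0 \<le> dist z y0 + s"
    using norm_triangle_ineq[of "z - y0" "s *\<^sub>R axis k 1"] assms
    by (simp add: dist_norm algebra_simps norm_axis_1)
  then have "z + s *\<^sub>R axis k 1 \<in> ball y0 (2 * \<rho>)" using assms by (simp add: dist_commute)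
  moreover have "z \<in> ball y0 (2 * \<rho>)" using assms by simp
  ultimately show "z + s *\<^sub>R axis k 1 \<in> U" "z \<in> U" using assms(1) by blast+
qed

text \<open>The commutator of \<open>lap\<close> with a difference quotient contains only derivatives of \<open>r\<close> up to
  order two, so it vanishes in the limit although \<open>r\<close> need not have third derivatives.\<close>

lemma lap_difference_quotient:
  fixes r :: "real \<Rightarrow> real^'n \<Rightarrow> real"
  assumes C2: "\<And>t. t > 0 \<Longrightarrow> Ck_on 2 U (r t)"
    and c1: "\<And>i. continuous_on (U \<times> {0<..}) (\<lambda>(y, t). partial i (r t) y)"
    and c2: "\<And>i j. continuous_on (U \<times> {0<..}) (\<lambda>(y, t). partial i (partial j (r t)) y)"
    and jet: "\<And>i. partial i (r t0) y0 = 0" "\<And>i j. partial i (partial j (r t0)) y0 = 0"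
    and V: "smooth_on U V"
    and lim: "ys \<longlonglongrightarrow> y0" "ts \<longlonglongrightarrow> t0" and 0: "y0 \<in> U" "t0 > (0::real)"
    and s: "s \<longlonglongrightarrow> 0" "\<And>j::nat. s j > 0"
  shows "(\<lambda>j. lap (\<lambda>z. V z * ((r (ts j) (z + s j *\<^sub>R axis k 1) - r (ts j) z) / s j)) (ys j)
    - V (ys j) * ((lap (r (ts j)) (ys j + s j *\<^sub>R axis k 1) - lap (r (ts j)) (ys j)) / s j)) \<longlonglongrightarrow> 0"
proof -
  obtain \<rho>0 where \<rho>0: "\<rho>0 > 0" "ball y0 \<rho>0 \<subseteq> U" using open_U 0(1) open_contains_ball by blast
  define \<rho> where "\<rho> = \<rho>0 / 2"
  have \<rho>: "\<rho> > 0" "ball y0 (2 * \<rho>) \<subseteq> U" using \<rho>0 by (auto simp: \<rho>_def)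
  let ?W = "ball y0 \<rho>"
  have W: "open ?W" "?W \<subseteq> U" using \<rho> by auto
  define e where "e = (axis k 1 :: real^'n)"
  define d where "d h j = (h (ts j) (ys j + s j *\<^sub>R e) - h (ts j) (ys j)) / s j" for h :: "real \<Rightarrow> real^'n \<Rightarrow> real" and j
  \<comment> \<open>\<open>E j\<close> is the commutator in closed form: differences of the
    coefficients of the Laplacian, then the two Leibniz terms of \<open>V\<close>. Each summand
    contains a factor that tends to a first or second spatial derivative of \<open>r t0\<close> at
    \<open>y0\<close>, hence to 0.\<close>
  define E where "E j = - V (ys j) * ((\<Sum>p\<in>UNIV. \<Sum>q\<in>UNIV. d (\<lambda>_. a p q) j * partial p (partial q (r (ts j))) (ys j + s j *\<^sub>R e))
       + (\<Sum>l\<in>UNIV. d (\<lambda>_. b l) j * partial l (r (ts j)) (ys j + s j *\<^sub>R e)))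
    + d r j * lap V (ys j)
    + 2 * (\<Sum>p\<in>UNIV. \<Sum>q\<in>UNIV. a p q (ys j) * partial p V (ys j) * d (\<lambda>t. partial q (r t)) j)" for j
  have C: "Ck_on (Suc (Suc 0)) U (r t)" if "t > 0" for t using C2[OF that] by (simp only: numeral_2_eq_2)
  have C1: "Ck_on (Suc 0) U (partial i (r t))" if "t > 0" for t i using C[OF that] by simp
  have dr: "r t differentiable at y" "partial i (r t) differentiable at y" if "t > 0" "y \<in> U" for t y i
    using Ck_on_differentiable[OF C[OF that(1)] open_U that(2)] Ck_on_differentiable[OF C1[OF that(1)] open_U that(2)] by auto
  have se: "(\<lambda>j. ys j + s j *\<^sub>R e) \<longlonglongrightarrow> y0"
    using tendsto_add[OF lim(1) tendsto_scaleR[OF s(1) tendsto_const[of e]]] by simp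
  have cont_smooth: "continuous_on (U \<times> {0<..}) (\<lambda>(y, t::real). h y)" if "smooth_on U h" for h :: "real^'n \<Rightarrow> real"
    unfolding case_prod_beta
    by (rule continuous_on_compose2[OF smooth_on_continuous[OF that], of _ fst]) (auto intro: continuous_intros)
  have dsm: "d (\<lambda>_. h) \<longlonglongrightarrow> partial k h y0" if "smooth_on U h" for h
    unfolding d_def[abs_def] e_def
    by (rule seq_dq_space[of "\<lambda>_. h", OF _ _ lim 0 s])
      (auto intro: smooth_on_differentiable[OF that open_U] cont_smooth[OF smooth_on_partial[OF that]])
  have ssm: "(\<lambda>j. h (ys j)) \<longlonglongrightarrow> h y0" if "smooth_on U h" for h :: "real^'n \<Rightarrow> real"
    by (rule seq_tendsto[of "\<lambda>_. h", OF cont_smooth[OF that] lim 0])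
  have t1: "(\<lambda>j. partial l (r (ts j)) (ys j + s j *\<^sub>R e)) \<longlonglongrightarrow> 0" for l
    using seq_tendsto[of "\<lambda>t. partial l (r t)", OF c1 se lim(2) 0] jet(1) by simp
  have t2: "(\<lambda>j. partial p (partial q (r (ts j))) (ys j + s j *\<^sub>R e)) \<longlonglongrightarrow> 0" for p q
    using seq_tendsto[of "\<lambda>t. partial p (partial q (r t))", OF c2 se lim(2) 0] jet(2) by simp
  have t3: "d r \<longlonglongrightarrow> 0"
    using seq_dq_space[OF dr(1) c1 lim 0 s, of k] jet(1) by (simp add: d_def[abs_def] e_def)
  have t4: "d (\<lambda>t. partial q (r t)) \<longlonglongrightarrow> 0" for q
    using seq_dq_space[OF dr(2) c2 lim 0 s, of q k] jet(2) by (simp add: d_def[abs_def] e_def)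
  have "E \<longlonglongrightarrow> - V y0 * ((\<Sum>p\<in>UNIV. \<Sum>q\<in>UNIV. partial k (a p q) y0 * 0) + (\<Sum>l\<in>UNIV. partial k (b l) y0 * 0))
      + 0 * lap V y0 + 2 * (\<Sum>p\<in>UNIV. \<Sum>q\<in>UNIV. a p q y0 * partial p V y0 * 0)"
    unfolding E_def[abs_def]
    by (intro tendsto_intros dsm ssm t1 t2 t3 t4 smooth_a smooth_b V smooth_lap smooth_on_partial)
  then have "E \<longlonglongrightarrow> 0" by simp
  moreover have "eventually (\<lambda>j. E j = lap (\<lambda>z. V z * ((r (ts j) (z + s j *\<^sub>R axis k 1) - r (ts j) z) / s j)) (ys j)
    - V (ys j) * ((lap (r (ts j)) (ys j + s j *\<^sub>R axis k 1) - lap (r (ts j)) (ys j)) / s j)) sequentially"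
  proof -
    have "eventually (\<lambda>j. ys j \<in> ?W) sequentially"
      using tendstoD[OF lim(1) \<rho>(1)] by (simp add: dist_commute)
    moreover have "eventually (\<lambda>j. s j < \<rho>) sequentially" by (rule order_tendstoD(2)[OF s(1) \<rho>(1)])
    moreover have "eventually (\<lambda>j. ts j > 0) sequentially" by (rule order_tendstoD(1)[OF lim(2) 0(2)])
    ultimately show ?thesis
    proof eventually_elim
      case (elim j)
      define \<epsilon> where "\<epsilon> = s j *\<^sub>R e"
      define y where "y = ys j"
      define R where "R = r (ts j)"
      define D where "D z = (R (z + \<epsilon>) - R z) / s j" for z
      have sh: "z + \<epsilon> \<in> U" "z \<in> U" if "z \<in> ?W" for z
        using shift_near[OF \<rho>(2) s(2) elim(2) that] by (simp_all add: \<epsilon>_def e_def)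
      have y: "y \<in> ?W" using elim(1) by (simp add: y_def)
      note shy = sh[OF y]
      have dR: "R differentiable at z" "partial i R differentiable at z" if "z \<in> U" for z i
        using dr[OF elim(3) that] by (simp_all add: R_def)
      have CR: "Ck_on 2 U R" using C2[OF elim(3)] by (simp add: R_def)
      have dH: "partial i (\<lambda>z. (H (z + \<epsilon>) - H z) / s j) z = (partial i H (z + \<epsilon>) - partial i H z) / s j"
        if "H differentiable at z" "H differentiable at (z + \<epsilon>)" for H :: "real^'n \<Rightarrow> real" and i z
      proof -
        have "partial i (\<lambda>z. (H (z + \<epsilon>) - H z) / s j) z = partial i (\<lambda>z. (1 / s j) * (H (z + \<epsilon>) - H z)) z"
          by simp
        also have "\<dots> = (1 / s j) * (partial i H (z + \<epsilon>) - partial i H z)"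
          by (subst partial_cmult) (simp_all add: partial_diff partial_translate that differentiable_diff)
        finally show ?thesis by simp
      qed
      have D1: "partial i D z = (partial i R (z + \<epsilon>) - partial i R z) / s j" if "z \<in> ?W" for i z
        unfolding D_def[abs_def] by (rule dH) (use sh[OF that] dR in auto)
      have D2: "partial i (partial l D) y = (partial i (partial l R) (y + \<epsilon>) - partial i (partial l R) y) / s j" for i l
      proof -
        have "partial i (partial l D) y = partial i (\<lambda>z. (partial l R (z + \<epsilon>) - partial l R z) / s j) y"
          by (rule partial_cong[OF W(1) y D1])
        also have "\<dots> = (partial i (partial l R) (y + \<epsilon>) - partial i (partial l R) y) / s j"
          by (rule dH) (use shy dR in auto)
        finally show ?thesis .
      qed
      have "Ck_on 2 ?W (\<lambda>z. (1 / s j) * (R (z + \<epsilon>) - R z))"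
        by (intro Ck_on_mult Ck_on_diff Ck_on_const W(1) Ck_on_translate[OF open_U W(1) sh(1) CR] Ck_on_subset[OF CR W(2)])
      then have CD: "Ck_on 2 ?W D" by (simp add: D_def[abs_def])
      have CV: "Ck_on 2 ?W V" by (rule Ck2_smooth[OF V W(2)])
      \<comment> \<open>The discrete product rule: a (R'(y + \<epsilon>) - R'(y)) is the difference
        of the products a R' minus the difference of a times R'(y + \<epsilon>), for
        \<open>a\<close> with second and \<open>b\<close> with first derivatives.\<close>
      have lD: "lap D y = (lap R (y + \<epsilon>) - lap R y) / s j
          - ((\<Sum>p\<in>UNIV. \<Sum>q\<in>UNIV. (a p q (y + \<epsilon>) - a p q y) / s j * partial p (partial q R) (y + \<epsilon>))
            + (\<Sum>l\<in>UNIV. (b l (y + \<epsilon>) - b l y) / s j * partial l R (y + \<epsilon>)))"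
        unfolding lap_eq[OF W y CD] lap_eq[OF open_U subset_refl shy(1) CR] lap_eq[OF open_U subset_refl shy(2) CR] D1[OF y] D2
        using s(2)[of j]
        by (simp add: sum_divide_distrib sum.distrib sum_subtractf diff_divide_distrib add_divide_distrib algebra_simps)
      have "lap (\<lambda>z. V z * D z) y - V y * ((lap R (y + \<epsilon>) - lap R y) / s j) = E j"
        unfolding lap_mult[OF W CV CD y] lD E_def d_def gip_def D1[OF y]
        by (simp add: y_def[symmetric] R_def[symmetric] \<epsilon>_def[symmetric] D_def algebra_simps)
      then show ?case by (simp add: D_def y_def R_def \<epsilon>_def e_def)
    qed
  qed
  ultimately show ?thesis by (rule Lim_transform_eventually)
qed

end

text \<open>The solution in one chart. Only times t > 0 occur: there the time derivative is
  two-sided and \<open>U \<times> {0<..}\<close> is open, as limits of difference quotients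
  require.\<close>

locale parabolic = coord_metric G U
  for G :: "real^'n::finite \<Rightarrow> real^'n^'n" and U +
  fixes F Ft :: "real \<Rightarrow> real^'n \<Rightarrow> real" and c :: real
  assumes F_C2: "\<And>t. t > 0 \<Longrightarrow> Ck_on 2 U (F t)"
    and F_time: "\<And>t y. t > 0 \<Longrightarrow> y \<in> U \<Longrightarrow> ((\<lambda>t. F t y) has_real_derivative Ft t y) (at t)"
    and F_cont: "continuous_on (U \<times> {0<..}) (\<lambda>(y, t). F t y)"
    and F_cont1: "\<And>i. continuous_on (U \<times> {0<..}) (\<lambda>(y, t). partial i (F t) y)"
    and F_cont2: "\<And>i j. continuous_on (U \<times> {0<..}) (\<lambda>(y, t). partial i (partial j (F t)) y)"
    and Ft_cont: "continuous_on (U \<times> {0<..}) (\<lambda>(y, t). Ft t y)"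
    and F_pos: "\<And>t y. t > 0 \<Longrightarrow> y \<in> U \<Longrightarrow> F t y > 0"
    and F_eq: "\<And>t y. t > 0 \<Longrightarrow> y \<in> U \<Longrightarrow> Ft t y = lap (F t) y + c * F t y * (1 - F t y)"
begin

lemma F_differentiable:
  assumes "t > 0" "y \<in> U"
  shows "F t differentiable at y" "partial i (F t) differentiable at y"
  using Ck2_differentiable[OF open_U subset_refl F_C2[OF assms(1)] assms(2)] by auto

lemma smooth_cont:
  assumes "smooth_on U h" shows "continuous_on (U \<times> {0<..}) (\<lambda>(y, t::real). h y :: real)"
  unfolding case_prod_beta
  by (rule continuous_on_compose2[OF smooth_on_continuous[OF assms], of _ fst]) (auto intro: continuous_intros)

lemma lapF_cont: "continuous_on (U \<times> {0<..}) (\<lambda>(y, t). lap (F t) y)"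
proof -
  have "continuous_on (U \<times> {0<..}) (\<lambda>P. (\<lambda>(y, t). Ft t y) P - c * (\<lambda>(y, t). F t y) P * (1 - (\<lambda>(y, t). F t y) P))"
    by (intro continuous_intros Ft_cont F_cont)
  then show ?thesis by (rule continuous_on_cong[THEN iffD1, rotated -1]) (auto simp: F_eq)
qed

text \<open>If \<open>F t0\<close> and \<open>fh\<close> have the same 2-jet in \<open>y0\<close>, an expression
  \<open>F\<^sub>t + V\<cdot>d(F - fh) + R\<close> with a minimum in \<open>(t0, y0)\<close> is treated as if the parabolic
  operator could be applied to it, although its derivatives need not exist.\<close>

lemma viscosity_inequality:
  fixes R Rt :: "real \<Rightarrow> real^'n \<Rightarrow> real" and V :: "'n \<Rightarrow> real^'n \<Rightarrow> real"
  assumes fh: "smooth_on U fh" and V: "\<And>k. smooth_on U (V k)"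
    and R_C2: "\<And>t. t > 0 \<Longrightarrow> Ck_on 2 U (R t)"
    and R_time: "\<And>t y. t > 0 \<Longrightarrow> y \<in> U \<Longrightarrow> ((\<lambda>t. R t y) has_real_derivative Rt t y) (at t)"
    and R_cont: "continuous_on (U \<times> {0<..}) (\<lambda>(y, t). R t y)"
    and Rt_cont: "continuous_on (U \<times> {0<..}) (\<lambda>(y, t). Rt t y)"
    and lapR_cont: "continuous_on (U \<times> {0<..}) (\<lambda>(y, t). lap (R t) y)"
    and 0: "y0 \<in> U" "t0 > 0"
    and jet: "\<And>i. partial i (F t0) y0 = partial i fh y0"
      "\<And>i j. partial i (partial j (F t0)) y0 = partial i (partial j fh) y0"
    and t1: "t1 < t0"
    and Z: "\<And>t y. y \<in> U \<Longrightarrow> t1 \<le> t \<Longrightarrow> 0 < t \<Longrightarrow> t \<le> t0 \<Longrightarrow>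
      Ft t y + (\<Sum>k\<in>UNIV. V k y * (partial k (F t) y - partial k fh y)) + R t y \<ge> 0"
    and Z0: "Ft t0 y0 + R t0 y0 = 0"
  shows "c * (1 - 2 * F t0 y0) * (Ft t0 y0 + (\<Sum>k\<in>UNIV. V k y0 * partial k (F t0) y0))
      + (\<Sum>k\<in>UNIV. V k y0 * partial k (lap fh) y0) + Rt t0 y0 - lap (R t0) y0 \<le> 0"
    (is "?I \<le> 0")
proof -
  obtain \<rho>0 where \<rho>0: "\<rho>0 > 0" "ball y0 \<rho>0 \<subseteq> U" using open_U 0(1) open_contains_ball by blast
  \<comment> \<open>A quarter of \<rho>0 leaves room in \<open>U\<close> for shifts of points of the
    ball; t0 / 2 keeps times positive, and t0 - t1 keeps them in the range where \<open>Z\<close> is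
    assumed.\<close>
  define \<rho> where "\<rho> = min (\<rho>0 / 4) (min (t0 / 2) (t0 - t1))"
  have \<rho>: "\<rho> > 0" "\<rho> \<le> t0 / 2" "\<rho> \<le> t0 - t1" "4 * \<rho> \<le> \<rho>0" using \<rho>0 0 t1 by (auto simp: \<rho>_def min_def)
  have ball4: "ball y0 (4 * \<rho>) \<subseteq> U" using \<rho>0(2) \<rho>(4) by force
  then have ball2: "ball y0 (2 * \<rho>) \<subseteq> U" using \<rho>(1) by force
  have cball: "cball y0 \<rho> \<subseteq> ball y0 (2 * \<rho>)" using \<rho>(1) by auto
  let ?W = "ball y0 \<rho>"
  have W: "open ?W" "?W \<subseteq> U" using ball2 \<rho>(1) by auto
  define K where "K = cball y0 \<rho> \<times> {t0 - \<rho>..t0}"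
  have K: "compact K" "(y0, t0) \<in> K" using \<rho>(1) by (auto simp: K_def intro: compact_Times)
  have KU: "y \<in> U" "t > 0" "t1 \<le> t" "t \<le> t0" if "(y, t) \<in> K" for y t
    using that \<rho> 0 cball ball2 by (auto simp: K_def)
  define s where "s j = \<rho> / 2 / real (Suc j)" for j :: nat
  have s_pos: "s j > 0" for j using \<rho>(1) by (simp add: s_def)
  have "s j \<le> \<rho> / 2" for j using \<rho>(1) by (simp add: s_def field_simps)
  then have s_less: "s j < \<rho>" for j using \<rho>(1) by (metis field_sum_of_halves le_less_trans less_add_same_cancel1 half_gt_zero)
  have s_lim: "s \<longlonglongrightarrow> 0"
  proof -
    have "(\<lambda>m. \<rho> / 2 * (1 / real (Suc m))) \<longlonglongrightarrow> \<rho> / 2 * 0"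
      by (intro tendsto_intros LIMSEQ_inverse_real_of_nat[unfolded inverse_eq_divide])
    moreover have "s = (\<lambda>m. \<rho> / 2 * (1 / real (Suc m)))" by (rule ext) (simp add: s_def)
    ultimately show ?thesis by simp
  qed
  define e where "e k = (axis k 1 :: real^'n)" for k
  have shK: "y + s j *\<^sub>R e k \<in> U" if "y \<in> cball y0 \<rho>" for y j k
    using shift_near(1)[of y0 "2 * \<rho>" "s j" y k] ball4 s_pos[of j] s_less[of j] that cball \<rho>(1) by (auto simp: e_def)
  \<comment> \<open>Subtracting \<open>fh\<close> kills the spatial derivatives of order one and two
    at (y0, t0) and leaves the time derivative unchanged.\<close>
  define r where "r t y = F t y - fh y" for t y
  have r_C2: "Ck_on 2 U (r t)" if "t > 0" for t
    unfolding r_def[abs_def] by (intro Ck_on_diff open_U F_C2 that Ck2_smooth[OF fh subset_refl])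
  have fhd: "fh differentiable at y" "partial i fh differentiable at y" if "y \<in> U" for y i
    using smooth_on_differentiable[OF fh open_U that] smooth_on_differentiable[OF smooth_on_partial[OF fh] open_U that] by auto
  have r1: "partial i (r t) y = partial i (F t) y - partial i fh y" if "t > 0" "y \<in> U" for t y i
    unfolding r_def[abs_def] by (intro partial_diff F_differentiable fhd that)
  have r2: "partial i (partial l (r t)) y = partial i (partial l (F t)) y - partial i (partial l fh) y" if "t > 0" "y \<in> U" for t y i l
  proof -
    have "partial i (partial l (r t)) y = partial i (\<lambda>y. partial l (F t) y - partial l fh y) y"
      by (rule partial_cong[OF open_U that(2)]) (rule r1[OF that(1)])
    also have "\<dots> = partial i (partial l (F t)) y - partial i (partial l fh) y"
      by (intro partial_diff F_differentiable fhd that)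
    finally show ?thesis .
  qed
  have lapr: "lap (r t) y = lap (F t) y - lap fh y" if "t > 0" "y \<in> U" for t y
  proof -
    have "lap (r t) y = lap (\<lambda>y. F t y + (-1) * fh y) y" by (simp add: r_def[abs_def])
    also have "\<dots> = lap (F t) y + lap (\<lambda>y. (-1) * fh y) y"
      by (rule lap_add[OF open_U subset_refl]) (intro F_C2 that Ck_on_mult open_U Ck_on_const Ck2_smooth[OF fh subset_refl])+
    also have "\<dots> = lap (F t) y - lap fh y"
      using lap_cmult[OF open_U subset_refl Ck2_smooth[OF fh subset_refl] that(2), of "-1"] by simp
    finally show ?thesis .
  qed
  have r_c1: "continuous_on (U \<times> {0<..}) (\<lambda>(y, t). partial i (r t) y)" for i
  proof -
    have "continuous_on (U \<times> {0<..}) (\<lambda>P. (\<lambda>(y, t). partial i (F t) y) P - (\<lambda>(y, t). partial i fh y) P)"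
      by (intro continuous_intros F_cont1 smooth_cont smooth_on_partial fh)
    then show ?thesis by (rule continuous_on_cong[THEN iffD1, rotated -1]) (auto simp: r1)
  qed
  have r_c2: "continuous_on (U \<times> {0<..}) (\<lambda>(y, t). partial i (partial l (r t)) y)" for i l
  proof -
    have "continuous_on (U \<times> {0<..}) (\<lambda>P. (\<lambda>(y, t). partial i (partial l (F t)) y) P - (\<lambda>(y, t). partial i (partial l fh) y) P)"
      by (intro continuous_intros F_cont2 smooth_cont smooth_on_partial fh)
    then show ?thesis by (rule continuous_on_cong[THEN iffD1, rotated -1]) (auto simp: r2)
  qed
  have r_c0: "continuous_on (U \<times> {0<..}) (\<lambda>(y, t). r t y)"
  proof -
    have "continuous_on (U \<times> {0<..}) (\<lambda>P. (\<lambda>(y, t). F t y) P - (\<lambda>(y, t). fh y) P)"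
      by (intro continuous_intros F_cont smooth_cont fh)
    then show ?thesis by (rule continuous_on_cong[THEN iffD1, rotated -1]) (auto simp: r_def)
  qed
  have r_time: "((\<lambda>t. r t y) has_real_derivative Ft t y) (at t)" if "t > 0" "y \<in> U" for t y
    unfolding r_def using F_time[OF that] by (auto intro!: derivative_eq_intros)
  have r_jet: "partial i (r t0) y0 = 0" "partial i (partial l (r t0)) y0 = 0" for i l
    using r1[OF 0(2,1)] r2[OF 0(2,1)] jet by auto
  have r_diff: "r t differentiable at y" "partial i (r t) differentiable at y" if "t > 0" "y \<in> U" for t y i
    using Ck2_differentiable[OF open_U subset_refl r_C2[OF that(1)] that(2)] by auto
  define N where "N x = c * x * (1 - x)" for x
  \<comment> \<open>Forward quotients make the expression $C^2$ in space. For t near t0 they use the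
    solution after time t0, where \<open>Z\<close> says nothing; only the limit \<open>Zf\<close> on
    \<open>K\<close> has to be nonnegative.\<close>
  define z where "z j P = (r (snd P + s j) (fst P) - r (snd P) (fst P)) / s j
      + (\<Sum>k\<in>UNIV. V k (fst P) * ((r (snd P) (fst P + s j *\<^sub>R e k) - r (snd P) (fst P)) / s j)) + R (snd P) (fst P)" for j P
  define Zf where "Zf P = Ft (snd P) (fst P) + (\<Sum>k\<in>UNIV. V k (fst P) * partial k (r (snd P)) (fst P)) + R (snd P) (fst P)" for P
  \<comment> \<open>The squared coordinate distance; with t0 - t it forms the penalty that makes the
    minimum at (y0, t0) strict.\<close>
  define \<psi> where "\<psi> y = (\<Sum>i\<in>UNIV. (y $ i - y0 $ i) * (y $ i - y0 $ i))" for y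
  have \<psi>_smooth: "smooth_on U \<psi>"
    unfolding \<psi>_def[abs_def] by (intro smooth_intros open_U finite)
  have \<psi>_pos: "\<psi> y > 0" if "y \<noteq> y0" for y
  proof -
    have "y - y0 \<noteq> 0" using that by simp
    then have "(y - y0) \<bullet> (y - y0) > 0" using inner_gt_zero_iff[of "y - y0"] by blast
    then show ?thesis by (simp add: \<psi>_def inner_vec_def)
  qed
  have \<psi>_nonneg: "\<psi> y \<ge> 0" for y unfolding \<psi>_def by (intro sum_nonneg) simp
  have \<psi>0: "\<psi> y0 = 0" by (simp add: \<psi>_def)
  have \<psi>_cont: "continuous_on UNIV \<psi>" unfolding \<psi>_def by (intro continuous_intros)
  have Ksub: "K \<subseteq> U \<times> {0<..}" using KU by auto
  have cK: "continuous_on K (\<lambda>P. h (snd P) (fst P))" if "continuous_on (U \<times> {0<..}) (\<lambda>(y, t). h t y)" for h :: "real \<Rightarrow> real^'n \<Rightarrow> real"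
    using continuous_on_subset[OF that Ksub] by (simp add: case_prod_beta)
  have z_cont: "continuous_on K (z j)" for j
  proof -
    have 1: "continuous_on K (\<lambda>P. r (snd P + s j) (fst P))"
    proof -
      have "continuous_on K (\<lambda>P. (\<lambda>(y, t). r t y) (fst P, snd P + s j))"
      proof (rule continuous_on_compose2[OF r_c0])
        show "continuous_on K (\<lambda>P. (fst P, snd P + s j))" by (intro continuous_intros)
        show "(\<lambda>P. (fst P, snd P + s j)) ` K \<subseteq> U \<times> {0<..}"
        proof safe
          fix y t assume "(y, t) \<in> K"
          then show "fst (y, t) \<in> U" "0 < snd (y, t) + s j"
            using KU[of y t] s_pos[of j] by auto
        qed
      qed
      then show ?thesis by simp
    qed
    have 2: "continuous_on K (\<lambda>P. r (snd P) (fst P + s j *\<^sub>R e k))" for k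
    proof -
      have "continuous_on K (\<lambda>P. (\<lambda>(y, t). r t y) (fst P + s j *\<^sub>R e k, snd P))"
      proof (rule continuous_on_compose2[OF r_c0])
        show "continuous_on K (\<lambda>P. (fst P + s j *\<^sub>R e k, snd P))" by (intro continuous_intros)
        show "(\<lambda>P. (fst P + s j *\<^sub>R e k, snd P)) ` K \<subseteq> U \<times> {0<..}"
        proof safe
          fix y t assume yt: "(y, t) \<in> K"
          then have "y \<in> cball y0 \<rho>" by (simp add: K_def)
          then show "fst (y, t) + s j *\<^sub>R e k \<in> U" "0 < snd (y, t)"
            using KU[OF yt] shK[of y j k] by auto
        qed
      qed
      then show ?thesis by simp
    qed
    show ?thesis unfolding z_def
      by (intro continuous_intros 1 2 cK r_c0 R_cont cK[of "\<lambda>_. V _"] smooth_cont V) (use s_pos[of j] in auto)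
  qed
  have lim: "(\<lambda>j. z (q j) (P j)) \<longlonglongrightarrow> Zf P'"
    if q: "strict_mono q" and PK: "\<And>j. P j \<in> K" "P' \<in> K" and P: "P \<longlonglongrightarrow> P'" for q P P'
  proof -
    have P'U: "fst P' \<in> U" "snd P' > 0" using KU[of "fst P'" "snd P'"] PK by auto
    note l1 = tendsto_fst[OF P] and l2 = tendsto_snd[OF P]
    have sq: "(\<lambda>j. s (q j)) \<longlonglongrightarrow> 0" using LIMSEQ_subseq_LIMSEQ[OF s_lim q] by (simp add: o_def)
    show ?thesis unfolding z_def Zf_def e_def
      by (intro tendsto_intros
          seq_dq_time[OF r_time Ft_cont l1 l2 P'U sq s_pos]
          seq_dq_space[OF r_diff(1) r_c1 l1 l2 P'U sq s_pos]
          seq_tendsto[OF R_cont l1 l2 P'U] seq_tendsto[of "\<lambda>_. V _", OF smooth_cont[OF V] l1 l2 P'U])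
  qed
  have Zf_nonneg: "Zf P \<ge> 0" if "P \<in> K" for P
    using Z[of "fst P" "snd P"] KU[of "fst P" "snd P"] that r1[of "snd P" "fst P"] by (simp add: Zf_def)
  have Zf0: "Zf (y0, t0) = 0" using Z0 by (simp add: Zf_def r_jet)
  \<comment> \<open>The right side is the price of the penalty \<eta> (\<psi> + (t0 - t)): its time
    derivative is -\<eta>, its Laplacian \<eta> times that of \<psi>.\<close>
  have main: "?I \<le> \<eta> * (1 + lap \<psi> y0)" if \<eta>: "\<eta> > 0" for \<eta>
  proof -
    define \<Psi> where "\<Psi> P = \<eta> * (\<psi> (fst P) + (t0 - snd P))" for P
    have \<Psi>: "continuous_on K \<Psi>" "\<And>P. P \<in> K \<Longrightarrow> P \<noteq> (y0, t0) \<Longrightarrow> \<Psi> P > 0" "\<Psi> (y0, t0) = 0"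
    proof -
      show "continuous_on K \<Psi>" unfolding \<Psi>_def
        by (intro continuous_intros continuous_on_compose2[OF \<psi>_cont]) auto
      show "\<Psi> P > 0" if "P \<in> K" "P \<noteq> (y0, t0)" for P
      proof -
        obtain y t where P: "P = (y, t)" by (cases P)
        have "t \<le> t0" using that(1) by (simp add: P K_def)
        then have "\<psi> y + (t0 - t) > 0"
          using that(2) \<psi>_pos[of y] \<psi>_nonneg[of y] by (cases "y = y0") (auto simp: P intro: add_pos_nonneg)
        then show ?thesis using \<eta> by (simp add: \<Psi>_def P)
      qed
    qed (simp add: \<Psi>_def \<psi>0)
    obtain q P where q: "strict_mono q" and P: "\<And>j. P j \<in> K" "P \<longlonglongrightarrow> (y0, t0)"
      and min: "\<And>j Q. Q \<in> K \<Longrightarrow> z (q j) (P j) + \<Psi> (P j) \<le> z (q j) Q + \<Psi> Q"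
      using approximate_minimum[where K = K and ?P0.0 = "(y0, t0)" and z = z and Z = Zf and \<Psi> = \<Psi>,
          OF K z_cont lim Zf_nonneg Zf0 \<Psi>] by blast
    define ys where "ys j = fst (P j)" for j
    define ts where "ts j = snd (P j)" for j
    define \<sigma> where "\<sigma> j = s (q j)" for j
    have \<sigma>: "\<sigma> \<longlonglongrightarrow> 0" "\<And>j. \<sigma> j > 0" "\<And>j. \<sigma> j < \<rho>"
      using LIMSEQ_subseq_LIMSEQ[OF s_lim q] s_pos s_less by (auto simp: \<sigma>_def[abs_def] o_def)
    have lims: "ys \<longlonglongrightarrow> y0" "ts \<longlonglongrightarrow> t0"
      using tendsto_fst[OF P(2)] tendsto_snd[OF P(2)] by (simp_all add: ys_def[abs_def] ts_def[abs_def])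
    define B where "B k j = lap (\<lambda>z. V k z * ((r (ts j) (z + \<sigma> j *\<^sub>R axis k 1) - r (ts j) z) / \<sigma> j)) (ys j)
        - V k (ys j) * ((lap (r (ts j)) (ys j + \<sigma> j *\<^sub>R axis k 1) - lap (r (ts j)) (ys j)) / \<sigma> j)" for k j
    have B_lim: "B k \<longlonglongrightarrow> 0" for k
      unfolding B_def[abs_def]
      by (rule lap_difference_quotient[OF r_C2 r_c1 r_c2 r_jet V lims 0 \<sigma>(1,2)])
    \<comment> \<open>\<open>X j\<close> is the time derivative minus the Laplacian of the penalised
      approximation at its minimum. The equation has been used to remove second derivatives under
      difference quotients: Ft - lap r equals \<open>NL\<close>, so quotients of \<open>N\<close>
      and \<open>NL\<close> and the commutators \<open>B\<close> remain, all of which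
      converge.\<close>
    define NL where "NL t y = N (F t y) + lap fh y" for t y
    define X where "X j = (N (F (ts j + \<sigma> j) (ys j)) - N (F (ts j) (ys j))) / \<sigma> j
        + (\<Sum>k\<in>UNIV. V k (ys j) * ((NL (ts j) (ys j + \<sigma> j *\<^sub>R axis k 1) - NL (ts j) (ys j)) / \<sigma> j))
        - (\<Sum>k\<in>UNIV. B k j) + Rt (ts j) (ys j) - lap (R (ts j)) (ys j) - \<eta> * (1 + lap \<psi> (ys j))" for j
    have "X \<longlonglongrightarrow> c * (1 - 2 * F t0 y0) * Ft t0 y0
        + (\<Sum>k\<in>UNIV. V k y0 * (c * (1 - 2 * F t0 y0) * partial k (F t0) y0 + partial k (lap fh) y0))
        - (\<Sum>k\<in>(UNIV::'n set). 0) + Rt t0 y0 - lap (R t0) y0 - \<eta> * (1 + lap \<psi> y0)"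
    proof -
      have dN: "(N has_real_derivative c * (1 - 2 * x)) (at x)" for x
        unfolding N_def by (auto intro!: derivative_eq_intros simp: algebra_simps)
      have N_time: "((\<lambda>t. N (F t y)) has_real_derivative c * (1 - 2 * F t y) * Ft t y) (at t)" if "t > 0" "y \<in> U" for t y
        using DERIV_chain2[OF dN F_time[OF that]] .
      have N_tc: "continuous_on (U \<times> {0<..}) (\<lambda>(y, t). c * (1 - 2 * F t y) * Ft t y)"
      proof -
        have "continuous_on (U \<times> {0<..}) (\<lambda>P. c * (1 - 2 * (\<lambda>(y, t). F t y) P) * (\<lambda>(y, t). Ft t y) P)"
          by (intro continuous_intros F_cont Ft_cont)
        then show ?thesis by (simp add: case_prod_beta)
      qed
      have lfd: "lap fh differentiable at y" if "y \<in> U" for y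
        by (rule smooth_on_differentiable[OF smooth_lap[OF fh] open_U that])
      have NLd: "NL t differentiable at y" "partial k (NL t) y = c * (1 - 2 * F t y) * partial k (F t) y + partial k (lap fh) y"
        if "t > 0" "y \<in> U" for t y k
        using partial_real_comp[OF F_differentiable(1)[OF that] dN] lfd[OF that(2)]
        unfolding NL_def[abs_def] by (auto simp: partial_add intro: differentiable_add)
      have NLc: "continuous_on (U \<times> {0<..}) (\<lambda>(y, t). partial k (NL t) y)" for k
      proof -
        have "continuous_on (U \<times> {0<..}) (\<lambda>P. c * (1 - 2 * (\<lambda>(y, t). F t y) P) * (\<lambda>(y, t). partial k (F t) y) P + (\<lambda>(y, t). partial k (lap fh) y) P)"
          by (intro continuous_intros F_cont F_cont1 smooth_cont smooth_on_partial smooth_lap fh)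
        then show ?thesis by (rule continuous_on_cong[THEN iffD1, rotated -1]) (auto simp: NLd)
      qed
      have t1: "(\<lambda>j. (N (F (ts j + \<sigma> j) (ys j)) - N (F (ts j) (ys j))) / \<sigma> j) \<longlonglongrightarrow> c * (1 - 2 * F t0 y0) * Ft t0 y0"
        by (rule seq_dq_time[of "\<lambda>t y. N (F t y)", OF N_time N_tc lims 0 \<sigma>(1,2)])
      have t2: "(\<lambda>j. (NL (ts j) (ys j + \<sigma> j *\<^sub>R axis k 1) - NL (ts j) (ys j)) / \<sigma> j) \<longlonglongrightarrow> c * (1 - 2 * F t0 y0) * partial k (F t0) y0 + partial k (lap fh) y0" for k
        using seq_dq_space[OF NLd(1) NLc lims 0 \<sigma>(1,2), of k] by (simp add: NLd 0)
      show ?thesis unfolding X_def[abs_def]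
        by (intro tendsto_intros t1 t2 B_lim seq_tendsto[OF Rt_cont lims 0] seq_tendsto[OF lapR_cont lims 0]
            seq_tendsto[of "\<lambda>_. V _", OF smooth_cont[OF V] lims 0]
            seq_tendsto[of "\<lambda>_. lap \<psi>", OF smooth_cont[OF smooth_lap[OF \<psi>_smooth]] lims 0])
    qed
    then have X_lim: "X \<longlonglongrightarrow> ?I - \<eta> * (1 + lap \<psi> y0)"
      by (simp add: algebra_simps sum.distrib sum_subtractf sum_distrib_left)
    have "eventually (\<lambda>j. X j \<le> 0) sequentially"
    proof -
      have "eventually (\<lambda>j. ys j \<in> ?W) sequentially"
        using tendstoD[OF lims(1) \<rho>(1)] by (simp add: dist_commute)
      moreover have "eventually (\<lambda>j. ts j > t0 - \<rho>) sequentially" by (rule order_tendstoD(1)[OF lims(2)]) (use \<rho> in simp)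
      ultimately show ?thesis
      proof eventually_elim
        case (elim j)
        define y t d where "y = ys j" and "t = ts j" and "d = \<sigma> j"
        have yt: "P j = (y, t)" by (simp add: y_def t_def ys_def ts_def)
        have yW: "y \<in> ?W" and t: "t0 - \<rho> < t" "t \<le> t0" "t > 0" and yU: "y \<in> U" and dpos: "d > 0" "d < \<rho>"
          using elim P(1)[of j] KU[of y t] \<sigma>(2,3)[of j] by (auto simp: y_def t_def d_def yt[unfolded y_def t_def] K_def)
        have shU: "x + d *\<^sub>R e k \<in> U" if "x \<in> ?W" for x k
          using shift_near(1)[OF ball2 dpos that] by (simp add: e_def)
        define zx where "zx x \<tau> = (r (\<tau> + d) x - r \<tau> x) / d
          + (\<Sum>k\<in>UNIV. V k x * ((r \<tau> (x + d *\<^sub>R e k) - r \<tau> x) / d)) + R \<tau> x + \<eta> * (\<psi> x + (t0 - \<tau>))" for x \<tau>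
        have zx_min: "zx y t \<le> zx x \<tau>" if "(x, \<tau>) \<in> K" for x \<tau>
          using min[OF that, of j] by (simp add: z_def \<Psi>_def yt zx_def d_def \<sigma>_def)
        define T D where "T x = (1 / d) * (F (t + d) x + (-1) * F t x)"
          and "D k x = (1 / d) * (r t (x + d *\<^sub>R e k) - r t x)" for x k
        define H where "H x = (T x + (\<Sum>k\<in>UNIV. V k x * D k x)) + (R t x + \<eta> * (\<psi> x + (t0 - t)))" for x
        have Hzx: "H x = zx x t" for x
          by (simp add: H_def zx_def T_def D_def r_def add.assoc)
        note sub = Ck_on_subset[OF _ W(2)]
        have CT: "Ck_on 2 ?W T" unfolding T_def[abs_def]
          by (intro Ck_on_mult Ck_on_add Ck_on_const W(1) sub[OF F_C2]) (use t dpos in auto)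
        have CD: "Ck_on 2 ?W (D k)" for k unfolding D_def[abs_def]
          by (intro Ck_on_mult Ck_on_diff Ck_on_const W(1) sub[OF r_C2] t Ck_on_translate[OF open_U W(1) shU r_C2])
        have CV: "Ck_on 2 ?W (V k)" for k by (rule Ck2_smooth[OF V W(2)])
        have CS: "Ck_on 2 ?W (\<lambda>x. \<Sum>k\<in>UNIV. V k x * D k x)"
          by (intro Ck_on_sum Ck_on_mult W(1) CV CD finite)
        have CR: "Ck_on 2 ?W (R t)" by (rule sub[OF R_C2[OF t(3)]])
        have C\<psi>: "Ck_on 2 ?W \<psi>" by (rule Ck2_smooth[OF \<psi>_smooth W(2)])
        have CP: "Ck_on 2 ?W (\<lambda>x. \<psi> x + (t0 - t))"
          by (intro Ck_on_add W(1) Ck_on_const C\<psi>)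
        have CH: "Ck_on 2 ?W H" unfolding H_def[abs_def]
          by (intro Ck_on_add W(1) CT CS CR Ck_on_mult Ck_on_const CP)
        have lapH: "lap H y = (lap T y + (\<Sum>k\<in>UNIV. lap (\<lambda>x. V k x * D k x) y)) + (lap (R t) y + \<eta> * lap \<psi> y)"
        proof -
          have "lap H y = lap (\<lambda>x. T x + (\<Sum>k\<in>UNIV. V k x * D k x)) y + lap (\<lambda>x. R t x + \<eta> * (\<psi> x + (t0 - t))) y"
            unfolding H_def[abs_def]
            by (rule lap_add[OF W _ _ yW]) (intro Ck_on_add W(1) CT CS CR Ck_on_mult Ck_on_const CP)+
          also have "lap (\<lambda>x. T x + (\<Sum>k\<in>UNIV. V k x * D k x)) y = lap T y + lap (\<lambda>x. \<Sum>k\<in>UNIV. V k x * D k x) y"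
            by (rule lap_add[OF W CT CS yW])
          also have "lap (\<lambda>x. \<Sum>k\<in>UNIV. V k x * D k x) y = (\<Sum>k\<in>UNIV. lap (\<lambda>x. V k x * D k x) y)"
            by (rule lap_sum[OF W finite _ yW]) (intro Ck_on_mult W(1) CV CD)
          also have "lap (\<lambda>x. R t x + \<eta> * (\<psi> x + (t0 - t))) y = lap (R t) y + lap (\<lambda>x. \<eta> * (\<psi> x + (t0 - t))) y"
            by (rule lap_add[OF W CR _ yW]) (intro Ck_on_mult W(1) Ck_on_const CP)
          also have "lap (\<lambda>x. \<eta> * (\<psi> x + (t0 - t))) y = \<eta> * lap (\<lambda>x. \<psi> x + (t0 - t)) y"
            by (rule lap_cmult[OF W CP yW])
          also have "lap (\<lambda>x. \<psi> x + (t0 - t)) y = lap \<psi> y"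
            by (subst lap_add[OF W C\<psi> Ck_on_const yW]) (simp add: lap_const[OF W])
          finally show ?thesis .
        qed
        have lapT: "lap T y = (1 / d) * (lap (F (t + d)) y - lap (F t) y)"
        proof -
          have c1: "Ck_on 2 ?W (F (t + d))" "Ck_on 2 ?W (F t)" using t dpos by (auto intro: sub[OF F_C2])
          have "lap T y = (1 / d) * lap (\<lambda>x. F (t + d) x + (-1) * F t x) y"
            unfolding T_def[abs_def] by (rule lap_cmult[OF W _ yW]) (intro Ck_on_add Ck_on_mult Ck_on_const c1 W(1))
          also have "lap (\<lambda>x. F (t + d) x + (-1) * F t x) y = lap (F (t + d)) y + lap (\<lambda>x. (-1) * F t x) y"
            by (rule lap_add[OF W c1(1) _ yW]) (intro Ck_on_mult Ck_on_const c1 W(1))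
          also have "lap (\<lambda>x. (-1) * F t x) y = - lap (F t) y"
            using lap_cmult[OF W c1(2) yW, of "-1"] by simp
          finally show ?thesis by simp
        qed
        have "lap H y \<ge> 0"
        proof (rule lap_nonneg_at_min[OF W CH yW])
          fix x assume "x \<in> ?W"
          then have "(x, t) \<in> K" using t by (auto simp: K_def)
          then show "H y \<le> H x" using zx_min by (simp add: Hzx)
        qed
        moreover
        define Dt where "Dt = (Ft (t + d) y - Ft t y) / d + (\<Sum>k\<in>UNIV. V k y * ((Ft t (y + d *\<^sub>R e k) - Ft t y) / d)) + Rt t y - \<eta>"
        \<comment> \<open>The minimum may lie at the final time t0, so only earlier times are
          available for comparison; a positive derivative would make the function smaller just
          before t.\<close>
        have "Dt \<le> 0"
        proof (rule ccontr)
          assume "\<not> Dt \<le> 0"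
          have rs: "((\<lambda>\<tau>. r (\<tau> + d) y) has_real_derivative Ft (t + d) y) (at t)"
            using DERIV_shift[of "\<lambda>\<tau>. r \<tau> y" "Ft (t + d) y" t d] r_time[of "t + d" y] t dpos yU by simp
          have e: "((\<lambda>\<tau>. \<eta> * (\<psi> y + (t0 - \<tau>))) has_real_derivative - \<eta>) (at t)"
            by (auto intro!: derivative_eq_intros)
          have "(zx y has_real_derivative ((Ft (t + d) y - Ft t y) / d
              + (\<Sum>k\<in>UNIV. V k y * ((Ft t (y + d *\<^sub>R e k) - Ft t y) / d)) + Rt t y + - \<eta>)) (at t)"
            unfolding zx_def[abs_def]
            by (intro DERIV_add DERIV_sum DERIV_cmult DERIV_cdivide DERIV_diff rs r_time R_time e t(3) yU shU yW)
          then have "(zx y has_real_derivative Dt) (at t)" by (simp add: Dt_def)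
          from DERIV_pos_inc_left[OF this] \<open>\<not> Dt \<le> 0\<close> obtain \<delta> where \<delta>: "\<delta> > 0" "\<And>h. h > 0 \<Longrightarrow> h < \<delta> \<Longrightarrow> zx y (t - h) < zx y t"
            by auto
          define h where "h = min (\<delta> / 2) (t - (t0 - \<rho>))"
          have h: "h > 0" "h < \<delta>" "h \<le> t - (t0 - \<rho>)" using \<delta> t by (auto simp: h_def)
          then have "(y, t - h) \<in> K" using yW t by (auto simp: K_def)
          then show False using zx_min[of y "t - h"] \<delta>(2)[OF h(1,2)] by simp
        qed
        ultimately have "Dt - lap H y \<le> 0" by simp
        moreover have "Dt - lap H y = X j"
        proof -
          have VD: "lap (\<lambda>x. V k x * D k x) y = B k j + V k y * ((lap (r t) (y + d *\<^sub>R e k) - lap (r t) y) / d)" for k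
            by (simp add: B_def D_def y_def t_def d_def e_def)
          have F1: "Ft (t + d) y = lap (F (t + d)) y + N (F (t + d) y)" "Ft t y = lap (F t) y + N (F t y)"
            using F_eq[of "t + d" y] F_eq[of t y] t dpos yU by (auto simp: N_def)
          have F2: "Ft t (y + d *\<^sub>R e k) - Ft t y - (lap (r t) (y + d *\<^sub>R e k) - lap (r t) y) = NL t (y + d *\<^sub>R e k) - NL t y" for k
            using F_eq[OF t(3) shU[OF yW]] F_eq[OF t(3) yU] lapr[OF t(3) shU[OF yW]] lapr[OF t(3) yU]
            by (simp add: NL_def N_def)
          have F3: "V k y * ((Ft t (y + d *\<^sub>R e k) - Ft t y) / d) = V k y * ((lap (r t) (y + d *\<^sub>R e k) - lap (r t) y) / d)
              + V k y * ((NL t (y + d *\<^sub>R e k) - NL t y) / d)" for k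
            unfolding F2[symmetric] using dpos by (simp add: field_simps)
          show ?thesis
            unfolding Dt_def lapH lapT VD F3 X_def y_def[symmetric] t_def[symmetric] d_def[symmetric] e_def[symmetric]
            unfolding F1 sum.distrib using dpos by (simp add: field_simps)
        qed
        ultimately show ?case by simp
      qed
    qed
    then have "?I - \<eta> * (1 + lap \<psi> y0) \<le> 0"
      by (intro tendsto_upperbound[OF X_lim]) auto
    then show ?thesis by simp
  qed
  show ?thesis
  proof (rule ccontr)
    assume "\<not> ?I \<le> 0"
    then have I: "?I > 0" by simp
    \<comment> \<open>With \<eta> = ?I / C the bound \<open>main\<close> falls strictly below
      \<open>?I\<close> itself.\<close>
    define C where "C = \<bar>1 + lap \<psi> y0\<bar> + 1"
    have C: "C > 0" "1 + lap \<psi> y0 < C" by (auto simp: C_def)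
    have "?I \<le> (?I / C) * (1 + lap \<psi> y0)" by (rule main) (use I C in simp)
    also have "\<dots> < (?I / C) * C" by (rule mult_strict_left_mono[OF C(2)]) (use I C in simp)
    finally show False using C by simp
  qed
qed

end

subsection \<open>The differential inequality at a minimum\<close>

text \<open>The polynomial copies a 2-jet of the solution and can be differentiated further, which
  the solution cannot.\<close>

lemma quadratic_jet:
  fixes y0 :: "real^'n::finite" and l0 :: real and l :: "'n \<Rightarrow> real" and m :: "'n \<Rightarrow> 'n \<Rightarrow> real"
  assumes m: "\<And>i j. m i j = m j i"
  defines "u \<equiv> \<lambda>y. l0 + (\<Sum>i\<in>UNIV. l i * (y $ i - y0 $ i)) + (\<Sum>i\<in>UNIV. \<Sum>j\<in>UNIV. m i j * ((y $ i - y0 $ i) * (y $ j - y0 $ j)))"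
  shows "open S \<Longrightarrow> smooth_on S u" "u y0 = l0" "partial k u y0 = l k" "partial i (partial k u) y0 = 2 * m i k"
proof -
  show "smooth_on S u" if "open S" for S
    unfolding u_def by (intro smooth_intros that finite)
  have d: "(\<lambda>y. y $ i - y0 $ i) differentiable at y" for i and y :: "real^'n"
    by (intro smooth_on_differentiable[of UNIV] smooth_intros) auto
  have p: "partial k (\<lambda>y. y $ i - y0 $ i) y = (if k = i then 1 else 0)" for k i and y :: "real^'n"
  proof -
    have "(\<lambda>y::real^'n. y $ i) differentiable at y"
      by (intro smooth_on_differentiable[of UNIV] smooth_intros) auto
    then show ?thesis by (simp add: partial_diff partial_nth)
  qed
  note ds = d differentiable_mult differentiable_sum differentiable_add
  have 1: "partial k u = (\<lambda>y. l k + 2 * (\<Sum>j\<in>UNIV. m k j * (y $ j - y0 $ j)))" for k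
  proof
    fix y
    have "partial k u y = (\<Sum>i\<in>UNIV. l i * (if k = i then 1 else 0))
      + (\<Sum>i\<in>UNIV. \<Sum>j\<in>UNIV. m i j * ((if k = i then 1 else 0) * (y $ j - y0 $ j) + (y $ i - y0 $ i) * (if k = j then 1 else 0)))"
      unfolding u_def by (simp add: partial_add partial_cmult partial_sum partial_mult ds p)
    also have "(\<Sum>i\<in>UNIV. l i * (if k = i then 1 else 0)) = l k"
      by (rule sum_delta_mult)
    also have "(\<Sum>i\<in>UNIV. \<Sum>j\<in>UNIV. m i j * ((if k = i then 1 else 0) * (y $ j - y0 $ j) + (y $ i - y0 $ i) * (if k = j then 1 else 0)))
      = (\<Sum>i\<in>UNIV. (\<Sum>j\<in>UNIV. m i j * (y $ j - y0 $ j)) * (if k = i then 1 else 0))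
        + (\<Sum>i\<in>UNIV. \<Sum>j\<in>UNIV. (m i j * (y $ i - y0 $ i)) * (if k = j then 1 else 0))"
      by (simp add: sum.distrib sum_distrib_left distrib_left mult_ac)
    also have "\<dots> = 2 * (\<Sum>j\<in>UNIV. m k j * (y $ j - y0 $ j))"
      unfolding sum_delta_mult by (simp add: m[of _ k])
    finally show "partial k u y = l k + 2 * (\<Sum>j\<in>UNIV. m k j * (y $ j - y0 $ j))" by simp
  qed
  show "u y0 = l0" by (simp add: u_def)
  show "partial k u y0 = l k" unfolding 1 by simp
  have "partial i (partial k u) y0 = 2 * (\<Sum>j\<in>UNIV. m k j * (if i = j then 1 else 0))"
    unfolding 1 by (simp add: partial_add partial_cmult partial_sum ds p)
  also have "\<dots> = 2 * m k i" by (subst sum_delta_mult) (rule refl)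
  finally show "partial i (partial k u) y0 = 2 * m i k" by (simp add: m)
qed

context parabolic
begin

lemma gip_cont:
  fixes h k :: "real \<Rightarrow> real^'n \<Rightarrow> real"
  assumes "\<And>i. continuous_on (U \<times> {0<..}) (\<lambda>(y, t). partial i (h t) y)" "\<And>i. continuous_on (U \<times> {0<..}) (\<lambda>(y, t). partial i (k t) y)"
  shows "continuous_on (U \<times> {0<..}) (\<lambda>(y, t). gip (h t) (k t) y)"
proof -
  have "continuous_on (U \<times> {0<..}) (\<lambda>P. \<Sum>i\<in>UNIV. \<Sum>j\<in>UNIV. (\<lambda>(y, t). a i j y) P
      * (\<lambda>(y, t). partial i (h t) y) P * (\<lambda>(y, t). partial j (k t) y) P)"
    by (intro continuous_intros assms smooth_cont smooth_a)
  then show ?thesis by (simp add: gip_def case_prod_beta)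
qed

text \<open>With \<open>u\<close> the second order Taylor polynomial of \<open>ln (F t0)\<close> in \<open>y0\<close> and \<open>V\<close> its gradient,
  $|\nabla F|^2 / F \ge 2 \langle V, \nabla F \rangle - |V|^2 F$ with equality in \<open>y0\<close>. This makes the Harnack
  quantity linear in the derivatives of \<open>F\<close> while keeping its minimum.\<close>

lemma minimum_inequality:
  assumes Ric: "\<And>v. (\<Sum>j\<in>UNIV. \<Sum>k\<in>UNIV. ricci G j k y0 * v $ j * v $ k) \<ge> 0"
    and 0: "y0 \<in> U" "t0 > 0" and t1: "t1 < t0" and \<alpha>: "\<alpha> \<le> 1"
    and ge: "\<And>t y. y \<in> U \<Longrightarrow> t1 \<le> t \<Longrightarrow> 0 < t \<Longrightarrow> t \<le> t0 \<Longrightarrow>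
      Ft t y - (1 - \<alpha>) * gip (F t) (F t) y / F t y + (\<beta> + c) * (F t y * F t y) + (p + q * (t - t0) - c) * F t y \<ge> 0"
    and eq0: "Ft t0 y0 - (1 - \<alpha>) * gip (F t0) (F t0) y0 / F t0 y0 + (\<beta> + c) * (F t0 y0 * F t0 y0) + (p - c) * F t0 y0 = 0"
  defines "E \<equiv> F t0 y0"
  defines "X \<equiv> gip (F t0) (F t0) y0 / E\<^sup>2"
  defines "\<Lambda> \<equiv> lap (F t0) y0 / E - X"
  shows "2 * (1 - \<alpha>) * (\<Lambda>\<^sup>2 / CARD('n)) + c * E * (p + (1 - \<alpha>) * X + \<beta>) - 2 * (\<beta> + c) * E * X + q \<le> 0"
proof -
  have E: "E > 0" using F_pos[OF 0(2,1)] by (simp add: E_def)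
  define l where "l i = partial i (F t0) y0 / E" for i
  \<comment> \<open>Half of the second derivatives of ln (F t0) at \<open>y0\<close>.\<close>
  define m where "m i j = (partial i (partial j (F t0)) y0 / E - l i * l j) / 2" for i j
  have m2: "2 * m i j = partial i (partial j (F t0)) y0 / E - l i * l j" for i j by (simp add: m_def)
  have m_sym: "m i j = m j i" for i j
    using partial_commute[OF open_U F_C2[OF 0(2)] 0(1), of i j] by (simp add: m_def)
  define u where "u = (\<lambda>y. ln E + (\<Sum>i\<in>UNIV. l i * (y $ i - y0 $ i)) + (\<Sum>i\<in>UNIV. \<Sum>j\<in>UNIV. m i j * ((y $ i - y0 $ i) * (y $ j - y0 $ j))))"
  note qj = quadratic_jet[where m = m and l = l and ?l0.0 = "ln E" and ?y0.0 = y0, OF m_sym, folded u_def]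
  have u_smooth: "smooth_on U u" by (rule qj(1)[OF open_U])
  have u0: "u y0 = ln E" by (simp add: u_def)
  have u0': "partial i u y0 = l i" "partial i (partial j u) y0 = 2 * m i j" for i j
    by (rule qj(3) qj(4))+
  \<comment> \<open>The exponential of \<open>u\<close> is taken instead of the Taylor polynomial of
    \<open>F t0\<close> because then grad fh = fh grad u holds in all of \<open>U\<close>;
    \<open>viscosity_inequality\<close> differentiates \<open>lap fh\<close> once more, so an
    identity in \<open>y0\<close> alone would not suffice.\<close>
  define fh where "fh y = exp (u y)" for y
  have fh_smooth: "smooth_on U fh" unfolding fh_def[abs_def] by (intro smooth_intros open_U u_smooth)
  have u_diff: "u differentiable at y" "partial i u differentiable at y" if "y \<in> U" for y i
    using smooth_on_differentiable[OF u_smooth open_U that] smooth_on_differentiable[OF smooth_on_partial[OF u_smooth] open_U that] by auto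
  have fh_diff: "fh differentiable at y" if "y \<in> U" for y
    using smooth_on_differentiable[OF fh_smooth open_U that] .
  have fh0: "fh y0 = E" using E by (simp add: fh_def u0)
  have fh1: "partial i fh y = fh y * partial i u y" if "y \<in> U" for y i
    unfolding fh_def[abs_def] using partial_real_comp(2)[OF u_diff(1)[OF that] DERIV_exp] .
  have fh2: "partial i (partial j fh) y0 = E * (2 * m i j + l i * l j)" for i j
  proof -
    have "partial i (partial j fh) y0 = partial i (\<lambda>y. fh y * partial j u y) y0"
      by (rule partial_cong[OF open_U 0(1) fh1])
    then show ?thesis
      by (simp add: partial_mult fh_diff u_diff 0 fh1 fh0 u0 u0' algebra_simps)
  qed
  have jet: "partial i (F t0) y0 = partial i fh y0" "partial i (partial j (F t0)) y0 = partial i (partial j fh) y0" for i j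
    using E by (simp_all add: fh1 0 fh0 u0' l_def fh2 m2[unfolded l_def])
  define Xh where "Xh = gip u u"
  have Xh_smooth: "smooth_on U Xh" unfolding Xh_def by (rule smooth_gip[OF u_smooth u_smooth])
  define \<sigma> where "\<sigma> = 2 * (1 - \<alpha>)"
  define V where "V k y = (-\<sigma>) * coord_grad G u y $ k" for k y
  have V_smooth: "smooth_on U (V k)" for k
    unfolding V_def[abs_def] by (intro smooth_intros open_U smooth_grad u_smooth)
  \<comment> \<open>\<open>A\<close> equals V applied to d fh and so restores the term that
    \<open>viscosity_inequality\<close> subtracts.\<close>
  define A where "A y = (-\<sigma>) * (fh y * Xh y)" for y
  have A_smooth: "smooth_on U A"
    unfolding A_def[abs_def] by (intro smooth_intros open_U fh_smooth Xh_smooth)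
  \<comment> \<open>The factor of F: the term |V|^2 of the linearisation, scaled by 1 - \<alpha>,
    and the constant part of the Harnack quantity.\<close>
  define B where "B y = (1 - \<alpha>) * Xh y + (p - c)" for y
  have B_smooth: "smooth_on U B"
    unfolding B_def[abs_def] by (intro smooth_intros open_U Xh_smooth)
  note C2 = Ck2_smooth[OF _ subset_refl]
  define R where "R t y = A y + ((B y * F t y + (q * (t - t0)) * F t y) + (\<beta> + c) * (F t y * F t y))" for t y
  define Rt where "Rt t y = B y * Ft t y + q * F t y + q * (t - t0) * Ft t y + (\<beta> + c) * (2 * F t y * Ft t y)" for t y
  have V_gip: "(\<Sum>k\<in>UNIV. V k y * partial k h y) = - \<sigma> * gip h u y" for h y
    unfolding gip_grad V_def by (simp add: sum_distrib_left sum_negf mult_ac)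
  have FB: "Ck_on 2 U (\<lambda>y. B y * F t y)" "Ck_on 2 U (\<lambda>y. (q * (t - t0)) * F t y)" "Ck_on 2 U (\<lambda>y. F t y * F t y)"
      "Ck_on 2 U (\<lambda>y. (\<beta> + c) * (F t y * F t y))"
    if "t > 0" for t
    by (intro Ck_on_mult Ck_on_const open_U F_C2 that C2 B_smooth)+
  have R_C2: "Ck_on 2 U (R t)" if "t > 0" for t
    unfolding R_def[abs_def] by (intro Ck_on_add open_U FB that C2 A_smooth)
  have lapR: "lap (R t) y = lap A y + ((B y * lap (F t) y + F t y * lap B y + 2 * gip B (F t) y + q * (t - t0) * lap (F t) y)
      + (\<beta> + c) * (2 * F t y * lap (F t) y + 2 * gip (F t) (F t) y))" if t: "t > 0" and y: "y \<in> U" for t y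
  proof -
    note W = open_U subset_refl
    have "lap (R t) y = lap A y + lap (\<lambda>y. (B y * F t y + (q * (t - t0)) * F t y) + (\<beta> + c) * (F t y * F t y)) y"
      unfolding R_def[abs_def] by (rule lap_add[OF W _ _ y]) (intro Ck_on_add open_U FB t C2 A_smooth)+
    also have "lap (\<lambda>y. (B y * F t y + (q * (t - t0)) * F t y) + (\<beta> + c) * (F t y * F t y)) y
      = lap (\<lambda>y. B y * F t y + (q * (t - t0)) * F t y) y + lap (\<lambda>y. (\<beta> + c) * (F t y * F t y)) y"
      by (rule lap_add[OF W _ _ y]) (intro Ck_on_add open_U FB t)+
    also have "lap (\<lambda>y. B y * F t y + (q * (t - t0)) * F t y) y = lap (\<lambda>y. B y * F t y) y + lap (\<lambda>y. (q * (t - t0)) * F t y) y"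
      by (rule lap_add[OF W _ _ y]) (intro FB t)+
    also have "lap (\<lambda>y. (\<beta> + c) * (F t y * F t y)) y = (\<beta> + c) * lap (\<lambda>y. F t y * F t y) y"
      by (rule lap_cmult[OF W FB(3)[OF t] y])
    also have "lap (\<lambda>y. (q * (t - t0)) * F t y) y = (q * (t - t0)) * lap (F t) y"
      by (rule lap_cmult[OF W F_C2[OF t] y])
    also have "lap (\<lambda>y. B y * F t y) y = B y * lap (F t) y + F t y * lap B y + 2 * gip B (F t) y"
      by (rule lap_mult[OF W C2[OF B_smooth] F_C2[OF t] y])
    also have "lap (\<lambda>y. F t y * F t y) y = F t y * lap (F t) y + F t y * lap (F t) y + 2 * gip (F t) (F t) y"
      by (rule lap_mult[OF W F_C2[OF t] F_C2[OF t] y])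
    finally show ?thesis by (simp add: algebra_simps)
  qed
  have tcont: "continuous_on (U \<times> {0<..}) (\<lambda>P. (\<lambda>(y, t). q * (t - t0)) P)"
    by (simp add: case_prod_beta) (intro continuous_intros)
  have R_cont: "continuous_on (U \<times> {0<..}) (\<lambda>(y, t). R t y)"
  proof -
    have "continuous_on (U \<times> {0<..}) (\<lambda>P. (\<lambda>(y, t). A y) P + (((\<lambda>(y, t). B y) P * (\<lambda>(y, t). F t y) P + (\<lambda>(y, t). q * (t - t0)) P * (\<lambda>(y, t). F t y) P)
        + (\<beta> + c) * ((\<lambda>(y, t). F t y) P * (\<lambda>(y, t). F t y) P)))"
      by (intro continuous_on_add continuous_on_mult continuous_on_const tcont F_cont smooth_cont A_smooth B_smooth)
    then show ?thesis by (simp add: R_def case_prod_beta)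
  qed
  have Rt_cont: "continuous_on (U \<times> {0<..}) (\<lambda>(y, t). Rt t y)"
  proof -
    have "continuous_on (U \<times> {0<..}) (\<lambda>P. (\<lambda>(y, t). B y) P * (\<lambda>(y, t). Ft t y) P + q * (\<lambda>(y, t). F t y) P + (\<lambda>(y, t). q * (t - t0)) P * (\<lambda>(y, t). Ft t y) P
        + (\<beta> + c) * (2 * (\<lambda>(y, t). F t y) P * (\<lambda>(y, t). Ft t y) P))"
      by (intro continuous_on_add continuous_on_mult continuous_on_const tcont F_cont Ft_cont smooth_cont B_smooth)
    then show ?thesis by (simp add: Rt_def case_prod_beta)
  qed
  have lapR_cont: "continuous_on (U \<times> {0<..}) (\<lambda>(y, t). lap (R t) y)"
  proof -
    have gB: "continuous_on (U \<times> {0<..}) (\<lambda>(y, t). gip B (F t) y)"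
      using gip_cont[of "\<lambda>_. B" F] smooth_cont[OF smooth_on_partial[OF B_smooth]] F_cont1 by simp
    have "continuous_on (U \<times> {0<..}) (\<lambda>P. (\<lambda>(y, t). lap A y) P + (((\<lambda>(y, t). B y) P * (\<lambda>(y, t). lap (F t) y) P
        + (\<lambda>(y, t). F t y) P * (\<lambda>(y, t). lap B y) P + 2 * (\<lambda>(y, t). gip B (F t) y) P + (\<lambda>(y, t). q * (t - t0)) P * (\<lambda>(y, t). lap (F t) y) P)
        + (\<beta> + c) * (2 * (\<lambda>(y, t). F t y) P * (\<lambda>(y, t). lap (F t) y) P + 2 * (\<lambda>(y, t). gip (F t) (F t) y) P)))"
      by (intro continuous_on_add continuous_on_mult continuous_on_const tcont F_cont lapF_cont smooth_cont B_smooth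
          smooth_lap A_smooth gB gip_cont F_cont1)
    then show ?thesis by (rule continuous_on_cong[THEN iffD1, rotated -1]) (auto simp: lapR)
  qed
  have R_time: "((\<lambda>t. R t y) has_real_derivative Rt t y) (at t)" if "t > 0" "y \<in> U" for t y
  proof -
    note d = F_time[OF that]
    have "((\<lambda>t. R t y) has_real_derivative (0 + ((B y * Ft t y + ((q * (1 - 0)) * F t y + Ft t y * (q * (t - t0))))
        + (\<beta> + c) * (Ft t y * F t y + Ft t y * F t y)))) (at t)"
      unfolding R_def by (intro DERIV_add DERIV_const DERIV_cmult DERIV_mult DERIV_diff DERIV_ident d)
    then show ?thesis by (simp add: Rt_def algebra_simps)
  qed
  have gip_fh: "gip fh u y = fh y * Xh y" if "y \<in> U" for y
    by (simp add: gip_def Xh_def fh1[OF that] sum_distrib_left mult_ac)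
  have F_gip: "gip (F t0) h y0 = E * gip u h y0" for h
    by (simp add: gip_def jet fh1 0 fh0 sum_distrib_left mult_ac)
  have gFF: "gip (F t0) (F t0) y0 = E\<^sup>2 * Xh y0"
    using F_gip[of u] F_gip[of "F t0"] gip_commute[OF 0(1), of u "F t0"] by (simp add: Xh_def power2_eq_square)
  then have XXh: "X = Xh y0" using E by (simp add: X_def)
  have Z_eq: "Ft t y + (\<Sum>k\<in>UNIV. V k y * (partial k (F t) y - partial k fh y)) + R t y
      = Ft t y - \<sigma> * gip (F t) u y + (B y + q * (t - t0)) * F t y + (\<beta> + c) * (F t y * F t y)" if "y \<in> U" for t y
    unfolding right_diff_distrib sum_subtractf V_gip gip_fh[OF that] R_def A_def by (simp add: algebra_simps)
  have "c * (1 - 2 * F t0 y0) * (Ft t0 y0 + (\<Sum>k\<in>UNIV. V k y0 * partial k (F t0) y0))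
      + (\<Sum>k\<in>UNIV. V k y0 * partial k (lap fh) y0) + Rt t0 y0 - lap (R t0) y0 \<le> 0"
  proof (rule viscosity_inequality[where V = V and R = R and fh = fh and Rt = Rt, OF fh_smooth V_smooth R_C2 R_time R_cont Rt_cont lapR_cont 0 jet t1])
    show "Ft t0 y0 + R t0 y0 = 0"
    proof -
      have "(1 - \<alpha>) * gip (F t0) (F t0) y0 / F t0 y0 = (1 - \<alpha>) * E * Xh y0"
        unfolding gFF using E by (simp add: E_def[symmetric] power2_eq_square)
      then show ?thesis
        using eq0 by (simp add: R_def A_def B_def fh0 \<sigma>_def E_def[symmetric] algebra_simps)
    qed
    fix t y assume y: "y \<in> U" and t: "t1 \<le> t" "0 < t" "t \<le> t0"
    have Fp: "F t y > 0" by (rule F_pos[OF t(2) y])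
    \<comment> \<open>The square of dF - F du, divided by F, is the linearised bound for the
      gradient term.\<close>
    have "0 \<le> (\<Sum>i\<in>UNIV. \<Sum>j\<in>UNIV. a i j y * (partial i (F t) y - F t y * partial i u y) * (partial j (F t) y - F t y * partial j u y))"
      by (rule a_psd[OF y])
    also have "\<dots> = gip (F t) (F t) y - F t y * gip (F t) u y - F t y * gip u (F t) y + F t y * F t y * Xh y"
      by (simp add: gip_def Xh_def algebra_simps sum.distrib sum_subtractf sum_distrib_left)
    finally have "2 * gip (F t) u y * F t y \<le> gip (F t) (F t) y + F t y * F t y * Xh y"
      using gip_commute[OF y, of u "F t"] by (simp add: mult_ac)
    then have "2 * gip (F t) u y \<le> gip (F t) (F t) y / F t y + F t y * Xh y"
      using Fp by (simp add: field_simps)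
    then have "(1 - \<alpha>) * (2 * gip (F t) u y) \<le> (1 - \<alpha>) * (gip (F t) (F t) y / F t y + F t y * Xh y)"
      using \<alpha> by (intro mult_left_mono) auto
    then show "Ft t y + (\<Sum>k\<in>UNIV. V k y * (partial k (F t) y - partial k fh y)) + R t y \<ge> 0"
      unfolding Z_eq[OF y] using ge[OF y t] by (simp add: \<sigma>_def B_def algebra_simps)
  qed
  note vis = this
  note W = open_U subset_refl
  have lfh: "lap fh y = fh y * (lap u y + Xh y)" if "y \<in> U" for y
    unfolding fh_def[abs_def] Xh_def by (rule lap_exp[OF W C2[OF u_smooth] that])
  have lF: "lap (F t0) y0 = lap fh y0"
    unfolding lap_eq[OF W 0(1) F_C2[OF 0(2)]] lap_eq[OF W 0(1) C2[OF fh_smooth]] jet ..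
  have \<Lambda>: "lap u y0 = \<Lambda>"
    using lF lfh[OF 0(1)] E by (simp add: \<Lambda>_def fh0 XXh)
  define v1 where "v1 = gip u (lap u) y0"
  define y1 where "y1 = gip Xh u y0"
  define LX where "LX = lap Xh y0"
  have boch: "LX \<ge> 2 * (\<Lambda>\<^sup>2 / CARD('n)) + 2 * v1"
    using bochner_ineq[OF u_smooth 0(1) Ric] by (simp add: LX_def Xh_def \<Lambda> v1_def)
  have Vlap: "(\<Sum>k\<in>UNIV. V k y0 * partial k (lap fh) y0) = - \<sigma> * (E * X * (\<Lambda> + X) + E * (v1 + y1))"
  proof -
    have "partial k (lap fh) y0 = partial k (\<lambda>y. fh y * (lap u y + Xh y)) y0" for k
      by (rule partial_cong[OF open_U 0(1) lfh])
    moreover have "lap u differentiable at y0" "Xh differentiable at y0"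
      by (auto intro: smooth_on_differentiable[OF _ open_U 0(1)] smooth_lap u_smooth Xh_smooth)
    ultimately have "partial k (lap fh) y0 = E * partial k u y0 * (\<Lambda> + X) + E * (partial k (lap u) y0 + partial k Xh y0)" for k
      by (simp add: partial_mult partial_add differentiable_add fh_diff 0 fh1 fh0 \<Lambda> XXh)
    then have "gip (lap fh) u y0 = E * (\<Lambda> + X) * gip u u y0 + E * (gip (lap u) u y0 + gip Xh u y0)"
      by (simp add: gip_def algebra_simps sum.distrib sum_distrib_left)
    then show ?thesis
      unfolding V_gip v1_def y1_def gip_commute[OF 0(1), of u "lap u"] XXh Xh_def by (simp add: algebra_simps)
  qed
  have VF: "(\<Sum>k\<in>UNIV. V k y0 * partial k (F t0) y0) = - \<sigma> * (E * X)"
    unfolding V_gip F_gip XXh Xh_def ..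
  have lapA: "lap A y0 = - \<sigma> * (E * LX + X * (E * (\<Lambda> + X)) + 2 * (E * y1))"
  proof -
    have "lap A y0 = - \<sigma> * lap (\<lambda>y. fh y * Xh y) y0"
      unfolding A_def[abs_def] by (rule lap_cmult[OF W _ 0(1)]) (intro Ck_on_mult open_U C2 fh_smooth Xh_smooth)
    also have "lap (\<lambda>y. fh y * Xh y) y0 = fh y0 * lap Xh y0 + Xh y0 * lap fh y0 + 2 * gip fh Xh y0"
      by (rule lap_mult[OF W C2[OF fh_smooth] C2[OF Xh_smooth] 0(1)])
    also have "gip fh Xh y0 = E * y1"
      using F_gip[of Xh] gip_commute[OF 0(1), of u Xh] by (simp add: gip_def jet y1_def)
    finally show ?thesis by (simp add: lfh 0 fh0 \<Lambda> XXh LX_def)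
  qed
  have lapB: "lap B y0 = (1 - \<alpha>) * LX"
  proof -
    have "lap B y0 = lap (\<lambda>y. (1 - \<alpha>) * Xh y) y0 + lap (\<lambda>_. p - c) y0"
      unfolding B_def[abs_def] by (rule lap_add[OF W _ _ 0(1)]) (intro Ck_on_mult Ck_on_const open_U C2 Xh_smooth)+
    then show ?thesis by (simp add: lap_const[OF W] lap_cmult[OF W C2[OF Xh_smooth] 0(1)] LX_def)
  qed
  have gBF: "gip B (F t0) y0 = (1 - \<alpha>) * (E * y1)"
  proof -
    have "partial k B y0 = (1 - \<alpha>) * partial k Xh y0" for k
      unfolding B_def[abs_def]
      by (simp add: partial_add partial_cmult smooth_on_differentiable[OF Xh_smooth open_U 0(1)] differentiable_mult)
    then have "gip B (F t0) y0 = (1 - \<alpha>) * gip Xh (F t0) y0"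
      by (simp add: gip_def sum_distrib_left mult_ac)
    then show ?thesis
      using F_gip[of Xh] gip_commute[OF 0(1), of Xh "F t0"] gip_commute[OF 0(1), of u Xh] by (simp add: y1_def)
  qed
  define \<rho> where "\<rho> = (1 - \<alpha>) * X + p - c"
  have B0: "B y0 = \<rho>" by (simp add: B_def \<rho>_def XXh)
  have LF: "lap (F t0) y0 = E * (\<Lambda> + X)" by (simp add: lF lfh 0 fh0 \<Lambda> XXh)
  define D where "D = Ft t0 y0"
  \<comment> \<open>The time derivative at the minimum in two ways: from the equation, and in
    \<open>D2\<close> from the vanishing of the Harnack quantity. \<open>D2\<close> serves for the
    combination multiplied by c (1 - 2 E), \<open>D1\<close> for the rest.\<close>
  have D1: "D = E * (\<Lambda> + X) + c * E * (1 - E)"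
    using F_eq[OF 0(2,1)] by (simp add: D_def LF E_def)
  have D2: "D - \<sigma> * (E * X) = - \<rho> * E - (\<beta> + c) * (E * E)"
  proof -
    have "(1 - \<alpha>) * gip (F t0) (F t0) y0 / F t0 y0 = (1 - \<alpha>) * E * X"
      unfolding gFF XXh using E by (simp add: E_def[symmetric] power2_eq_square)
    then show ?thesis using eq0 by (simp add: D_def \<rho>_def \<sigma>_def E_def[symmetric] algebra_simps)
  qed
  have "c * (1 - 2 * E) * (D - \<sigma> * (E * X)) - \<sigma> * (E * X * (\<Lambda> + X) + E * (v1 + y1))
      + (\<rho> * D + q * E + (\<beta> + c) * (2 * E * D))
      - (- \<sigma> * (E * LX + X * (E * (\<Lambda> + X)) + 2 * (E * y1)) + (\<rho> * (E * (\<Lambda> + X)) + E * ((1 - \<alpha>) * LX) + 2 * ((1 - \<alpha>) * (E * y1)))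
      + (\<beta> + c) * (2 * E * (E * (\<Lambda> + X)) + 2 * (E\<^sup>2 * X))) \<le> 0"
    using vis unfolding VF Vlap lapR[OF 0(2,1)] lapA lapB gBF LF gFF[folded XXh] Rt_def B0 E_def[symmetric] D_def[symmetric]
    by simp
  \<comment> \<open>The terms in \<open>y1\<close> cancel, with coefficients -\<sigma>, 2 \<sigma>
    and -\<sigma>. \<open>LX\<close> keeps the factor 1 - \<alpha>, which is nonnegative, so that
    Bochner's inequality applies; there the terms in \<open>v1\<close> cancel too.\<close>
  also have "c * (1 - 2 * E) * (D - \<sigma> * (E * X)) - \<sigma> * (E * X * (\<Lambda> + X) + E * (v1 + y1))
      + (\<rho> * D + q * E + (\<beta> + c) * (2 * E * D))
      - (- \<sigma> * (E * LX + X * (E * (\<Lambda> + X)) + 2 * (E * y1)) + (\<rho> * (E * (\<Lambda> + X)) + E * ((1 - \<alpha>) * LX) + 2 * ((1 - \<alpha>) * (E * y1)))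
      + (\<beta> + c) * (2 * E * (E * (\<Lambda> + X)) + 2 * (E\<^sup>2 * X)))
    = E * ((1 - \<alpha>) * LX - \<sigma> * v1 + q + c * \<rho> * E + c * (\<beta> + c) * E - 2 * (\<beta> + c) * E * X)"
    unfolding D2 unfolding D1 \<sigma>_def by (simp add: algebra_simps power2_eq_square)
  finally have "(1 - \<alpha>) * LX - \<sigma> * v1 + q + c * \<rho> * E + c * (\<beta> + c) * E - 2 * (\<beta> + c) * E * X \<le> 0"
    using E by (simp add: mult_le_0_iff)
  moreover have "(1 - \<alpha>) * LX \<ge> (1 - \<alpha>) * (2 * (\<Lambda>\<^sup>2 / CARD('n)) + 2 * v1)"
    using \<alpha> boch by (intro mult_left_mono) auto
  ultimately show ?thesis by (simp add: \<sigma>_def \<rho>_def algebra_simps)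
qed

end

subsection \<open>Independence of the chart\<close>

context coord_metric
begin

text \<open>Half the trace of the inverse metric times the derivative of the metric, that is, the
  logarithmic derivative of the root of det G; the other two terms cancel by symmetry. It is the
  only combination of Christoffel symbols in \<open>coord_div\<close>, so its transformation law
  decides that of the divergence.\<close>

lemma christoffel_trace:
  assumes y: "y \<in> U"
  shows "(\<Sum>i\<in>UNIV. \<Gamma> i i j y) = (1/2) * (\<Sum>i\<in>UNIV. \<Sum>l\<in>UNIV. a i l y * dG j i l y)"
proof -
  have "(\<Sum>i\<in>UNIV. \<Gamma> i i j y) = (1/2) * ((\<Sum>i\<in>UNIV. \<Sum>l\<in>UNIV. a i l y * dG i j l y) + (\<Sum>i\<in>UNIV. \<Sum>l\<in>UNIV. a i l y * dG j i l y)
      - (\<Sum>i\<in>UNIV. \<Sum>l\<in>UNIV. a i l y * dG l i j y))"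
    by (simp add: christoffel_def a_def sum_distrib_left[symmetric] algebra_simps sum.distrib sum_subtractf sum_divide_distrib[symmetric])
  also have "(\<Sum>i\<in>UNIV. \<Sum>l\<in>UNIV. a i l y * dG l i j y) = (\<Sum>i\<in>UNIV. \<Sum>l\<in>UNIV. a i l y * dG i j l y)"
    by (subst sum.swap) (intro sum.cong refl, metis a_sym[OF y] dG_sym[OF y])
  finally show ?thesis by simp
qed

end

lemma partial_compose:
  fixes \<psi> :: "real^'n::finite \<Rightarrow> real^'n" and F :: "real^'n \<Rightarrow> real"
  assumes \<psi>: "\<psi> differentiable at y" and F: "F differentiable at (\<psi> y)"
  shows "(\<lambda>z. F (\<psi> z)) differentiable at y"
    "partial i (\<lambda>z. F (\<psi> z)) y = (\<Sum>p\<in>UNIV. partial p F (\<psi> y) * partial i (\<lambda>z. \<psi> z $ p) y)"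
proof -
  have d: "((\<lambda>z. F (\<psi> z)) has_derivative (\<lambda>v. \<Sum>p\<in>UNIV. (\<Sum>i\<in>UNIV. v $ i *\<^sub>R partial i \<psi> y) $ p *\<^sub>R partial p F (\<psi> y))) (at y)"
    by (rule has_derivative_compose[OF has_derivative_partial[OF \<psi>] has_derivative_partial[OF F]])
  then show "(\<lambda>z. F (\<psi> z)) differentiable at y" unfolding differentiable_def by blast
  have "(\<Sum>k\<in>UNIV. axis i 1 $ k *\<^sub>R partial k \<psi> y) = partial i \<psi> y"
    by (simp add: axis_def if_distrib[of "\<lambda>z. z *\<^sub>R _"] cong: if_cong)
  then show "partial i (\<lambda>z. F (\<psi> z)) y = (\<Sum>p\<in>UNIV. partial p F (\<psi> y) * partial i (\<lambda>z. \<psi> z $ p) y)"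
    unfolding partialI[OF d] by (simp add: partial_vec_nth(2)[OF \<psi>] mult.commute)
qed

text \<open>\<open>\<psi>\<close> is a transition map on the overlap \<open>N\<close>, read in the
  first chart. Invertibility of its Jacobian is a consequence of \<open>rel\<close>, as both metrics
  are definite.\<close>

locale chart_change = M: coord_metric G U + M': coord_metric G' U'
  for G G' :: "real^'n::finite \<Rightarrow> real^'n^'n" and U U' +
  fixes \<psi> :: "real^'n \<Rightarrow> real^'n" and N
  assumes N: "open N" "N \<subseteq> U" "\<psi> ` N \<subseteq> U'"
    and \<psi>: "smooth_on N \<psi>"
    and rel: "\<And>y v w. y \<in> N \<Longrightarrow> (G y *v v) \<bullet> w = (G' (\<psi> y) *v frechet_derivative \<psi> (at y) v) \<bullet> frechet_derivative \<psi> (at y) w"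
begin

definition J :: "'n \<Rightarrow> 'n \<Rightarrow> real^'n \<Rightarrow> real"
  where "J p i = partial i (\<lambda>z. \<psi> z $ p)"

text \<open>The inverse of the Jacobian, written as G^-1 J^T G' at corresponding points.\<close>

definition K :: "'n \<Rightarrow> 'n \<Rightarrow> real^'n \<Rightarrow> real"
  where "K l q y = (\<Sum>i\<in>UNIV. \<Sum>p\<in>UNIV. M.a l i y * J p i y * G' (\<psi> y) $ p $ q)"

lemma U': "y \<in> N \<Longrightarrow> \<psi> y \<in> U'" and U: "y \<in> N \<Longrightarrow> y \<in> U"
  using N by auto

lemma \<psi>_diff: "y \<in> N \<Longrightarrow> \<psi> differentiable at y"
  by (rule smooth_on_differentiable[OF \<psi> N(1)])

lemma smooth_J: "smooth_on N (J p i)"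
  unfolding J_def by (intro smooth_on_partial smooth_on_vec_nth N \<psi>)

lemma J_diff: "y \<in> N \<Longrightarrow> J p i differentiable at y"
  by (rule smooth_on_differentiable[OF smooth_J N(1)])

lemma partial_J: "y \<in> N \<Longrightarrow> partial j (J p i) y = partial i (J p j) y"
  unfolding J_def
  by (rule partial_commute[OF N(1)]) (use smooth_on_vec_nth[OF N(1) \<psi>] in \<open>auto simp: smooth_on_def\<close>)

lemma G_rel:
  assumes y: "y \<in> N"
  shows "G y $ i $ j = (\<Sum>p\<in>UNIV. \<Sum>q\<in>UNIV. J p i y * G' (\<psi> y) $ p $ q * J q j y)"
proof -
  have D: "frechet_derivative \<psi> (at y) (axis k 1) $ p = J p k y" for k p
    unfolding frechet_eq_partial[OF \<psi>_diff[OF y]] J_def partial_vec_nth(2)[OF \<psi>_diff[OF y]]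
    by (simp add: axis_def if_distrib[of "\<lambda>z. z *\<^sub>R _"] if_distrib[of "\<lambda>z. z * _"] cong: if_cong)
  have "G y $ i $ j = (G y *v axis j 1) \<bullet> axis i 1"
    unfolding inner_axis by (simp add: matrix_vector_mult_def axis_def sum_delta_mult)
  also have "\<dots> = (\<Sum>p\<in>UNIV. (\<Sum>q\<in>UNIV. G' (\<psi> y) $ p $ q * J q j y) * J p i y)"
    unfolding rel[OF y] by (simp add: inner_vec_def matrix_vector_mult_def D)
  finally show ?thesis by (simp add: sum_distrib_left sum_distrib_right mult_ac)
qed

text \<open>G = J^T G' J gives (G^-1 J^T G') J = 1, and a left inverse of a square matrix is a right
  inverse. Multiplying J K = 1 by the inverse of G' yields the law for the inverse metric.\<close>

lemma inverses:
  assumes y: "y \<in> N"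
  shows KJ: "(\<Sum>q\<in>UNIV. K l q y * J q j y) = (if l = j then 1 else 0)"
    and JK: "(\<Sum>l\<in>UNIV. J p l y * K l q y) = (if p = q then 1 else 0)"
    and a_rel: "M'.a p q (\<psi> y) = (\<Sum>i\<in>UNIV. \<Sum>l\<in>UNIV. J p i y * M.a i l y * J q l y)"
proof -
  define Am where "Am = matrix_inv (G y)"
  define Am' where "Am' = matrix_inv (G' (\<psi> y))"
  define Jm where "Jm = (\<chi> p i. J p i y)"
  define Km where "Km = Am ** transpose Jm ** G' (\<psi> y)"
  have inv: "Am ** G y = mat 1" "G' (\<psi> y) ** Am' = mat 1" "Am' ** G' (\<psi> y) = mat 1"
    using matrix_inv_inverse[of "G y"] M.pos_G[OF U[OF y]] matrix_inv_inverse[of "G' (\<psi> y)"] M'.pos_G[OF U'[OF y]]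
    by (auto simp: Am_def Am'_def)
  have G: "G y = transpose Jm ** G' (\<psi> y) ** Jm"
    by (simp add: vec_eq_iff matrix_matrix_mult_def transpose_def Jm_def G_rel[OF y] sum_distrib_right)
      (intro allI sum.swap)
  have Km: "Km $ l $ q = K l q y" for l q
  proof -
    have "Km $ l $ q = (\<Sum>p\<in>UNIV. \<Sum>i\<in>UNIV. M.a l i y * J p i y * G' (\<psi> y) $ p $ q)"
      by (simp add: Km_def matrix_matrix_mult_def transpose_def Jm_def Am_def M.a_def sum_distrib_right)
    also have "\<dots> = K l q y" unfolding K_def by (rule sum.swap)
    finally show ?thesis .
  qed
  have KJ: "Km ** Jm = mat 1"
    using inv(1) unfolding G by (simp add: Km_def matrix_mul_assoc)
  then have JK: "Jm ** Km = mat 1" using matrix_left_right_inverse by blast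
  have "Jm ** Am ** transpose Jm = Jm ** Am ** transpose Jm ** (G' (\<psi> y) ** Am')"
    by (simp add: inv)
  also have "\<dots> = Jm ** Km ** Am'" by (simp add: Km_def matrix_mul_assoc)
  finally have A': "Jm ** Am ** transpose Jm = Am'" by (simp add: JK)
  show "(\<Sum>q\<in>UNIV. K l q y * J q j y) = (if l = j then 1 else 0)"
    using KJ by (simp add: vec_eq_iff matrix_matrix_mult_def mat_def Km) (simp add: Jm_def)
  show "(\<Sum>l\<in>UNIV. J p l y * K l q y) = (if p = q then 1 else 0)"
    using JK by (simp add: vec_eq_iff matrix_matrix_mult_def mat_def Km) (simp add: Jm_def)
  have "M'.a p q (\<psi> y) = (\<Sum>l\<in>UNIV. \<Sum>i\<in>UNIV. J p i y * M.a i l y * J q l y)"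
    unfolding M'.a_def Am'_def[symmetric] A'[symmetric]
    by (simp add: matrix_matrix_mult_def transpose_def Jm_def Am_def M.a_def sum_distrib_right)
  also have "\<dots> = (\<Sum>i\<in>UNIV. \<Sum>l\<in>UNIV. J p i y * M.a i l y * J q l y)" by (rule sum.swap)
  finally show "M'.a p q (\<psi> y) = (\<Sum>i\<in>UNIV. \<Sum>l\<in>UNIV. J p i y * M.a i l y * J q l y)" .
qed

text \<open>Differentiate G = J^T G' J and take the trace with G^-1. The two terms with a derivative
  of J agree by symmetry, each being tr (J^-1 dJ), the logarithmic derivative of det J; the term
  with a derivative of G' is the trace in the other chart.\<close>

lemma christoffel_trace_rel:
  assumes y: "y \<in> N"
  shows "(\<Sum>i\<in>UNIV. M.\<Gamma> i i j y) = (\<Sum>l\<in>UNIV. \<Sum>q\<in>UNIV. K l q y * partial j (J q l) y)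
    + (\<Sum>m\<in>UNIV. (\<Sum>i\<in>UNIV. M'.\<Gamma> i i m (\<psi> y)) * J m j y)"
proof -
  let ?g = "\<lambda>p q. G' (\<psi> y) $ p $ q"
  define S where "S = (\<Sum>l\<in>UNIV. \<Sum>q\<in>UNIV. K l q y * partial j (J q l) y)"
  define d where "d p q = partial j (\<lambda>z. G' (\<psi> z) $ p $ q) y" for p q
  note dc = partial_compose[OF \<psi>_diff[OF y] M'.diff_G[OF U'[OF y]]]
  have dG: "M.dG j i l y = (\<Sum>p\<in>UNIV. \<Sum>q\<in>UNIV. partial j (J p i) y * ?g p q * J q l y + J p i y * d p q * J q l y
      + J p i y * ?g p q * partial j (J q l) y)" for i l
  proof -
    have "M.dG j i l y = partial j (\<lambda>z. \<Sum>p\<in>UNIV. \<Sum>q\<in>UNIV. J p i z * G' (\<psi> z) $ p $ q * J q l z) y"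
      by (rule partial_cong[OF N(1) y]) (rule G_rel)
    then show ?thesis
      by (simp add: partial_sum partial_mult J_diff y dc(1) differentiable_mult differentiable_sum d_def algebra_simps)
  qed
  have sw: "(\<Sum>i\<in>UNIV. \<Sum>l\<in>UNIV. \<Sum>p\<in>UNIV. \<Sum>q\<in>UNIV. h i l p q) = (\<Sum>l\<in>UNIV. \<Sum>q\<in>UNIV. \<Sum>i\<in>UNIV. \<Sum>p\<in>UNIV. h i l p q)"
    for h :: "'n \<Rightarrow> 'n \<Rightarrow> 'n \<Rightarrow> 'n \<Rightarrow> real"
  proof -
    have "(\<Sum>i\<in>UNIV. \<Sum>l\<in>UNIV. \<Sum>p\<in>UNIV. \<Sum>q\<in>UNIV. h i l p q) = (\<Sum>l\<in>UNIV. \<Sum>i\<in>UNIV. \<Sum>p\<in>UNIV. \<Sum>q\<in>UNIV. h i l p q)"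
      by (rule sum.swap)
    also have "\<dots> = (\<Sum>l\<in>UNIV. \<Sum>i\<in>UNIV. \<Sum>q\<in>UNIV. \<Sum>p\<in>UNIV. h i l p q)"
      by (intro sum.cong refl sum.swap)
    also have "\<dots> = (\<Sum>l\<in>UNIV. \<Sum>q\<in>UNIV. \<Sum>i\<in>UNIV. \<Sum>p\<in>UNIV. h i l p q)"
      by (intro sum.cong refl sum.swap)
    finally show ?thesis .
  qed
  have sw2: "(\<Sum>i\<in>UNIV. \<Sum>l\<in>UNIV. \<Sum>p\<in>UNIV. \<Sum>q\<in>UNIV. h i l p q) = (\<Sum>p\<in>UNIV. \<Sum>q\<in>UNIV. \<Sum>i\<in>UNIV. \<Sum>l\<in>UNIV. h i l p q)"
    for h :: "'n \<Rightarrow> 'n \<Rightarrow> 'n \<Rightarrow> 'n \<Rightarrow> real"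
  proof -
    have "(\<Sum>i\<in>UNIV. \<Sum>l\<in>UNIV. \<Sum>p\<in>UNIV. \<Sum>q\<in>UNIV. h i l p q) = (\<Sum>i\<in>UNIV. \<Sum>p\<in>UNIV. \<Sum>l\<in>UNIV. \<Sum>q\<in>UNIV. h i l p q)"
      by (intro sum.cong refl sum.swap)
    also have "\<dots> = (\<Sum>p\<in>UNIV. \<Sum>i\<in>UNIV. \<Sum>q\<in>UNIV. \<Sum>l\<in>UNIV. h i l p q)"
      by (subst sum.swap) (intro sum.cong refl sum.swap)
    also have "\<dots> = (\<Sum>p\<in>UNIV. \<Sum>q\<in>UNIV. \<Sum>i\<in>UNIV. \<Sum>l\<in>UNIV. h i l p q)"
      by (intro sum.cong refl sum.swap)
    finally show ?thesis .
  qed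
  have e3: "(\<Sum>i\<in>UNIV. \<Sum>l\<in>UNIV. \<Sum>p\<in>UNIV. \<Sum>q\<in>UNIV. M.a i l y * (J p i y * ?g p q * partial j (J q l) y)) = S"
    by (subst sw) (simp add: S_def K_def sum_distrib_right sum_distrib_left M.a_sym[OF U[OF y]] mult_ac)
  have e1: "(\<Sum>i\<in>UNIV. \<Sum>l\<in>UNIV. \<Sum>p\<in>UNIV. \<Sum>q\<in>UNIV. M.a i l y * (partial j (J p i) y * ?g p q * J q l y)) = S"
  proof -
    have "(\<Sum>i\<in>UNIV. \<Sum>l\<in>UNIV. \<Sum>p\<in>UNIV. \<Sum>q\<in>UNIV. M.a i l y * (partial j (J p i) y * ?g p q * J q l y))
      = (\<Sum>l\<in>UNIV. \<Sum>i\<in>UNIV. \<Sum>p\<in>UNIV. \<Sum>q\<in>UNIV. M.a i l y * (partial j (J p i) y * ?g p q * J q l y))"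
      by (rule sum.swap)
    also have "\<dots> = (\<Sum>l\<in>UNIV. \<Sum>i\<in>UNIV. \<Sum>q\<in>UNIV. \<Sum>p\<in>UNIV. M.a i l y * (partial j (J p i) y * ?g p q * J q l y))"
      by (intro sum.cong refl sum.swap)
    also have "\<dots> = (\<Sum>l\<in>UNIV. \<Sum>i\<in>UNIV. \<Sum>q\<in>UNIV. \<Sum>p\<in>UNIV. M.a l i y * (J q l y * ?g q p * partial j (J p i) y))"
      by (intro sum.cong refl) (simp add: M.a_sym[OF U[OF y], of _ _] M'.G_sym[OF U'[OF y], of _ _] mult_ac)
    also have "\<dots> = S" by (rule e3)
    finally show ?thesis .
  qed
  have e2: "(\<Sum>i\<in>UNIV. \<Sum>l\<in>UNIV. \<Sum>p\<in>UNIV. \<Sum>q\<in>UNIV. M.a i l y * (J p i y * d p q * J q l y))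
     = 2 * (\<Sum>m\<in>UNIV. (\<Sum>i\<in>UNIV. M'.\<Gamma> i i m (\<psi> y)) * J m j y)"
  proof -
    have "(\<Sum>i\<in>UNIV. \<Sum>l\<in>UNIV. \<Sum>p\<in>UNIV. \<Sum>q\<in>UNIV. M.a i l y * (J p i y * d p q * J q l y))
      = (\<Sum>p\<in>UNIV. \<Sum>q\<in>UNIV. M'.a p q (\<psi> y) * d p q)"
      by (subst sw2) (simp add: a_rel[OF y] sum_distrib_right sum_distrib_left mult_ac)
    also have "\<dots> = (\<Sum>p\<in>UNIV. \<Sum>q\<in>UNIV. \<Sum>m\<in>UNIV. M'.a p q (\<psi> y) * M'.dG m p q (\<psi> y) * J m j y)"
      unfolding d_def dc(2) J_def[symmetric] by (simp add: sum_distrib_left mult_ac)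
    also have "\<dots> = (\<Sum>p\<in>UNIV. \<Sum>m\<in>UNIV. \<Sum>q\<in>UNIV. M'.a p q (\<psi> y) * M'.dG m p q (\<psi> y) * J m j y)"
      by (intro sum.cong refl sum.swap)
    also have "\<dots> = (\<Sum>m\<in>UNIV. \<Sum>p\<in>UNIV. \<Sum>q\<in>UNIV. M'.a p q (\<psi> y) * M'.dG m p q (\<psi> y) * J m j y)"
      by (rule sum.swap)
    also have "\<dots> = 2 * (\<Sum>m\<in>UNIV. (\<Sum>i\<in>UNIV. M'.\<Gamma> i i m (\<psi> y)) * J m j y)"
      by (simp add: M'.christoffel_trace[OF U'[OF y]] sum_distrib_right sum_distrib_left)
    finally show ?thesis .
  qed
  have "(\<Sum>i\<in>UNIV. \<Sum>l\<in>UNIV. M.a i l y * M.dG j i l y) = S + 2 * (\<Sum>m\<in>UNIV. (\<Sum>i\<in>UNIV. M'.\<Gamma> i i m (\<psi> y)) * J m j y) + S"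
    unfolding dG by (simp only: sum_distrib_left distrib_left sum.distrib e1 e2 e3)
  then show ?thesis
    unfolding M.christoffel_trace[OF U[OF y]] S_def by simp
qed

context
  fixes F F' :: "real^'n \<Rightarrow> real"
  assumes F: "Ck_on 2 N F" and F': "Ck_on 2 U' F'" and FF': "\<And>z. z \<in> N \<Longrightarrow> F z = F' (\<psi> z)"
begin

lemma partial_rel:
  assumes y: "y \<in> N"
  shows "partial i F y = (\<Sum>p\<in>UNIV. partial p F' (\<psi> y) * J p i y)"
proof -
  have "partial i F y = partial i (\<lambda>z. F' (\<psi> z)) y"
    by (rule partial_cong[OF N(1) y FF'])
  then show ?thesis
    using partial_compose(2)[OF \<psi>_diff[OF y] M'.Ck2_differentiable(1)[OF M'.open_U subset_refl F' U'[OF y]]] by (simp add: J_def)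
qed

lemma grad_rel:
  assumes y: "y \<in> N"
  shows "coord_grad G' F' (\<psi> y) $ p = (\<Sum>i\<in>UNIV. J p i y * coord_grad G F y $ i)"
proof -
  have "coord_grad G' F' (\<psi> y) $ p = (\<Sum>q\<in>UNIV. \<Sum>i\<in>UNIV. \<Sum>l\<in>UNIV. J p i y * M.a i l y * (partial q F' (\<psi> y) * J q l y))"
    by (simp add: M'.coord_grad_nth a_rel[OF y] sum_distrib_right sum_distrib_left mult_ac)
  also have "\<dots> = (\<Sum>i\<in>UNIV. \<Sum>q\<in>UNIV. \<Sum>l\<in>UNIV. J p i y * M.a i l y * (partial q F' (\<psi> y) * J q l y))"
    by (rule sum.swap)
  also have "\<dots> = (\<Sum>i\<in>UNIV. \<Sum>l\<in>UNIV. \<Sum>q\<in>UNIV. J p i y * M.a i l y * (partial q F' (\<psi> y) * J q l y))"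
    by (intro sum.cong refl sum.swap)
  also have "\<dots> = (\<Sum>i\<in>UNIV. J p i y * coord_grad G F y $ i)"
    by (simp add: M.coord_grad_nth partial_rel[OF y] sum_distrib_left mult_ac)
  finally show ?thesis .
qed

lemma gip_rel:
  assumes y: "y \<in> N" shows "M.gip F F y = M'.gip F' F' (\<psi> y)"
proof -
  have "M.gip F F y = (\<Sum>i\<in>UNIV. \<Sum>p\<in>UNIV. partial p F' (\<psi> y) * (J p i y * coord_grad G F y $ i))"
    unfolding M.gip_grad partial_rel[OF y] by (simp add: sum_distrib_right sum_distrib_left mult_ac)
  also have "\<dots> = M'.gip F' F' (\<psi> y)"
    unfolding M'.gip_grad grad_rel[OF y] by (subst sum.swap) (simp add: sum_distrib_left)
  finally show ?thesis .
qed

text \<open>The gradients X and X' satisfy X' = J X along \<open>\<psi>\<close>. Differentiating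
  this and contracting with the inverse Jacobian produces the divergence of X and a term tr (J^-1
  dJ) in X, by the symmetry \<open>partial_J\<close> of the derivatives of J. The same term appears
  in \<open>christoffel_trace_rel\<close>.\<close>

lemma lap_rel:
  assumes y: "y \<in> N" shows "M.lap F y = M'.lap F' (\<psi> y)"
proof -
  define X where "X i z = coord_grad G F z $ i" for i z
  define X' where "X' i z = coord_grad G' F' z $ i" for i z
  have X_diff: "X i differentiable at y" for i
    unfolding X_def[abs_def] M.coord_grad_nth
    by (intro differentiable_sum differentiable_mult finite ballI M.diff_a U[OF y] M.Ck2_differentiable(2)[OF N(1,2) F y])
  have X'_diff: "X' i differentiable at (\<psi> y)" for i
    unfolding X'_def[abs_def] M'.coord_grad_nth
    by (intro differentiable_sum differentiable_mult finite ballI M'.diff_a U'[OF y]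
        M'.Ck2_differentiable(2)[OF M'.open_U subset_refl F' U'[OF y]])
  have dX: "(\<Sum>m\<in>UNIV. partial m (X' k) (\<psi> y) * J m l y) = (\<Sum>i\<in>UNIV. partial i (J k l) y * X i y + J k i y * partial l (X i) y)" for k l
  proof -
    have "(\<Sum>m\<in>UNIV. partial m (X' k) (\<psi> y) * J m l y) = partial l (\<lambda>z. X' k (\<psi> z)) y"
      unfolding partial_compose(2)[OF \<psi>_diff[OF y] X'_diff] J_def ..
    also have "\<dots> = partial l (\<lambda>z. \<Sum>i\<in>UNIV. J k i z * X i z) y"
      by (rule partial_cong[OF N(1) y]) (simp add: X'_def X_def grad_rel)
    also have "\<dots> = (\<Sum>i\<in>UNIV. partial l (J k i) y * X i y + J k i y * partial l (X i) y)"
      by (simp add: partial_sum partial_mult J_diff y X_diff differentiable_mult)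
    finally show ?thesis by (simp add: partial_J[OF y, of l])
  qed
  \<comment> \<open>Inserting J K = 1 turns derivatives in the second chart into derivatives in the
    first, to which \<open>dX\<close> applies.\<close>
  have "(\<Sum>k\<in>UNIV. partial k (X' k) (\<psi> y)) = (\<Sum>k\<in>UNIV. \<Sum>m\<in>UNIV. partial m (X' k) (\<psi> y) * (\<Sum>l\<in>UNIV. J m l y * K l k y))"
    by (simp add: JK[OF y] sum_delta_mult)
  also have "\<dots> = (\<Sum>k\<in>UNIV. \<Sum>m\<in>UNIV. \<Sum>l\<in>UNIV. K l k y * (partial m (X' k) (\<psi> y) * J m l y))"
    by (simp add: sum_distrib_left mult_ac)
  also have "\<dots> = (\<Sum>k\<in>UNIV. \<Sum>l\<in>UNIV. \<Sum>m\<in>UNIV. K l k y * (partial m (X' k) (\<psi> y) * J m l y))"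
    by (intro sum.cong refl sum.swap)
  also have "\<dots> = (\<Sum>l\<in>UNIV. \<Sum>k\<in>UNIV. \<Sum>m\<in>UNIV. K l k y * (partial m (X' k) (\<psi> y) * J m l y))"
    by (rule sum.swap)
  also have "\<dots> = (\<Sum>l\<in>UNIV. \<Sum>k\<in>UNIV. \<Sum>i\<in>UNIV. K l k y * partial i (J k l) y * X i y)
      + (\<Sum>l\<in>UNIV. \<Sum>k\<in>UNIV. \<Sum>i\<in>UNIV. K l k y * J k i y * partial l (X i) y)"
    unfolding sum_distrib_left[symmetric] dX
    by (simp add: sum_distrib_left distrib_left sum.distrib mult.assoc)
  also have "(\<Sum>l\<in>UNIV. \<Sum>k\<in>UNIV. \<Sum>i\<in>UNIV. K l k y * J k i y * partial l (X i) y)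
     = (\<Sum>l\<in>UNIV. \<Sum>i\<in>UNIV. \<Sum>k\<in>UNIV. K l k y * J k i y * partial l (X i) y)"
    by (intro sum.cong refl sum.swap)
  also have "\<dots> = (\<Sum>l\<in>UNIV. \<Sum>i\<in>UNIV. (if l = i then 1 else 0) * partial l (X i) y)"
    unfolding sum_distrib_right[symmetric] KJ[OF y] ..
  also have "\<dots> = (\<Sum>i\<in>UNIV. partial i (X i) y)" by (simp only: sum_delta_mult)
  also have "(\<Sum>l\<in>UNIV. \<Sum>k\<in>UNIV. \<Sum>i\<in>UNIV. K l k y * partial i (J k l) y * X i y)
     = (\<Sum>l\<in>UNIV. \<Sum>i\<in>UNIV. \<Sum>k\<in>UNIV. K l k y * partial i (J k l) y * X i y)"
    by (intro sum.cong refl sum.swap)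
  also have "\<dots> = (\<Sum>i\<in>UNIV. \<Sum>l\<in>UNIV. \<Sum>k\<in>UNIV. K l k y * partial i (J k l) y * X i y)"
    by (rule sum.swap)
  also have "\<dots> = (\<Sum>i\<in>UNIV. (\<Sum>l\<in>UNIV. \<Sum>k\<in>UNIV. K l k y * partial i (J k l) y) * X i y)"
    by (simp add: sum_distrib_right)
  finally have 1: "(\<Sum>k\<in>UNIV. partial k (X' k) (\<psi> y))
    = (\<Sum>i\<in>UNIV. (\<Sum>l\<in>UNIV. \<Sum>k\<in>UNIV. K l k y * partial i (J k l) y) * X i y) + (\<Sum>i\<in>UNIV. partial i (X i) y)" .
  have div: "M.lap F y = (\<Sum>i\<in>UNIV. partial i (X i) y) + (\<Sum>j\<in>UNIV. (\<Sum>i\<in>UNIV. M.\<Gamma> i i j y) * X j y)"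
  proof -
    have "(\<Sum>i\<in>UNIV. \<Sum>j\<in>UNIV. M.\<Gamma> i i j y * X j y) = (\<Sum>j\<in>UNIV. (\<Sum>i\<in>UNIV. M.\<Gamma> i i j y) * X j y)"
      by (subst sum.swap) (simp add: sum_distrib_right)
    then show ?thesis unfolding M.lap_def coord_div_def sum.distrib X_def[abs_def] by simp
  qed
  have div': "M'.lap F' (\<psi> y) = (\<Sum>i\<in>UNIV. partial i (X' i) (\<psi> y)) + (\<Sum>j\<in>UNIV. (\<Sum>i\<in>UNIV. M'.\<Gamma> i i j (\<psi> y)) * X' j (\<psi> y))"
  proof -
    have "(\<Sum>i\<in>UNIV. \<Sum>j\<in>UNIV. M'.\<Gamma> i i j (\<psi> y) * X' j (\<psi> y)) = (\<Sum>j\<in>UNIV. (\<Sum>i\<in>UNIV. M'.\<Gamma> i i j (\<psi> y)) * X' j (\<psi> y))"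
      by (subst sum.swap) (simp add: sum_distrib_right)
    then show ?thesis unfolding M'.lap_def coord_div_def sum.distrib X'_def[abs_def] by simp
  qed
  have 2: "(\<Sum>j\<in>UNIV. (\<Sum>m\<in>UNIV. (\<Sum>i\<in>UNIV. M'.\<Gamma> i i m (\<psi> y)) * J m j y) * X j y) = (\<Sum>m\<in>UNIV. (\<Sum>i\<in>UNIV. M'.\<Gamma> i i m (\<psi> y)) * X' m (\<psi> y))"
  proof -
    have "(\<Sum>j\<in>UNIV. (\<Sum>m\<in>UNIV. (\<Sum>i\<in>UNIV. M'.\<Gamma> i i m (\<psi> y)) * J m j y) * X j y)
      = (\<Sum>j\<in>UNIV. \<Sum>m\<in>UNIV. (\<Sum>i\<in>UNIV. M'.\<Gamma> i i m (\<psi> y)) * (J m j y * X j y))"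
      by (simp add: sum_distrib_right mult.assoc)
    also have "\<dots> = (\<Sum>m\<in>UNIV. \<Sum>j\<in>UNIV. (\<Sum>i\<in>UNIV. M'.\<Gamma> i i m (\<psi> y)) * (J m j y * X j y))"
      by (rule sum.swap)
    also have "\<dots> = (\<Sum>m\<in>UNIV. (\<Sum>i\<in>UNIV. M'.\<Gamma> i i m (\<psi> y)) * X' m (\<psi> y))"
      by (simp only: sum_distrib_left[symmetric] X'_def X_def grad_rel[OF y])
    finally show ?thesis .
  qed
  show ?thesis
    unfolding div div' christoffel_trace_rel[OF y] distrib_right sum.distrib 2 1 by simp
qed

end
end

subsection \<open>Functions on a manifold\<close>

lemma cmap_cran: "p \<in> cdom \<kappa> \<Longrightarrow> cmap \<kappa> p \<in> cran \<kappa>"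
  unfolding cran_def by auto

context
  fixes M :: "'a::t2_space set" and A :: "('a, 'n::finite) chart set" and g :: "('a, 'n) metric"
  assumes crm: "closed_riemannian_manifold M A g"
begin

lemma atlasD:
  assumes "\<kappa> \<in> A"
  shows "openin (top_of_set M) (cdom \<kappa>)" "open (cran \<kappa>)" "homeomorphism (cdom \<kappa>) (cran \<kappa>) (cmap \<kappa>) (cinv \<kappa>)"
    "cdom \<kappa> \<subseteq> M"
  using crm assms unfolding closed_riemannian_manifold_def smooth_atlas_def by auto

lemma coord_metric_chart: "\<kappa> \<in> A \<Longrightarrow> coord_metric (g \<kappa>) (cran \<kappa>)"
  using crm atlasD(2) unfolding closed_riemannian_manifold_def riemannian_metric_def
  by unfold_locales auto

lemma cinv_cmap: "\<kappa> \<in> A \<Longrightarrow> p \<in> cdom \<kappa> \<Longrightarrow> cinv \<kappa> (cmap \<kappa> p) = p"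
  and cinv_cdom: "\<kappa> \<in> A \<Longrightarrow> y \<in> cran \<kappa> \<Longrightarrow> cinv \<kappa> y \<in> cdom \<kappa>"
  and cmap_cinv: "\<kappa> \<in> A \<Longrightarrow> y \<in> cran \<kappa> \<Longrightarrow> cmap \<kappa> (cinv \<kappa> y) = y"
  using atlasD(3)[of \<kappa>] unfolding homeomorphism_def cran_def by auto

lemma chart_at: "p \<in> M \<Longrightarrow> chart_at A p \<in> A \<and> p \<in> cdom (chart_at A p)"
  unfolding chart_at_def using crm unfolding closed_riemannian_manifold_def smooth_atlas_def
  by (intro someI_ex[of "\<lambda>\<kappa>. \<kappa> \<in> A \<and> p \<in> cdom \<kappa>"]) auto

lemma chart_change_charts:
  assumes k: "\<kappa> \<in> A" "\<kappa>' \<in> A"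
  shows "chart_change (g \<kappa>) (g \<kappa>') (cran \<kappa>) (cran \<kappa>') (cmap \<kappa>' \<circ> cinv \<kappa>) (cmap \<kappa> ` (cdom \<kappa> \<inter> cdom \<kappa>'))"
proof -
  interpret M: coord_metric "g \<kappa>" "cran \<kappa>" by (rule coord_metric_chart[OF k(1)])
  interpret M': coord_metric "g \<kappa>'" "cran \<kappa>'" by (rule coord_metric_chart[OF k(2)])
  show ?thesis
  proof
    have "openin (top_of_set (cdom \<kappa>)) (cdom \<kappa> \<inter> cdom \<kappa>')"
    proof -
      have "openin (top_of_set M) (cdom \<kappa> \<inter> cdom \<kappa>')" using atlasD(1)[OF k(1)] atlasD(1)[OF k(2)] by auto
      then show ?thesis by (rule openin_subset_trans) (use atlasD(4)[OF k(1)] in auto)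
    qed
    then have "openin (top_of_set (cran \<kappa>)) (cmap \<kappa> ` (cdom \<kappa> \<inter> cdom \<kappa>'))"
      by (rule homeomorphism_imp_open_map[OF atlasD(3)[OF k(1)]])
    then show "open (cmap \<kappa> ` (cdom \<kappa> \<inter> cdom \<kappa>'))"
      using atlasD(2)[OF k(1)] openin_open_trans by blast
    show "cmap \<kappa> ` (cdom \<kappa> \<inter> cdom \<kappa>') \<subseteq> cran \<kappa>" unfolding cran_def by auto
    show "(cmap \<kappa>' \<circ> cinv \<kappa>) ` cmap \<kappa> ` (cdom \<kappa> \<inter> cdom \<kappa>') \<subseteq> cran \<kappa>'"
      using cinv_cmap[OF k(1)] cmap_cran by fastforce
    show "smooth_on (cmap \<kappa> ` (cdom \<kappa> \<inter> cdom \<kappa>')) (cmap \<kappa>' \<circ> cinv \<kappa>)"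
      using crm k unfolding closed_riemannian_manifold_def smooth_atlas_def by blast
    fix y v w assume "y \<in> cmap \<kappa> ` (cdom \<kappa> \<inter> cdom \<kappa>')"
    then obtain p where p: "p \<in> cdom \<kappa> \<inter> cdom \<kappa>'" "y = cmap \<kappa> p" by auto
    have "(g \<kappa> (cmap \<kappa> p) *v v) \<bullet> w = (g \<kappa>' (cmap \<kappa>' p) *v frechet_derivative (cmap \<kappa>' \<circ> cinv \<kappa>) (at (cmap \<kappa> p)) v)
        \<bullet> frechet_derivative (cmap \<kappa>' \<circ> cinv \<kappa>) (at (cmap \<kappa> p)) w"
      using crm k p(1) unfolding closed_riemannian_manifold_def riemannian_metric_def Let_def by blast
    then show "(g \<kappa> y *v v) \<bullet> w = (g \<kappa>' ((cmap \<kappa>' \<circ> cinv \<kappa>) y) *v frechet_derivative (cmap \<kappa>' \<circ> cinv \<kappa>) (at y) v)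
        \<bullet> frechet_derivative (cmap \<kappa>' \<circ> cinv \<kappa>) (at y) w"
      using p cinv_cmap[OF k(1)] by simp
  qed
qed

text \<open>Invariance moves the computation from the chart selected at p to any chart around p. The
  selected chart may jump from point to point, whereas the maximum principle works in one fixed
  chart near the minimum.\<close>

lemma in_chart:
  assumes h: "\<And>\<kappa>. \<kappa> \<in> A \<Longrightarrow> Ck_on 2 (cran \<kappa>) (h \<circ> cinv \<kappa>)"
    and k: "\<kappa> \<in> A" and p: "p \<in> cdom \<kappa>"
  shows laplacian_in_chart: "laplacian A g h p = coord_metric.lap (g \<kappa>) (h \<circ> cinv \<kappa>) (cmap \<kappa> p)"
    and grad_norm_in_chart: "(grad_norm A g h p)\<^sup>2 = coord_metric.gip (g \<kappa>) (h \<circ> cinv \<kappa>) (h \<circ> cinv \<kappa>) (cmap \<kappa> p)"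
proof -
  define \<kappa>' where "\<kappa>' = chart_at A p"
  have k': "\<kappa>' \<in> A" "p \<in> cdom \<kappa>'" using chart_at[of p] atlasD(4)[OF k] p by (auto simp: \<kappa>'_def)
  interpret C: chart_change "g \<kappa>" "g \<kappa>'" "cran \<kappa>" "cran \<kappa>'" "cmap \<kappa>' \<circ> cinv \<kappa>" "cmap \<kappa> ` (cdom \<kappa> \<inter> cdom \<kappa>')"
    by (rule chart_change_charts[OF k k'(1)])
  have y: "cmap \<kappa> p \<in> cmap \<kappa> ` (cdom \<kappa> \<inter> cdom \<kappa>')" using p k' by auto
  have \<psi>: "(cmap \<kappa>' \<circ> cinv \<kappa>) (cmap \<kappa> p) = cmap \<kappa>' p" using cinv_cmap[OF k p] by simp
  have rel: "(h \<circ> cinv \<kappa>) z = (h \<circ> cinv \<kappa>') ((cmap \<kappa>' \<circ> cinv \<kappa>) z)" if "z \<in> cmap \<kappa> ` (cdom \<kappa> \<inter> cdom \<kappa>')" for z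
    using that cinv_cmap[OF k] cinv_cmap[OF k'(1)] by auto
  note asm = Ck_on_subset[OF h[OF k] C.N(2)] h[OF k'(1)] rel
  have "laplacian A g h p = C.M'.lap (h \<circ> cinv \<kappa>') (cmap \<kappa>' p)"
    by (simp add: laplacian_def Let_def \<kappa>'_def[symmetric] C.M'.lap_def)
  also have "\<dots> = C.M.lap (h \<circ> cinv \<kappa>) (cmap \<kappa> p)"
    using C.lap_rel[OF asm y] unfolding \<psi> by (rule sym)
  finally show "laplacian A g h p = coord_metric.lap (g \<kappa>) (h \<circ> cinv \<kappa>) (cmap \<kappa> p)" .
  have y': "cmap \<kappa>' p \<in> cran \<kappa>'" by (rule cmap_cran[OF k'(2)])
  have "(grad_norm A g h p)\<^sup>2 = C.M'.gip (h \<circ> cinv \<kappa>') (h \<circ> cinv \<kappa>') (cmap \<kappa>' p)"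
    using C.M'.gip_nonneg[OF y']
    by (simp add: grad_norm_def Let_def \<kappa>'_def[symmetric] C.M'.grad_norm_eq[OF y'])
  also have "\<dots> = C.M.gip (h \<circ> cinv \<kappa>) (h \<circ> cinv \<kappa>) (cmap \<kappa> p)"
    using C.gip_rel[OF asm y] unfolding \<psi> by (rule sym)
  finally show "(grad_norm A g h p)\<^sup>2 = coord_metric.gip (g \<kappa>) (h \<circ> cinv \<kappa>) (h \<circ> cinv \<kappa>) (cmap \<kappa> p)" .
qed

end

subsection \<open>The Harnack quantity on the manifold\<close>

lemma (in coord_metric) lap_cong:
  assumes W: "open W" "W \<subseteq> U" and y: "y \<in> W" and F: "Ck_on 2 W F" and eq: "\<And>z. z \<in> W \<Longrightarrow> F z = H z"
  shows "lap F y = lap H y"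
proof -
  have 1: "partial i F z = partial i H z" if "z \<in> W" for i z
    by (rule partial_cong[OF W(1) that eq])
  have 2: "partial i (partial j F) y = partial i (partial j H) y" for i j
    by (rule partial_cong[OF W(1) y 1])
  have H: "Ck_on 2 W H" using F Ck_on_cong[OF W(1) eq] by simp
  show ?thesis by (simp add: lap_eq[OF W y F] lap_eq[OF W y H] 1[OF y] 2)
qed

text \<open>For the Laplacian, apply \<open>lap_exp\<close> to ln F and solve for its term.\<close>

lemma (in coord_metric) lap_gip_ln:
  assumes F: "Ck_on 2 U F" "\<And>z. z \<in> U \<Longrightarrow> F z > 0" and y: "y \<in> U"
  shows "gip (\<lambda>z. ln (F z)) (\<lambda>z. ln (F z)) y = gip F F y / (F y)\<^sup>2"
    "lap (\<lambda>z. ln (F z)) y = lap F y / F y - gip F F y / (F y)\<^sup>2"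
proof -
  note W = open_U subset_refl
  have p: "partial i (\<lambda>z. ln (F z)) y = inverse (F y) * partial i F y" for i
    by (rule partial_ln(2)[OF Ck2_differentiable(1)[OF W F(1) y] F(2)[OF y]])
  show g: "gip (\<lambda>z. ln (F z)) (\<lambda>z. ln (F z)) y = gip F F y / (F y)\<^sup>2"
    by (simp add: gip_def p sum_divide_distrib power2_eq_square field_simps)
  have "lap F y = lap (\<lambda>z. exp (ln (F z))) y"
    by (rule lap_cong[OF W y F(1)]) (simp add: F)
  also have "\<dots> = F y * (lap (\<lambda>z. ln (F z)) y + gip F F y / (F y)\<^sup>2)"
    using lap_exp[OF W Ck_on_ln[OF open_U F] y] F(2)[OF y] by (simp add: g)
  finally show "lap (\<lambda>z. ln (F z)) y = lap F y / F y - gip F F y / (F y)\<^sup>2"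
    using F(2)[OF y] by (simp add: field_simps)
qed

section \<open>A solution of the equation in charts\<close>

context
  fixes M :: "'a::t2_space set" and A :: "('a, 'n::finite) chart set" and g :: "('a, 'n) metric"
    and f u :: "'a \<Rightarrow> real \<Rightarrow> real" and c \<alpha> \<beta> :: real
  assumes crm: "closed_riemannian_manifold M A g"
    and f_reg: "C21 A f"
    and f_pos: "\<And>x t. x \<in> M \<Longrightarrow> t \<ge> 0 \<Longrightarrow> f x t > 0"
    and f_eq: "\<And>x t. x \<in> M \<Longrightarrow> t \<ge> 0 \<Longrightarrow>
      time_deriv f x t = laplacian A g (\<lambda>y. f y t) x + c * f x t * (1 - f x t)"
    and u: "u = (\<lambda>x t. ln (f x t))"
begin

definition f_coord :: "('a, 'n) chart \<Rightarrow> real \<Rightarrow> real^'n \<Rightarrow> real"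
  where "f_coord \<kappa> t y = f (cinv \<kappa> y) t"

definition ft_coord :: "('a, 'n) chart \<Rightarrow> real \<Rightarrow> real^'n \<Rightarrow> real"
  where "ft_coord \<kappa> t y = time_deriv f (cinv \<kappa> y) t"

text \<open>Without the function of time: this part stays continuous down to t = 0, where that
  function blows up.\<close>

definition harnack_quantity :: "'a \<Rightarrow> real \<Rightarrow> real"
  where "harnack_quantity x t = laplacian A g (\<lambda>y. u y t) x + \<alpha> * (grad_norm A g (\<lambda>y. u y t) x)\<^sup>2 + \<beta> * exp (u x t)"

lemma f_coord_regular:
  assumes k: "\<kappa> \<in> A"
  shows "t \<ge> 0 \<Longrightarrow> Ck_on 2 (cran \<kappa>) (f_coord \<kappa> t)"
    and "p \<in> cdom \<kappa> \<Longrightarrow> f p differentiable_on {0..}"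
    and "continuous_on (cran \<kappa> \<times> {0..}) (\<lambda>(y, t). f_coord \<kappa> t y)"
    and "continuous_on (cran \<kappa> \<times> {0..}) (\<lambda>(y, t). partial i (f_coord \<kappa> t) y)"
    and "continuous_on (cran \<kappa> \<times> {0..}) (\<lambda>(y, t). partial i (partial j (f_coord \<kappa> t)) y)"
    and "continuous_on (cran \<kappa> \<times> {0..}) (\<lambda>(y, t). ft_coord \<kappa> t y)"
  using f_reg k unfolding C21_def Let_def f_coord_def[abs_def] ft_coord_def by auto

lemma f_coord_pos: "\<kappa> \<in> A \<Longrightarrow> y \<in> cran \<kappa> \<Longrightarrow> t \<ge> 0 \<Longrightarrow> f_coord \<kappa> t y > 0"
  using cinv_cdom[OF crm] atlasD(4)[OF crm] f_pos unfolding f_coord_def by blast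

lemma f_coord_eq:
  assumes k: "\<kappa> \<in> A" and y: "y \<in> cran \<kappa>" and t: "t \<ge> 0"
  shows "ft_coord \<kappa> t y = coord_metric.lap (g \<kappa>) (f_coord \<kappa> t) y + c * f_coord \<kappa> t y * (1 - f_coord \<kappa> t y)"
proof -
  have p: "cinv \<kappa> y \<in> cdom \<kappa>" by (rule cinv_cdom[OF crm k y])
  have "laplacian A g (\<lambda>y. f y t) (cinv \<kappa> y) = coord_metric.lap (g \<kappa>) ((\<lambda>y. f y t) \<circ> cinv \<kappa>) (cmap \<kappa> (cinv \<kappa> y))"
    using f_coord_regular(1)[OF _ t] by (intro laplacian_in_chart[OF crm _ k p]) (simp add: o_def f_coord_def[abs_def])
  then show ?thesis
    using f_eq[of "cinv \<kappa> y" t] p atlasD(4)[OF crm k] t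
    by (auto simp: ft_coord_def f_coord_def[abs_def] cmap_cinv[OF crm k y] o_def)
qed

lemma parabolic_chart:
  assumes k: "\<kappa> \<in> A"
  shows "parabolic (g \<kappa>) (cran \<kappa>) (f_coord \<kappa>) (ft_coord \<kappa>) c"
proof -
  interpret coord_metric "g \<kappa>" "cran \<kappa>" by (rule coord_metric_chart[OF crm k])
  note sub = continuous_on_subset[of "cran \<kappa> \<times> {0..}" _ "cran \<kappa> \<times> {0<..}"]
  show ?thesis
  proof
    show "((\<lambda>t. f_coord \<kappa> t y) has_real_derivative ft_coord \<kappa> t y) (at t)" if "t > 0" "y \<in> cran \<kappa>" for t y
    proof -
      define p where "p = cinv \<kappa> y"
      have "f p differentiable (at t within {0..})"
        using f_coord_regular(2)[OF k, of p] cinv_cdom[OF crm k that(2)] that(1) by (simp add: differentiable_on_def p_def)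
      then have "(f p has_vector_derivative vector_derivative (f p) (at t within {0..})) (at t within {0..})"
        by (rule vector_derivative_works[THEN iffD1])
      moreover have "at t within {0..} = at t"
        by (rule at_within_nhd[of _ "{0<..}"]) (use that(1) in auto)
      ultimately show ?thesis
        unfolding f_coord_def ft_coord_def time_deriv_def p_def[symmetric]
        by (simp add: has_real_derivative_iff_has_vector_derivative)
    qed
  qed (use f_coord_regular[OF k] f_coord_pos[OF k] f_coord_eq[OF k] in \<open>auto intro!: sub\<close>)
qed

lemma harnack_quantity_in_chart:
  assumes k: "\<kappa> \<in> A" and p: "p \<in> cdom \<kappa>" and t: "t \<ge> 0"
  defines "y \<equiv> cmap \<kappa> p"
  defines "E \<equiv> f_coord \<kappa> t y" and "X \<equiv> coord_metric.gip (g \<kappa>) (f_coord \<kappa> t) (f_coord \<kappa> t) y / (f_coord \<kappa> t y)\<^sup>2"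
  shows "harnack_quantity p t = coord_metric.lap (g \<kappa>) (f_coord \<kappa> t) y / E - X + \<alpha> * X + \<beta> * E"
    and "harnack_quantity p t = ft_coord \<kappa> t y / E - (1 - \<alpha>) * X + (\<beta> + c) * E - c"
proof -
  interpret coord_metric "g \<kappa>" "cran \<kappa>" by (rule coord_metric_chart[OF crm k])
  have y: "y \<in> cran \<kappa>" unfolding y_def by (rule cmap_cran[OF p])
  have Epos: "E > 0" unfolding E_def by (rule f_coord_pos[OF k y t])
  have C: "Ck_on 2 (cran \<kappa>') ((\<lambda>y. u y t) \<circ> cinv \<kappa>')" if "\<kappa>' \<in> A" for \<kappa>'
    using Ck_on_ln[OF atlasD(2)[OF crm that] f_coord_regular(1)[OF that t] f_coord_pos[OF that _ t]]
    by (simp add: o_def u f_coord_def)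
  have uo: "(\<lambda>y. u y t) \<circ> cinv \<kappa> = (\<lambda>z. ln (f_coord \<kappa> t z))"
    by (simp add: o_def u f_coord_def)
  have lp: "f_coord \<kappa> t z > 0" if "z \<in> cran \<kappa>" for z by (rule f_coord_pos[OF k that t])
  have ln: "gip (\<lambda>z. ln (f_coord \<kappa> t z)) (\<lambda>z. ln (f_coord \<kappa> t z)) y = gip (f_coord \<kappa> t) (f_coord \<kappa> t) y / (f_coord \<kappa> t y)\<^sup>2"
    "lap (\<lambda>z. ln (f_coord \<kappa> t z)) y = lap (f_coord \<kappa> t) y / f_coord \<kappa> t y - gip (f_coord \<kappa> t) (f_coord \<kappa> t) y / (f_coord \<kappa> t y)\<^sup>2"
    by (rule lap_gip_ln[OF f_coord_regular(1)[OF k t] lp y], assumption)+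
  have L: "laplacian A g (\<lambda>y. u y t) p = lap (\<lambda>z. ln (f_coord \<kappa> t z)) y"
    unfolding uo[symmetric] y_def by (rule laplacian_in_chart[OF crm C k p])
  have G: "(grad_norm A g (\<lambda>y. u y t) p)\<^sup>2 = gip (\<lambda>z. ln (f_coord \<kappa> t z)) (\<lambda>z. ln (f_coord \<kappa> t z)) y"
    unfolding uo[symmetric] y_def by (rule grad_norm_in_chart[OF crm C k p])
  have "exp (u p t) = E"
    using Epos cinv_cmap[OF crm k p] by (simp add: u E_def f_coord_def y_def)
  then show 1: "harnack_quantity p t = lap (f_coord \<kappa> t) y / E - X + \<alpha> * X + \<beta> * E"
    unfolding harnack_quantity_def L G ln X_def E_def by simp
  show "harnack_quantity p t = ft_coord \<kappa> t y / E - (1 - \<alpha>) * X + (\<beta> + c) * E - c"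
    unfolding 1 f_coord_eq[OF k y t] E_def[symmetric] using Epos by (simp add: field_simps)
qed

text \<open>Continuity is local, and each chart domain is relatively open in \<open>M\<close>. There
  the formula of first order, with the time derivative in place of the Laplacian, is built from
  jointly continuous functions only.\<close>

lemma harnack_quantity_continuous: "continuous_on (M \<times> {0..}) (\<lambda>(x, t). harnack_quantity x t)"
  unfolding continuous_on_eq_continuous_within
proof
  fix P assume P: "P \<in> M \<times> {0::real..}"
  obtain x t where xt: "P = (x, t)" "x \<in> M" "t \<ge> 0" using P by auto
  obtain \<kappa> where k: "\<kappa> \<in> A" "x \<in> cdom \<kappa>" using chart_at[OF crm xt(2)] by blast
  interpret coord_metric "g \<kappa>" "cran \<kappa>" by (rule coord_metric_chart[OF crm k(1)])
  let ?Q = "cran \<kappa> \<times> {0::real..}"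
  note lr = f_coord_regular[OF k(1)]
  have sc: "continuous_on ?Q (\<lambda>P. h (fst P))" if "smooth_on (cran \<kappa>) h" for h :: "real^'n \<Rightarrow> real"
    by (rule continuous_on_compose2[OF smooth_on_continuous[OF that], of _ fst]) (auto intro: continuous_intros)
  define \<Theta> where "\<Theta> P = ft_coord \<kappa> (snd P) (fst P) / f_coord \<kappa> (snd P) (fst P) - (1 - \<alpha>) * (gip (f_coord \<kappa> (snd P)) (f_coord \<kappa> (snd P)) (fst P) / (f_coord \<kappa> (snd P) (fst P))\<^sup>2)
    + (\<beta> + c) * f_coord \<kappa> (snd P) (fst P) - c" for P
  have "continuous_on ?Q \<Theta>"
    unfolding \<Theta>_def gip_def
    by (intro continuous_intros sc smooth_a lr(3,4,6)[unfolded case_prod_beta])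
      (use f_coord_pos[OF k(1)] in \<open>auto simp: less_imp_neq[symmetric]\<close>)
  then have "continuous_on (cdom \<kappa> \<times> {0..}) (\<lambda>P. \<Theta> (cmap \<kappa> (fst P), snd P))"
  proof (rule continuous_on_compose2)
    have "continuous_on (cdom \<kappa>) (cmap \<kappa>)"
      using atlasD(3)[OF crm k(1)] unfolding homeomorphism_def by blast
    then have "continuous_on (cdom \<kappa> \<times> {0..}) (\<lambda>P. cmap \<kappa> (fst P))"
      by (rule continuous_on_compose2[of _ _ _ fst]) (auto intro: continuous_intros)
    then show "continuous_on (cdom \<kappa> \<times> {0::real..}) (\<lambda>P. (cmap \<kappa> (fst P), snd P))"
      by (intro continuous_intros)
  qed (auto intro: cmap_cran)
  then have "continuous_on (cdom \<kappa> \<times> {0..}) (\<lambda>(x, t). harnack_quantity x t)"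
    by (rule continuous_on_cong[THEN iffD1, rotated -1]) (auto simp: harnack_quantity_in_chart(2)[OF k(1)] \<Theta>_def)
  then have "continuous (at P within (cdom \<kappa> \<times> {0..})) (\<lambda>(x, t). harnack_quantity x t)"
    using k xt by (auto simp: continuous_on_eq_continuous_within)
  moreover have "at P within (M \<times> {0..}) = at P within (cdom \<kappa> \<times> {0..})"
  proof -
    obtain O' where O': "open O'" "cdom \<kappa> = M \<inter> O'"
      using atlasD(1)[OF crm k(1)] openin_open by blast
    show ?thesis
      by (rule at_within_nhd[of _ "O' \<times> UNIV"]) (use O' k xt in \<open>auto intro: open_Times\<close>)
  qed
  ultimately show "continuous (at P within (M \<times> {0..})) (\<lambda>(x, t). harnack_quantity x t)" by simp
qed

text \<open>The comparison function enters through its blow-up at 0, its left derivative and the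
  positivity of the polynomial for every p above it; at a negative minimum m the relevant p is
  \<phi> - m. A left derivative is enough, since a minimum is compared with earlier times
  only.\<close>

lemma harnack_abstract:
  fixes \<phi> :: "real \<Rightarrow> real"
  assumes Ric: "nonneg_ricci A g" and \<alpha>: "\<alpha> \<le> 1"
    and cont: "continuous_on {0<..} \<phi>"
    and blow: "\<And>B. \<exists>\<delta>>0. \<forall>t. 0 < t \<and> t < \<delta> \<longrightarrow> \<phi> t > B"
    and der: "\<And>t. t > 0 \<Longrightarrow> \<exists>\<phi>'. (\<phi> has_real_derivative \<phi>') (at t within {..t}) \<and>
      (\<forall>p X E. p > \<phi> t \<longrightarrow> X \<ge> 0 \<longrightarrow> E > 0 \<longrightarrow>
        2 * (1 - \<alpha>) * ((\<alpha> * X + \<beta> * E + p)\<^sup>2 / CARD('n)) + c * E * (p + (1 - \<alpha>) * X + \<beta>) - 2 * (\<beta> + c) * E * X + \<phi>' > 0)"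
    and x: "x \<in> M" "t > 0"
  shows "laplacian A g (\<lambda>y. u y t) x + \<alpha> * (grad_norm A g (\<lambda>y. u y t) x)\<^sup>2 + \<beta> * exp (u x t) + \<phi> t \<ge> 0"
proof (fold harnack_quantity_def, rule ccontr)
  assume neg: "\<not> harnack_quantity x t + \<phi> t \<ge> 0"
  have compM: "compact M" using crm by (simp add: closed_riemannian_manifold_def)
  have "compact (M \<times> {0..t})" by (intro compact_Times compM compact_Icc)
  moreover have "continuous_on (M \<times> {0..t}) (\<lambda>(x, t). harnack_quantity x t)"
    by (rule continuous_on_subset[OF harnack_quantity_continuous]) auto
  ultimately obtain P0 where P0: "\<And>P. P \<in> M \<times> {0..t} \<Longrightarrow> (\<lambda>(x, t). harnack_quantity x t) P0 \<le> (\<lambda>(x, t). harnack_quantity x t) P"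
    using continuous_attains_inf[of "M \<times> {0..t}" "\<lambda>(x, t). harnack_quantity x t"] x by fastforce
  \<comment> \<open>By compactness the quantity is bounded below on the whole time interval
    including 0, so the blow-up of \<phi> makes the sum positive before \<delta>.\<close>
  define m0 where "m0 = (\<lambda>(x, t). harnack_quantity x t) P0"
  obtain \<delta> where \<delta>: "\<delta> > 0" "\<And>t. 0 < t \<Longrightarrow> t < \<delta> \<Longrightarrow> \<phi> t > - m0" using blow[of "- m0"] by blast
  have early: "harnack_quantity x' t' + \<phi> t' > 0" if "x' \<in> M" "0 < t'" "t' < \<delta>" "t' \<le> t" for x' t'
    using P0[of "(x', t')"] \<delta>(2)[OF that(2,3)] that by (auto simp: m0_def)
  have t\<delta>: "t \<ge> \<delta>" using early[OF x(1), of t] neg x by force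
  \<comment> \<open>Cutting at \<delta> / 2 leaves room before the minimum, which by
    \<open>early\<close> lies at a time at least \<delta>.\<close>
  define K where "K = M \<times> {\<delta> / 2..t}"
  have K: "compact K" unfolding K_def by (intro compact_Times compM compact_Icc)
  have xK: "(x, t) \<in> K" using x t\<delta> \<delta> by (auto simp: K_def)
  have "continuous_on K (\<lambda>P. (\<lambda>(x, t). harnack_quantity x t) P + \<phi> (snd P))"
    using \<delta>(1) unfolding K_def
    by (intro continuous_on_add continuous_on_subset[OF harnack_quantity_continuous] continuous_on_compose2[OF cont, of _ snd])
      (auto intro: continuous_intros)
  then obtain p ts where pK: "(p, ts) \<in> K" and min: "\<And>x' t'. (x', t') \<in> K \<Longrightarrow> harnack_quantity p ts + \<phi> ts \<le> harnack_quantity x' t' + \<phi> t'"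
    using continuous_attains_inf[OF K, of "\<lambda>P. (\<lambda>(x, t). harnack_quantity x t) P + \<phi> (snd P)"] xK by fastforce
  define m where "m = harnack_quantity p ts + \<phi> ts"
  have m: "m < 0" using min[OF xK] neg by (simp add: m_def)
  have pM: "p \<in> M" and ts: "ts \<le> t" "ts \<ge> \<delta> / 2" "ts > 0" using pK \<delta> by (auto simp: K_def)
  have ts\<delta>: "ts \<ge> \<delta>" using early[OF pM ts(3) _ ts(1)] m by (force simp: m_def)
  obtain \<kappa> where k: "\<kappa> \<in> A" "p \<in> cdom \<kappa>" using chart_at[OF crm pM] by blast
  interpret parabolic "g \<kappa>" "cran \<kappa>" "f_coord \<kappa>" "ft_coord \<kappa>" c by (rule parabolic_chart[OF k(1)])
  define y0 where "y0 = cmap \<kappa> p"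
  have y0: "y0 \<in> cran \<kappa>" unfolding y0_def by (rule cmap_cran[OF k(2)])
  obtain \<phi>' where \<phi>': "(\<phi> has_real_derivative \<phi>') (at ts within {..ts})"
    "\<And>p X E. p > \<phi> ts \<Longrightarrow> X \<ge> 0 \<Longrightarrow> E > 0 \<Longrightarrow>
        2 * (1 - \<alpha>) * ((\<alpha> * X + \<beta> * E + p)\<^sup>2 / CARD('n)) + c * E * (p + (1 - \<alpha>) * X + \<beta>) - 2 * (\<beta> + c) * E * X + \<phi>' > 0"
    using der[OF ts(3)] by blast
  define E where "E = f_coord \<kappa> ts y0"
  define X where "X = gip (f_coord \<kappa> ts) (f_coord \<kappa> ts) y0 / E\<^sup>2"
  define pp where "pp = \<phi> ts - m"
  define S where "S = 2 * (1 - \<alpha>) * ((\<alpha> * X + \<beta> * E + pp)\<^sup>2 / CARD('n)) + c * E * (pp + (1 - \<alpha>) * X + \<beta>) - 2 * (\<beta> + c) * E * X"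
  \<comment> \<open>Half of the positive margin: the slope q = \<phi>' - \<epsilon> lies below the
    left derivative, and S + q = \<epsilon> is still positive.\<close>
  define \<epsilon> where "\<epsilon> = (S + \<phi>') / 2"
  have E: "E > 0" unfolding E_def by (rule F_pos[OF ts(3) y0])
  have X: "X \<ge> 0" using gip_nonneg[OF y0] E by (simp add: X_def)
  have \<epsilon>: "\<epsilon> > 0" using \<phi>'(2)[of pp X E] m X E by (simp add: \<epsilon>_def S_def pp_def)
  define q where "q = \<phi>' - \<epsilon>"
  have "eventually (\<lambda>s. q < (\<phi> s - \<phi> ts) / (s - ts)) (at ts within {..ts})"
    using \<phi>'(1) \<epsilon> unfolding has_field_derivative_iff by (intro order_tendstoD(1)) (auto simp: q_def)
  then obtain d where d: "d > 0" "\<And>s. s \<le> ts \<Longrightarrow> s \<noteq> ts \<Longrightarrow> dist s ts < d \<Longrightarrow> q < (\<phi> s - \<phi> ts) / (s - ts)"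
    unfolding eventually_at by auto
  \<comment> \<open>Before \<open>ts\<close> the increment s - ts is negative, so the smaller slope
    gives an upper bound. This affine majorant is the only trace of \<phi> that
    \<open>minimum_inequality\<close> sees.\<close>
  have lin: "\<phi> s \<le> \<phi> ts + q * (s - ts)" if "s \<le> ts" "ts - s < d" for s
  proof (cases "s = ts")
    case False
    then have "q < (\<phi> s - \<phi> ts) / (s - ts)" using d(2)[of s] that by (simp add: dist_real_def)
    moreover have "s - ts < 0" using False that by simp
    ultimately show ?thesis by (simp add: neg_less_divide_eq less_imp_le)
  qed simp
  define t1 where "t1 = max (\<delta> / 2) (ts - d / 2)"
  have t1: "t1 < ts" using ts\<delta> \<delta> d by (simp add: t1_def)
  have hy: "harnack_quantity (cinv \<kappa> y) s = ft_coord \<kappa> s y / f_coord \<kappa> s y - (1 - \<alpha>) * (gip (f_coord \<kappa> s) (f_coord \<kappa> s) y / (f_coord \<kappa> s y)\<^sup>2) + (\<beta> + c) * f_coord \<kappa> s y - c"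
    if "y \<in> cran \<kappa>" "s > 0" for y s
    using harnack_quantity_in_chart(2)[OF k(1) cinv_cdom[OF crm k(1) that(1)], of s] that cmap_cinv[OF crm k(1) that(1)] by simp
  have mult: "(harnack_quantity (cinv \<kappa> y) s + r) * f_coord \<kappa> s y = ft_coord \<kappa> s y - (1 - \<alpha>) * gip (f_coord \<kappa> s) (f_coord \<kappa> s) y / f_coord \<kappa> s y
      + (\<beta> + c) * (f_coord \<kappa> s y * f_coord \<kappa> s y) + (r - c) * f_coord \<kappa> s y"
    if "y \<in> cran \<kappa>" "s > 0" for y s r
    unfolding hy[OF that] using F_pos[OF that(2,1)] by (simp add: field_simps power2_eq_square)
  have hp: "harnack_quantity (cinv \<kappa> y0) ts = m - \<phi> ts" using cinv_cmap[OF crm k] by (simp add: y0_def m_def)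
  have "2 * (1 - \<alpha>) * ((lap (f_coord \<kappa> ts) y0 / E - X)\<^sup>2 / CARD('n)) + c * E * (pp + (1 - \<alpha>) * X + \<beta>) - 2 * (\<beta> + c) * E * X + q \<le> 0"
    unfolding E_def X_def
  proof (rule minimum_inequality[OF _ y0 ts(3) t1 \<alpha>])
    show "0 \<le> (\<Sum>j\<in>UNIV. \<Sum>ka\<in>UNIV. ricci (g \<kappa>) j ka y0 * v $ j * v $ ka)" for v
      using Ric k(1) y0 unfolding nonneg_ricci_def by blast
    show "ft_coord \<kappa> ts y0 - (1 - \<alpha>) * gip (f_coord \<kappa> ts) (f_coord \<kappa> ts) y0 / f_coord \<kappa> ts y0
        + (\<beta> + c) * (f_coord \<kappa> ts y0 * f_coord \<kappa> ts y0) + (pp - c) * f_coord \<kappa> ts y0 = 0"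
      unfolding mult[OF y0 ts(3), symmetric] hp pp_def by simp
    fix s y assume y: "y \<in> cran \<kappa>" and s: "t1 \<le> s" "0 < s" "s \<le> ts"
    have "(cinv \<kappa> y, s) \<in> K"
      using cinv_cdom[OF crm k(1) y] atlasD(4)[OF crm k(1)] s ts by (auto simp: K_def t1_def)
    then have "m \<le> harnack_quantity (cinv \<kappa> y) s + \<phi> s" using min by (simp add: m_def)
    moreover have "\<phi> s \<le> \<phi> ts + q * (s - ts)" using s d by (intro lin) (auto simp: t1_def)
    ultimately have "0 \<le> harnack_quantity (cinv \<kappa> y) s + (pp + q * (s - ts))" by (simp add: pp_def)
    then have "0 \<le> (harnack_quantity (cinv \<kappa> y) s + (pp + q * (s - ts))) * f_coord \<kappa> s y"
      using F_pos[OF s(2) y] by (intro mult_nonneg_nonneg) auto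
    then show "0 \<le> ft_coord \<kappa> s y - (1 - \<alpha>) * gip (f_coord \<kappa> s) (f_coord \<kappa> s) y / f_coord \<kappa> s y
        + (\<beta> + c) * (f_coord \<kappa> s y * f_coord \<kappa> s y) + (pp + q * (s - ts) - c) * f_coord \<kappa> s y"
      unfolding mult[OF y s(2)] .
  qed
  moreover have "lap (f_coord \<kappa> ts) y0 / E - X = - (\<alpha> * X + \<beta> * E + pp)"
    using harnack_quantity_in_chart(1)[OF k, of ts] ts(3) by (simp add: y0_def[symmetric] E_def[symmetric] X_def[symmetric] pp_def m_def)
  ultimately have "S + q \<le> 0"
    by (simp only: S_def power2_minus)
  then show False using \<epsilon> by (simp add: q_def \<epsilon>_def field_simps)
qed

end

subsection \<open>The explicit comparison functions\<close>

text \<open>Expanding in X, the terms in X^2 and X p are nonnegative, \<gamma> is the coefficient of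
  X E, and what is free of X is \<open>Q\<close>.\<close>

lemma reaction_polynomial_pos:
  fixes k :: real
  assumes k: "k > 0" and a: "\<alpha> \<ge> 0" and p: "p > 0" and X: "X \<ge> 0" and E: "E > 0"
    and \<gamma>: "2 * k * \<alpha> * \<beta> - 2 * \<beta> - c * (1 + \<alpha>) \<ge> 0"
    and Q: "k * \<beta>\<^sup>2 * E\<^sup>2 + E * ((2 * k * \<beta> + c) * p + \<beta> * c) + k * p\<^sup>2 + d > 0"
  shows "k * (\<alpha> * X + \<beta> * E + p)\<^sup>2 + c * E * (p + (1 - \<alpha>) * X + \<beta>) - 2 * (\<beta> + c) * E * X + d > 0"
proof -
  have "k * (\<alpha> * X + \<beta> * E + p)\<^sup>2 + c * E * (p + (1 - \<alpha>) * X + \<beta>) - 2 * (\<beta> + c) * E * X + d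
    = k * \<alpha>\<^sup>2 * X\<^sup>2 + 2 * k * \<alpha> * p * X + X * E * (2 * k * \<alpha> * \<beta> - 2 * \<beta> - c * (1 + \<alpha>))
      + (k * \<beta>\<^sup>2 * E\<^sup>2 + E * ((2 * k * \<beta> + c) * p + \<beta> * c) + k * p\<^sup>2 + d)"
    by (simp add: power2_eq_square algebra_simps)
  moreover have "k * \<alpha>\<^sup>2 * X\<^sup>2 \<ge> 0" "2 * k * \<alpha> * p * X \<ge> 0" using assms by auto
  moreover have "X * E * (2 * k * \<alpha> * \<beta> - 2 * \<beta> - c * (1 + \<alpha>)) \<ge> 0" using assms by (intro mult_nonneg_nonneg) auto
  ultimately show ?thesis using Q by linarith
qed

lemma complete_square_bound:
  fixes k :: real
  assumes "k > 0" "\<beta> \<noteq> 0"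
  shows "k * \<beta>\<^sup>2 * E\<^sup>2 + E * B + k * p\<^sup>2 + d \<ge> k * p\<^sup>2 + d - B\<^sup>2 / (4 * k * \<beta>\<^sup>2)"
proof -
  have "k * \<beta>\<^sup>2 > 0" using assms by simp
  have "k * \<beta>\<^sup>2 * E\<^sup>2 + E * B + B\<^sup>2 / (4 * k * \<beta>\<^sup>2) = k * \<beta>\<^sup>2 * (E + B / (2 * k * \<beta>\<^sup>2))\<^sup>2"
    using assms by (simp add: power2_eq_square field_simps)
  also have "\<dots> \<ge> 0" using \<open>k * \<beta>\<^sup>2 > 0\<close> by simp
  finally show ?thesis by linarith
qed

lemma quadratic_pos_b:
  fixes k :: real
  assumes k: "k > 0" and b: "\<beta> < 0" and E: "E > 0" and w: "2 * k * \<beta> + c > 0" and \<phi>: "\<phi> > 0" and p: "p > \<phi>"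
    and d1: "k * \<phi>\<^sup>2 + d \<ge> 0"
    and d2: "(2 * k * \<beta> + c) * \<phi> + \<beta> * c \<ge> 0 \<or> k * \<phi>\<^sup>2 + d \<ge> ((2 * k * \<beta> + c) * \<phi> + \<beta> * c)\<^sup>2 / (4 * k * \<beta>\<^sup>2)"
  shows "k * \<beta>\<^sup>2 * E\<^sup>2 + E * ((2 * k * \<beta> + c) * p + \<beta> * c) + k * p\<^sup>2 + d > 0"
proof -
  define B where "B x = (2 * k * \<beta> + c) * x + \<beta> * c" for x
  have Bmono: "B \<phi> < B p" using p w by (simp add: B_def)
  have "\<phi>\<^sup>2 < p\<^sup>2" using p \<phi> by (intro power_strict_mono) auto
  then have sq: "k * \<phi>\<^sup>2 < k * p\<^sup>2" using k by simp
  show ?thesis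
  proof (cases "B p \<ge> 0")
    case True
    then have "k * \<beta>\<^sup>2 * E\<^sup>2 + E * B p \<ge> 0" using k E by (intro add_nonneg_nonneg mult_nonneg_nonneg) auto
    then show ?thesis using sq d1 by (simp add: B_def)
  next
    case False
    then have "(B p)\<^sup>2 \<le> (B \<phi>)\<^sup>2" using Bmono by (intro abs_le_square_iff[THEN iffD1]) auto
    then have "(B p)\<^sup>2 / (4 * k * \<beta>\<^sup>2) \<le> (B \<phi>)\<^sup>2 / (4 * k * \<beta>\<^sup>2)" using k by (intro divide_right_mono) auto
    moreover have "k * \<phi>\<^sup>2 + d \<ge> (B \<phi>)\<^sup>2 / (4 * k * \<beta>\<^sup>2)" using d2 False Bmono by (simp add: B_def)
    ultimately show ?thesis
      using complete_square_bound[OF k, where \<beta> = \<beta> and E = E and B = "B p" and p = p and d = d] b sq unfolding B_def by linarith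
  qed
qed

text \<open>After completing the square in E, the lower bound is h(\<phi>) - h(p) for the quadratic
  h on the right of the differential equation. Since w < 0, it opens downwards with larger zero
  -\<beta>, so it decreases strictly beyond -\<beta>.\<close>

lemma quadratic_pos_a:
  fixes k :: real
  assumes k: "k > 0" and b: "\<beta> < 0" and c: "c > 0" and w: "4 * k * \<beta> + c < 0" and \<phi>: "\<phi> > - \<beta>" and p: "p > \<phi>"
    and d: "d = c * (\<phi> + \<beta>) * ((4 * k * \<beta> + c) * \<phi> + \<beta> * c) / (4 * k * \<beta>\<^sup>2)"
  shows "k * \<beta>\<^sup>2 * E\<^sup>2 + E * ((2 * k * \<beta> + c) * p + \<beta> * c) + k * p\<^sup>2 + d > 0"
proof -
  define h where "h x = c * (x + \<beta>) * ((4 * k * \<beta> + c) * x + \<beta> * c) / (4 * k * \<beta>\<^sup>2)" for x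
  have kb: "4 * k * \<beta>\<^sup>2 > 0" using k b by simp
  have "k * p\<^sup>2 - ((2 * k * \<beta> + c) * p + \<beta> * c)\<^sup>2 / (4 * k * \<beta>\<^sup>2) = - h p"
  proof -
    have "4 * k * \<beta>\<^sup>2 * (k * p\<^sup>2) - ((2 * k * \<beta> + c) * p + \<beta> * c)\<^sup>2 = - (c * (p + \<beta>) * ((4 * k * \<beta> + c) * p + \<beta> * c))"
      by (simp add: power2_eq_square algebra_simps)
    moreover have "k * p\<^sup>2 = 4 * k * \<beta>\<^sup>2 * (k * p\<^sup>2) / (4 * k * \<beta>\<^sup>2)" using kb by (metis less_irrefl nonzero_mult_div_cancel_left)
    ultimately show ?thesis unfolding h_def by (metis diff_divide_distrib minus_divide_left)
  qed
  then have "k * \<beta>\<^sup>2 * E\<^sup>2 + E * ((2 * k * \<beta> + c) * p + \<beta> * c) + k * p\<^sup>2 + d \<ge> h \<phi> - h p"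
    using complete_square_bound[OF k, where \<beta> = \<beta> and E = E and B = "(2 * k * \<beta> + c) * p + \<beta> * c" and p = p and d = d] b by (simp add: d h_def)
  moreover have "h p < h \<phi>"
  proof -
    \<comment> \<open>Up to a positive factor, the divided difference of \<open>h\<close> between
      \<phi> and p is w (p + \<phi>) + \<beta> c + \<beta> w. It is compared with its value -4 k
      \<beta>^2 at p + \<phi> = -2 \<beta>.\<close>
    have "(4 * k * \<beta> + c) * (p + \<phi>) < (4 * k * \<beta> + c) * (- 2 * \<beta>)"
      using w \<phi> p by (intro mult_strict_left_mono_neg) auto
    also have "\<dots> = - (4 * k * \<beta> + c) * \<beta> - \<beta> * c - 4 * k * \<beta>\<^sup>2"
      by (simp add: power2_eq_square algebra_simps)
    finally have "(4 * k * \<beta> + c) * (p + \<phi>) + \<beta> * c + \<beta> * (4 * k * \<beta> + c) < 0" using kb by (simp add: algebra_simps)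
    then have "c * ((p - \<phi>) * ((4 * k * \<beta> + c) * (p + \<phi>) + \<beta> * c + \<beta> * (4 * k * \<beta> + c))) < 0"
      using p c by (intro mult_pos_neg) auto
    then have "c * (p + \<beta>) * ((4 * k * \<beta> + c) * p + \<beta> * c) < c * (\<phi> + \<beta>) * ((4 * k * \<beta> + c) * \<phi> + \<beta> * c)"
      by (simp add: algebra_simps)
    then show ?thesis unfolding h_def using kb by (rule divide_strict_right_mono)
  qed
  ultimately show ?thesis by simp
qed

text \<open>A solution of \<open>\<phi>' = c (\<phi> + \<beta>) (w \<phi> + \<beta> c) / (4 k \<beta>\<^sup>2)\<close>, the equation which makes the
  discriminant of the quadratic form in \<open>e\<^sup>u\<close> vanish; here \<open>w = 4 k \<beta> + c < 0\<close> and \<open>P = \<beta> c / w\<close>.\<close>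

lemma comparison_a:
  fixes k c \<beta> P w :: real
  assumes k: "k > 0" and b: "\<beta> < 0" and c: "c > 0" and w: "w = 4 * k * \<beta> + c" "w < 0" and P: "P = \<beta> * c / w"
  defines "\<phi> \<equiv> \<lambda>t. (P * exp (- c * t) - \<beta>) / (1 - exp (- c * t))"
  shows "continuous_on {0<..} \<phi>" "\<exists>\<delta>>0. \<forall>t. 0 < t \<and> t < \<delta> \<longrightarrow> \<phi> t > B"
    "t > 0 \<Longrightarrow> \<phi> t > - \<beta>"
    "t > 0 \<Longrightarrow> (\<phi> has_real_derivative c * (\<phi> t + \<beta>) * (w * \<phi> t + \<beta> * c) / (4 * k * \<beta>\<^sup>2)) (at t)"
proof -
  have kb: "4 * k * \<beta>\<^sup>2 > 0" using k b by simp
  have wP: "w * P = \<beta> * c" using w P by simp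
  have wPb: "w * (P - \<beta>) = - (4 * k * \<beta>\<^sup>2)"
    using wP by (simp add: w(1) power2_eq_square algebra_simps)
  have Pb: "P - \<beta> > 0" using wPb kb w(2) by (smt (verit) mult_nonpos_nonpos)
  have s: "exp (- c * t) < 1" if "t > 0" for t using that c by simp
  \<comment> \<open>The distances of \<phi> from the two equilibria -\<beta> and -P of the equation;
    their product gives the right side.\<close>
  have plus: "\<phi> t + \<beta> = (P - \<beta>) * (exp (- c * t) / (1 - exp (- c * t)))" "\<phi> t + P = (P - \<beta>) / (1 - exp (- c * t))"
    if "t > 0" for t
  proof -
    have "(P * e - \<beta>) / (1 - e) + \<beta> = (P - \<beta>) * (e / (1 - e))" "(P * e - \<beta>) / (1 - e) + P = (P - \<beta>) / (1 - e)"
      if "e < 1" for e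
      using that by (simp_all add: field_simps)
    from this[OF s[OF that]] show "\<phi> t + \<beta> = (P - \<beta>) * (exp (- c * t) / (1 - exp (- c * t)))"
      "\<phi> t + P = (P - \<beta>) / (1 - exp (- c * t))"
      by (simp_all add: \<phi>_def)
  qed
  show gt: "\<phi> t > - \<beta>" if "t > 0" for t
  proof -
    have "(P - \<beta>) * (exp (- c * t) / (1 - exp (- c * t))) > 0"
      using Pb s[OF that] by (intro mult_pos_pos divide_pos_pos) auto
    then show ?thesis using plus(1)[OF that] by linarith
  qed
  show der: "(\<phi> has_real_derivative c * (\<phi> t + \<beta>) * (w * \<phi> t + \<beta> * c) / (4 * k * \<beta>\<^sup>2)) (at t)" if t: "t > 0" for t
  proof -
    define e where "e = exp (- c * t)"
    have e: "1 - e \<noteq> 0" using s[OF t] unfolding e_def by linarith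
    have "(\<phi> has_real_derivative ((P * (e * (- c))) * (1 - e) - (P * e - \<beta>) * (- (e * (- c)))) / ((1 - e) * (1 - e))) (at t)"
      unfolding \<phi>_def e_def
      by (rule derivative_eq_intros refl | use e in \<open>simp add: e_def\<close>)+
    also have "(P * (e * (- c))) * (1 - e) - (P * e - \<beta>) * (- (e * (- c))) = - (c * ((P - \<beta>) * e))"
      by (simp add: algebra_simps)
    also have "- (c * ((P - \<beta>) * e)) / ((1 - e) * (1 - e)) = c * ((P - \<beta>) * (e / (1 - e))) * (- 1 / (1 - e))"
      by simp
    also have "- 1 / (1 - e) = (w * (\<phi> t + P)) / (4 * k * \<beta>\<^sup>2)"
    proof -
      have "w * (\<phi> t + P) = (w * (P - \<beta>)) / (1 - e)" using plus(2)[OF t] by (simp add: e_def)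
      then have "w * (\<phi> t + P) = - (4 * k * \<beta>\<^sup>2) / (1 - e)" unfolding wPb .
      then show ?thesis using k b by simp
    qed
    also have "c * ((P - \<beta>) * (e / (1 - e))) = c * (\<phi> t + \<beta>)" using plus(1)[OF t] by (simp add: e_def)
    also have "w * (\<phi> t + P) = w * \<phi> t + \<beta> * c" using wP by (simp add: algebra_simps)
    finally show ?thesis by simp
  qed
  show "continuous_on {0<..} \<phi>"
    by (rule continuous_at_imp_continuous_on) (use der in \<open>auto intro: DERIV_isCont\<close>)
  show "\<exists>\<delta>>0. \<forall>t. 0 < t \<and> t < \<delta> \<longrightarrow> \<phi> t > B"
  proof (intro exI conjI allI impI)
    define C where "C = \<bar>B + \<beta>\<bar> + 1"
    have C: "C > 0" "C > B + \<beta>" by (auto simp: C_def)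
    show "min (1 / (2 * c)) ((P - \<beta>) / (2 * c * C)) > 0" using c Pb C by simp
    fix t assume t: "0 < t \<and> t < min (1 / (2 * c)) ((P - \<beta>) / (2 * c * C))"
    then have ct: "2 * c * t < 1" "2 * c * t * C < P - \<beta>" using c C by (auto simp: field_simps)
    \<comment> \<open>For c t < 1/2 the exponential is at least 1/2 and 1 minus it is at most c t,
      so the quotient is at least 1 / (2 c t).\<close>
    have e1: "exp (- c * t) \<ge> 1 - c * t" using exp_ge_add_one_self[of "- c * t"] by simp
    have "(1/2) / (c * t) \<le> exp (- c * t) / (1 - exp (- c * t))"
      using e1 ct s[of t] t c by (intro frac_le) auto
    then have "(P - \<beta>) * ((1/2) / (c * t)) \<le> \<phi> t + \<beta>"
      unfolding plus(1)[OF conjunct1[OF t]] using Pb by (intro mult_left_mono) auto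
    moreover have "C < (P - \<beta>) * ((1/2) / (c * t))"
      using ct(2) c t by (simp add: field_simps)
    ultimately show "\<phi> t > B" using C by linarith
  qed
qed

text \<open>For w \<ge> 0 the equation of \<open>comparison_a\<close> has no solution descending
  from infinity at t = 0. As 2 k \<beta> + c > 0, the coefficient (2 k \<beta> + c) \<phi> + \<beta>
  c is nonnegative for large \<phi>, and \<phi>' = -k \<phi>^2 serves instead. \<open>T\<close> is
  the zero of that coefficient along 1 / (k t); from there on \<phi> solves the equation of
  \<open>comparison_a\<close>, in a form that makes sense for w = 0.\<close>

lemma comparison_b:
  fixes k c \<beta> w T :: real
  assumes k: "k > 0" and b: "\<beta> < 0" and c: "c > 0" and w: "w = 4 * k * \<beta> + c" "w \<ge> 0"
    and T: "T = (2 * k * \<beta> + c) / (k * (- \<beta> * c))"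
  defines "\<phi> \<equiv> \<lambda>t. if t \<le> T then 1 / (k * t) else (- \<beta> * c * (exp (c * (t - T)) + 1)) / (w + c * exp (c * (t - T)))"
  shows "continuous_on {0<..} \<phi>" "\<exists>\<delta>>0. \<forall>t. 0 < t \<and> t < \<delta> \<longrightarrow> \<phi> t > B"
    "t > 0 \<Longrightarrow> \<phi> t > 0"
    "t > 0 \<Longrightarrow> \<exists>d. (\<phi> has_real_derivative d) (at t within {..t}) \<and> k * (\<phi> t)\<^sup>2 + d \<ge> 0 \<and>
      ((2 * k * \<beta> + c) * \<phi> t + \<beta> * c \<ge> 0 \<or> k * (\<phi> t)\<^sup>2 + d \<ge> ((2 * k * \<beta> + c) * \<phi> t + \<beta> * c)\<^sup>2 / (4 * k * \<beta>\<^sup>2))"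
proof -
  have kb: "4 * k * \<beta>\<^sup>2 > 0" using k b by simp
  have bc: "- \<beta> * c > 0" using b c by (simp add: mult_neg_pos)
  have v: "2 * k * \<beta> + c > 0" using w c by linarith
  have Tpos: "T > 0" unfolding T by (rule divide_pos_pos[OF v mult_pos_pos[OF k bc]])
  define D where "D t = w + c * exp (c * (t - T))" for t
  define \<phi>2 where "\<phi>2 t = (- \<beta> * c * (exp (c * (t - T)) + 1)) / D t" for t
  have D: "D t > 0" for t unfolding D_def using w c by (intro add_nonneg_pos mult_pos_pos) auto
  have \<phi>_eq: "\<phi> = (\<lambda>t. if t \<le> T then 1 / (k * t) else \<phi>2 t)" unfolding \<phi>_def \<phi>2_def D_def ..
  \<comment> \<open>Both branches take the value -\<beta> c / (2 k \<beta> + c) at \<open>T\<close>,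
    the zero of the coefficient of E.\<close>
  have TT: "1 / (k * T) = \<phi>2 T"
  proof -
    have "k * T = (2 * k * \<beta> + c) / (- \<beta> * c)" unfolding T using k by simp
    moreover have "\<phi>2 T = (- \<beta> * c) / (2 * k * \<beta> + c)"
    proof -
      have "D T = 2 * (2 * k * \<beta> + c)" by (simp add: D_def w(1))
      then show ?thesis using v by (simp add: \<phi>2_def field_simps)
    qed
    ultimately show ?thesis by simp
  qed
  have der1: "((\<lambda>t. 1 / (k * t)) has_real_derivative - 1 / (k * t\<^sup>2)) (at t)" if "t > 0" for t
    using that k by (auto intro!: derivative_eq_intros simp: power2_eq_square field_simps)
  have der2: "(\<phi>2 has_real_derivative - (4 * k * \<beta>\<^sup>2 * c\<^sup>2 * exp (c * (t - T))) / (D t)\<^sup>2) (at t)" for t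
  proof -
    define e where "e = exp (c * (t - T))"
    have D': "D t = w + c * e" by (simp add: D_def e_def)
    have "(\<phi>2 has_real_derivative ((- \<beta> * c * (e * c)) * D t - (- \<beta> * c * (e + 1)) * (c * (e * c))) / (D t * D t)) (at t)"
      unfolding \<phi>2_def[abs_def] D_def e_def
      by (rule derivative_eq_intros refl | use D[of t] in \<open>simp add: D_def\<close>)+
    also have "(- \<beta> * c * (e * c)) * D t - (- \<beta> * c * (e + 1)) * (c * (e * c)) = - (4 * k * \<beta>\<^sup>2 * c\<^sup>2 * e)"
      unfolding D' w(1) by (simp add: power2_eq_square algebra_simps)
    finally show ?thesis by (simp add: power2_eq_square e_def)
  qed
  show pos: "\<phi> t > 0" if "t > 0" for t
  proof (cases "t \<le> T")
    case True then show ?thesis using that k by (simp add: \<phi>_eq)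
  next
    case False
    have "\<phi>2 t > 0" unfolding \<phi>2_def by (rule divide_pos_pos[OF mult_pos_pos[OF bc] D]) (simp add: add_pos_pos)
    then show ?thesis using False by (simp add: \<phi>_eq)
  qed
  show "continuous_on {0<..} \<phi>"
    unfolding \<phi>_eq
  proof (rule continuous_on_cases_le)
    show "continuous_on {t \<in> {0<..}. t \<le> T} (\<lambda>t. 1 / (k * t))"
      by (rule continuous_at_imp_continuous_on) (use der1 in \<open>auto intro: DERIV_isCont\<close>)
    show "continuous_on {t \<in> {0<..}. T \<le> t} \<phi>2"
      by (rule continuous_at_imp_continuous_on) (use der2 in \<open>auto intro: DERIV_isCont\<close>)
  qed (use TT in \<open>auto intro: continuous_intros\<close>)
  show "\<exists>\<delta>>0. \<forall>t. 0 < t \<and> t < \<delta> \<longrightarrow> \<phi> t > B"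
  proof (intro exI conjI allI impI)
    show "min T (1 / (k * (\<bar>B\<bar> + 1))) > 0" using Tpos k by (simp add: add_nonneg_pos)
    fix t assume t: "0 < t \<and> t < min T (1 / (k * (\<bar>B\<bar> + 1)))"
    then have "t * (k * (\<bar>B\<bar> + 1)) < 1" using k by (simp add: pos_less_divide_eq add_nonneg_pos)
    then have "\<bar>B\<bar> + 1 < 1 / (k * t)" using t k by (simp add: pos_less_divide_eq mult_ac)
    then show "\<phi> t > B" using t by (simp add: \<phi>_eq)
  qed
  assume t: "t > 0"
  show "\<exists>d. (\<phi> has_real_derivative d) (at t within {..t}) \<and> k * (\<phi> t)\<^sup>2 + d \<ge> 0 \<and>
      ((2 * k * \<beta> + c) * \<phi> t + \<beta> * c \<ge> 0 \<or> k * (\<phi> t)\<^sup>2 + d \<ge> ((2 * k * \<beta> + c) * \<phi> t + \<beta> * c)\<^sup>2 / (4 * k * \<beta>\<^sup>2))"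
  proof (cases "t \<le> T")
    case True
    \<comment> \<open>To the left of t only the first branch is seen, also for t = T.\<close>
    have "(\<phi> has_real_derivative - 1 / (k * t\<^sup>2)) (at t within {..t})"
      by (rule has_field_derivative_transform_within[OF has_field_derivative_at_within[OF der1[OF t]], of 1])
        (use True in \<open>auto simp: \<phi>_eq\<close>)
    moreover have "k * (\<phi> t)\<^sup>2 + - 1 / (k * t\<^sup>2) = 0"
      using True t k by (simp add: \<phi>_eq power2_eq_square field_simps)
    moreover have "(2 * k * \<beta> + c) * \<phi> t + \<beta> * c \<ge> 0"
    proof -
      have "t * (k * (- \<beta> * c)) \<le> 2 * k * \<beta> + c"
        using True k bc unfolding T by (simp only: pos_le_divide_eq mult_pos_pos)
      then have "- \<beta> * c \<le> (2 * k * \<beta> + c) / (k * t)"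
        using t k by (simp add: pos_le_divide_eq mult_ac)
      then show ?thesis using True by (simp add: \<phi>_eq)
    qed
    ultimately show ?thesis by (intro exI[of _ "- 1 / (k * t\<^sup>2)"]) auto
  next
    case False
    define e where "e = exp (c * (t - T))"
    define d where "d = - (4 * k * \<beta>\<^sup>2 * c\<^sup>2 * e) / (D t)\<^sup>2"
    have \<phi>t: "\<phi> t = \<phi>2 t" using False by (simp add: \<phi>_eq)
    have D': "D t = w + c * e" "D t \<noteq> 0" using D[of t] by (auto simp: D_def e_def)
    have "(\<phi> has_real_derivative d) (at t within {..t})"
    proof (rule has_field_derivative_at_within, rule has_field_derivative_transform_within_open[OF _ open_greaterThan[of T]])
      show "(\<phi>2 has_real_derivative d) (at t)" unfolding d_def e_def by (rule der2)
    qed (use False in \<open>auto simp: \<phi>_eq\<close>)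
    \<comment> \<open>\<open>p1\<close> and \<open>p2\<close> are the two linear factors of the
      equation for \<phi>; their product is the derivative, which makes the discriminant vanish
      exactly.\<close>
    moreover have ode: "k * (\<phi> t)\<^sup>2 + d = ((2 * k * \<beta> + c) * \<phi> t + \<beta> * c)\<^sup>2 / (4 * k * \<beta>\<^sup>2)"
    proof -
      have p1: "\<phi> t + \<beta> = 4 * k * \<beta>\<^sup>2 / D t"
        using D' unfolding \<phi>t \<phi>2_def e_def[symmetric]
        by (simp add: w(1) power2_eq_square field_simps)
      have p2: "w * \<phi> t + \<beta> * c = - (4 * k * \<beta>\<^sup>2 * c * e) / D t"
        using D' unfolding \<phi>t \<phi>2_def e_def[symmetric]
        by (simp add: w(1) power2_eq_square field_simps)
      have "c * (\<phi> t + \<beta>) * (w * \<phi> t + \<beta> * c) = 4 * k * \<beta>\<^sup>2 * d"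
        unfolding p1 p2 d_def by (simp add: power2_eq_square)
      moreover have "((2 * k * \<beta> + c) * \<phi> t + \<beta> * c)\<^sup>2 = 4 * k * \<beta>\<^sup>2 * (k * (\<phi> t)\<^sup>2) + c * (\<phi> t + \<beta>) * (w * \<phi> t + \<beta> * c)"
        unfolding w(1) by (simp add: power2_eq_square algebra_simps)
      ultimately have "((2 * k * \<beta> + c) * \<phi> t + \<beta> * c)\<^sup>2 = 4 * k * \<beta>\<^sup>2 * (k * (\<phi> t)\<^sup>2 + d)"
        by (simp add: distrib_left)
      then show ?thesis using kb by (metis less_irrefl nonzero_mult_div_cancel_left)
    qed
    moreover have "((2 * k * \<beta> + c) * \<phi> t + \<beta> * c)\<^sup>2 / (4 * k * \<beta>\<^sup>2) \<ge> 0" using kb by simp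
    ultimately show ?thesis by (intro exI[of _ d]) auto
  qed
qed

text \<open>Both cases are instances of \<open>harnack_abstract\<close>: with k = 2 (1 - \<alpha>) /
  n and w = 4 k \<beta> + c the two functions of time become those of \<open>comparison_a\<close>
  and \<open>comparison_b\<close>.\<close>

theorem theorem1:
  fixes M :: "'a::t2_space set"
    and A :: "('a, 'n::finite) chart set"
    and g :: "('a, 'n) metric"
    and f u :: "'a \<Rightarrow> real \<Rightarrow> real"
    and n :: nat
    and c \<alpha> \<beta> T\<^sub>2 :: real
  assumes n: "n = CARD('n)"
    and M: "closed_riemannian_manifold M A g"
    and Ric: "nonneg_ricci A g"
    and c: "c > 0"
    and f_reg: "C21 A f"
    and f_pos: "\<And>x t. x \<in> M \<Longrightarrow> t \<ge> 0 \<Longrightarrow> f x t > 0"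
    and f_eq: "\<And>x t. x \<in> M \<Longrightarrow> t \<ge> 0 \<Longrightarrow>
      time_deriv f x t = laplacian A g (\<lambda>y. f y t) x + c * f x t * (1 - f x t)"
    and u: "u = (\<lambda>x t. ln (f x t))"
    and i: "0 < \<alpha>" "\<alpha> < 1"
    and ii: "\<beta> \<le> (- c * n * (1 + \<alpha>)) / (4 * \<alpha>^2 - 4 * \<alpha> + 2 * n)"
            "(- c * n * (1 + \<alpha>)) / (4 * \<alpha>^2 - 4 * \<alpha> + 2 * n) < 0"
    and T\<^sub>2: "T\<^sub>2 = n / (2 * (1 - \<alpha>) * (- \<beta> * c)) * (4 * \<beta> * (1 - \<alpha>) / n + c)"
  shows
    "(8 * \<beta> * (1 - \<alpha>) / n + c < 0 \<longrightarrow>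
      (\<forall>x\<in>M. \<forall>t>0.
        laplacian A g (\<lambda>y. u y t) x + \<alpha> * (grad_norm A g (\<lambda>y. u y t) x)^2 + \<beta> * exp (u x t)
          + ((\<beta> * c * n / (c * n + 8 * \<beta> * (1 - \<alpha>))) * exp (- c * t) - \<beta>) / (1 - exp (- c * t))
        \<ge> 0)) \<and>
     (8 * \<beta> * (1 - \<alpha>) / n + c \<ge> 0 \<longrightarrow>
      (\<forall>x\<in>M. \<forall>t>0.
        laplacian A g (\<lambda>y. u y t) x + \<alpha> * (grad_norm A g (\<lambda>y. u y t) x)^2 + \<beta> * exp (u x t)
          + (if t \<le> T\<^sub>2 then n / (2 * (1 - \<alpha>) * t)
             else (- \<beta> * c * (exp (c * (t - T\<^sub>2)) + 1))
                    / (c + 8 * \<beta> * (1 - \<alpha>) / n + c * exp (c * (t - T\<^sub>2))))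
        \<ge> 0))"
proof -
  have n0: "real n > 0" using n by simp
  define k where "k = 2 * (1 - \<alpha>) / n"
  have k: "k > 0" using i n0 by (simp add: k_def)
  have b: "\<beta> < 0" using ii by linarith
  define w where "w = 4 * k * \<beta> + c"
  have w_eq: "8 * \<beta> * (1 - \<alpha>) / n + c = w" by (simp add: w_def k_def)
  have \<gamma>: "2 * k * \<alpha> * \<beta> - 2 * \<beta> - c * (1 + \<alpha>) \<ge> 0"
  proof -
    have "n \<ge> 1" using n0 by simp
    \<comment> \<open>The denominator in (ii) is (2 \<alpha> - 1)^2 + 2 n - 1, positive since n
      \<ge> 1, so (ii) may be multiplied out.\<close>
    then have D: "4 * \<alpha>\<^sup>2 - 4 * \<alpha> + 2 * n > 0"
      using zero_le_power2[of "2 * \<alpha> - 1"] by (simp add: power2_eq_square algebra_simps)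
    then have "\<beta> * (4 * \<alpha>\<^sup>2 - 4 * \<alpha> + 2 * n) \<le> - c * n * (1 + \<alpha>)"
      using ii(1) pos_le_divide_eq[OF D] by blast
    moreover have "n * (2 * k * \<alpha> * \<beta> - 2 * \<beta> - c * (1 + \<alpha>)) = - c * n * (1 + \<alpha>) - \<beta> * (4 * \<alpha>\<^sup>2 - 4 * \<alpha> + 2 * n)"
      using n0 by (simp add: k_def power2_eq_square field_simps)
    ultimately have "n * (2 * k * \<alpha> * \<beta> - 2 * \<beta> - c * (1 + \<alpha>)) \<ge> 0" by simp
    then show ?thesis using n0 by (simp add: zero_le_mult_iff)
  qed
  have poly: "2 * (1 - \<alpha>) * ((\<alpha> * X + \<beta> * E + p)\<^sup>2 / CARD('n)) + c * E * (p + (1 - \<alpha>) * X + \<beta>) - 2 * (\<beta> + c) * E * X + d > 0"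
    if "p > 0" "X \<ge> 0" "E > 0" "k * \<beta>\<^sup>2 * E\<^sup>2 + E * ((2 * k * \<beta> + c) * p + \<beta> * c) + k * p\<^sup>2 + d > 0" for p X E d
    using reaction_polynomial_pos[OF k less_imp_le[OF i(1)] that(1-3) \<gamma> that(4)] by (simp add: k_def n)
  note harnack = harnack_abstract[OF M f_reg f_pos f_eq u Ric less_imp_le[OF i(2)]]
  show ?thesis unfolding w_eq
  proof (intro conjI impI ballI allI)
    fix x t assume w0: "w < 0" and x: "x \<in> M" and t: "(t::real) > 0"
    define P where "P = \<beta> * c * n / (c * n + 8 * \<beta> * (1 - \<alpha>))"
    have P: "P = \<beta> * c / w"
    proof -
      have "c * n + 8 * \<beta> * (1 - \<alpha>) = n * w" using n0 by (simp add: w_def k_def field_simps)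
      then show ?thesis using n0 by (simp add: P_def)
    qed
    note cmp = comparison_a[OF k b c w_def w0 P]
    show "laplacian A g (\<lambda>y. u y t) x + \<alpha> * (grad_norm A g (\<lambda>y. u y t) x)\<^sup>2 + \<beta> * exp (u x t)
        + (P * exp (- c * t) - \<beta>) / (1 - exp (- c * t)) \<ge> 0"
    proof (rule harnack[OF _ _ _ _ cmp(1,2) _ x t])
      fix t :: real assume t: "t > 0"
      let ?\<phi> = "\<lambda>t. (P * exp (- c * t) - \<beta>) / (1 - exp (- c * t))"
      have "k * \<beta>\<^sup>2 * E\<^sup>2 + E * ((2 * k * \<beta> + c) * p + \<beta> * c) + k * p\<^sup>2
          + c * (?\<phi> t + \<beta>) * (w * ?\<phi> t + \<beta> * c) / (4 * k * \<beta>\<^sup>2) > 0" if "p > ?\<phi> t" for p E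
        by (rule quadratic_pos_a[OF k b c _ cmp(3)[OF t] that]) (use w0 in \<open>simp_all add: w_def\<close>)
      then show "\<exists>\<phi>'. (?\<phi> has_real_derivative \<phi>') (at t within {..t}) \<and>
         (\<forall>p X E. ?\<phi> t < p \<longrightarrow> 0 \<le> X \<longrightarrow> 0 < E \<longrightarrow>
           0 < 2 * (1 - \<alpha>) * ((\<alpha> * X + \<beta> * E + p)\<^sup>2 / CARD('n)) + c * E * (p + (1 - \<alpha>) * X + \<beta>) - 2 * (\<beta> + c) * E * X + \<phi>')"
        using cmp(3)[OF t] b
        by (intro exI[of _ "c * (?\<phi> t + \<beta>) * (w * ?\<phi> t + \<beta> * c) / (4 * k * \<beta>\<^sup>2)"] conjI allI impI
            has_field_derivative_at_within[OF cmp(4)[OF t]] poly) auto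
    qed
  next
    fix x t assume w0: "w \<ge> 0" and x: "x \<in> M" and t: "(t::real) > 0"
    have T: "T\<^sub>2 = (2 * k * \<beta> + c) / (k * (- \<beta> * c))"
      using n0 i b c by (simp add: T\<^sub>2 k_def field_simps)
    let ?\<phi> = "\<lambda>t. if t \<le> T\<^sub>2 then 1 / (k * t) else (- \<beta> * c * (exp (c * (t - T\<^sub>2)) + 1)) / (w + c * exp (c * (t - T\<^sub>2)))"
    note cmp = comparison_b[OF k b c w_def w0 T]
    have v: "2 * k * \<beta> + c > 0" using w0 c by (simp add: w_def)
    have H: "laplacian A g (\<lambda>y. u y t) x + \<alpha> * (grad_norm A g (\<lambda>y. u y t) x)\<^sup>2 + \<beta> * exp (u x t) + ?\<phi> t \<ge> 0"
    proof (rule harnack[OF _ _ _ _ cmp(1,2) _ x t])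
      fix t :: real assume t: "t > 0"
      obtain d where d: "(?\<phi> has_real_derivative d) (at t within {..t})" "k * (?\<phi> t)\<^sup>2 + d \<ge> 0"
        "(2 * k * \<beta> + c) * ?\<phi> t + \<beta> * c \<ge> 0 \<or> k * (?\<phi> t)\<^sup>2 + d \<ge> ((2 * k * \<beta> + c) * ?\<phi> t + \<beta> * c)\<^sup>2 / (4 * k * \<beta>\<^sup>2)"
        using cmp(4)[OF t] by blast
      show "\<exists>\<phi>'. (?\<phi> has_real_derivative \<phi>') (at t within {..t}) \<and>
         (\<forall>p X E. ?\<phi> t < p \<longrightarrow> 0 \<le> X \<longrightarrow> 0 < E \<longrightarrow>
           0 < 2 * (1 - \<alpha>) * ((\<alpha> * X + \<beta> * E + p)\<^sup>2 / CARD('n)) + c * E * (p + (1 - \<alpha>) * X + \<beta>) - 2 * (\<beta> + c) * E * X + \<phi>')"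
      proof (intro exI[of _ d] conjI allI impI d(1))
        fix p X E :: real assume p: "?\<phi> t < p" and X: "0 \<le> X" and E: "0 < E"
        have "p > 0" using p cmp(3)[OF t] by (rule less_trans[rotated])
        then show "0 < 2 * (1 - \<alpha>) * ((\<alpha> * X + \<beta> * E + p)\<^sup>2 / CARD('n)) + c * E * (p + (1 - \<alpha>) * X + \<beta>) - 2 * (\<beta> + c) * E * X + d"
          by (rule poly[OF _ X E quadratic_pos_b[OF k b E v cmp(3)[OF t] p d(2,3)]])
      qed
    qed
    have e1: "n / (2 * (1 - \<alpha>) * t) = 1 / (k * t)"
      using n0 by (simp add: k_def)
    have e2: "c + 8 * \<beta> * (1 - \<alpha>) / n = w" using w_eq by simp
    show "laplacian A g (\<lambda>y. u y t) x + \<alpha> * (grad_norm A g (\<lambda>y. u y t) x)\<^sup>2 + \<beta> * exp (u x t)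
        + (if t \<le> T\<^sub>2 then n / (2 * (1 - \<alpha>) * t) else (- \<beta> * c * (exp (c * (t - T\<^sub>2)) + 1)) / (c + 8 * \<beta> * (1 - \<alpha>) / n + c * exp (c * (t - T\<^sub>2)))) \<ge> 0"
      unfolding e1 e2 by (rule H)
  qed
qed

end
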